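(* Let $n$ be a positive integer and let $d$ be an integer with $0\le d\le n-1$. (i) For every point $\Theta=(\theta_1,\dots,\theta_n)\in\mathbf{R}^n$ such that $1,\theta_1,\dots,\theta_n$ are linearly independent over $\mathbf{Q}$, we have $$ \omega_d(\Theta)\ge\frac{d+1}{n-d}. $$ (ii) For almost all $\Theta$ with respect to Lebesgue measure on $\mathbf{R}^n$, equality $\omega_d(\Theta)=\frac{d+1}{n-d}$ holds. (iii) The spectrum of the function $\omega_d$, i.e. the set of values $\omega_d(\Theta)$ when $\Theta=(\theta_1,\dots,\theta_n)$ ranges over the points of $\mathbf{R}^n$ with $1,\theta_1,\dots,\theta_n$ linearly independent over $\mathbf{Q}$, is equal to the whole interval $\left[\frac{d+1}{n-d},+\infty\right]$ (with $+\infty$ included).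
   Context: Identify $\mathbf{R}^n$ with a subset of $\mathbf{P}^n(\mathbf{R})$ via $(x_1,\dots,x_n)\mapsto(1,x_1,\dots,x_n)$, so that $\Theta$ is also viewed as the point of $\mathbf{P}^n(\mathbf{R})$ with homogeneous coordinates $(1,\theta_1,\dots,\theta_n)$. Projective distance: equip $\mathbf{R}^{n+1}$ with the usual dot product and the Grassmann algebra $\Lambda(\mathbf{R}^{n+1})$ with the induced inner product (for any orthonormal basis $e_0,\dots,e_n$ of $\mathbf{R}^{n+1}$, the products $e_{i_1}\wedge\dots\wedge e_{i_k}$, $0\le i_1<\dots<i_k\le n$, $0\le k\le n+1$, form an orthonormal basis); $|\cdot|$ denotes the Euclidean norm. For points $P,Q\in\mathbf{P}^n(\mathbf{R})$ with homogeneous coordinates $\mathbf{x},\mathbf{y}$, put $\mathrm{d}(P,Q)=\frac{|\mathbf{x}\wedge\mathbf{y}|}{|\mathbf{x}|\,|\mathbf{y}|}$. For a real linear subvariety $L\subset\mathbf{P}^n(\mathbf{R})$ put $\mathrm{d}(\Theta,L)=\min_{P\in L}\mathrm{d}(\Theta,P)$, the minimum being over the real points of $L$. Height: a $d$-dimensional linear subvariety is $L=\mathbf{P}(V)$ with $V\subset\mathbf{R}^{n+1}$ a linear subspace of dimension $d+1$. Its Plücker coordinates are $\mathbf{X}=\mathbf{x}_0\wedge\dots\wedge\mathbf{x}_d\in\Lambda^{d+1}(\mathbf{R}^{n+1})\cong\mathbf{R}^{\binom{n+1}{d+1}}$ for any basis $\mathbf{x}_0,\dots,\mathbf{x}_d$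 of $V$ (well defined up to a nonzero real scalar). $L$ is rational (over $\mathbf{Q}$) if $V$ is spanned by vectors of $\mathbf{Q}^{n+1}$. For rational $L$, the height $H(L)$ is the Weil height of a system of rational Plücker coordinates of $L$, normalized with the Euclidean norm at the Archimedean place; that is, $H(L)=|\mathbf{X}|$ when the Plücker coordinates $\mathbf{X}$ are chosen to be integers with greatest common divisor $1$. Exponents: for an integer $d$ with $0\le d\le n-1$, $\omega_d(\Theta)$ is the supremum (possibly $+\infty$) of the real numbers $\omega$ for which there exist infinitely many rational linear subvarieties $L\subset\mathbf{P}^n(\mathbf{R})$ with $\dim(L)=d$ and $\mathrm{d}(\Theta,L)\le H(L)^{-1-\omega}$. *)

theory Defs
  imports "HOL-Analysis.Analysis" "HOL-Library.Option_ord"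
begin

text \<open>
  The ambient dimension \<open>n\<close> is \<open>CARD('n)\<close>; homogeneous coordinates are indexed by \<^typ>\<open>'n option\<close>,
  with \<^term>\<open>None\<close> the index of the zeroth one. The order on indices only fixes the signs of the
  basis \<open>e\<^sub>I\<close> below; norms and heights do not depend on it.
\<close>

section \<open>Grassmann algebra\<close>

text \<open>
  The Grassmann algebra of \<^typ>\<open>real ^ 'i\<close> is modelled on \<^typ>\<open>real ^ 'i set\<close>: the coordinate at
  \<open>I\<close> is the coefficient of the product \<open>e\<^sub>I\<close> of the \<open>e\<^sub>i\<close> (\<open>i \<in> I\<close>) in increasing order. The
  library norm of \<^typ>\<open>real ^ 'i set\<close> is then the one for which the \<open>e\<^sub>I\<close> are orthonormal. For
  disjoint \<open>I\<close>, \<open>J\<close> one has \<open>e\<^sub>I \<and> e\<^sub>J = wedge_sign I J * e\<^sub>K\<close> with \<open>K = I \<union> J\<close>; for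
  overlapping ones the product is zero.
\<close>

definition wedge_sign :: "'i::linorder set \<Rightarrow> 'i set \<Rightarrow> real" where
  "wedge_sign I J = (-1) ^ card {(i, j). i \<in> I \<and> j \<in> J \<and> j < i}"

definition wedge :: "real ^ 'i set \<Rightarrow> real ^ 'i set \<Rightarrow> real ^ ('i::{finite,linorder}) set" where
  "wedge X Y = (\<chi> K. \<Sum>I\<in>Pow K. wedge_sign I (K - I) * X $ I * Y $ (K - I))"

definition grade1 :: "real ^ ('i::{finite,linorder}) \<Rightarrow> real ^ 'i set" where
  "grade1 x = (\<Sum>i\<in>UNIV. axis {i} (x $ i))"

definition wedge_list :: "(real ^ ('i::{finite,linorder})) list \<Rightarrow> real ^ 'i set" where
  "wedge_list xs = foldr (\<lambda>x. wedge (grade1 x)) xs (axis {} 1)"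

section \<open>Projective distance\<close>

definition homog :: "real ^ ('n::finite) \<Rightarrow> real ^ 'n option" where
  "homog \<Theta> = (\<chi> j. case j of None \<Rightarrow> 1 | Some i \<Rightarrow> \<Theta> $ i)"

text \<open>A projective point is given by any of its (nonzero) vectors of homogeneous coordinates.\<close>

definition proj_dist :: "real ^ ('i::{finite,linorder}) \<Rightarrow> real ^ ('i::{finite,linorder}) \<Rightarrow> real" where
  "proj_dist x y = norm (wedge (grade1 x) (grade1 y)) / (norm x * norm y)"

text \<open>
  A linear subvariety \<open>\<P>(V)\<close> is represented by the linear subspace \<open>V\<close>. The infimum
  is attained when \<open>V\<close> is a nonzero subspace, by compactness of its unit sphere.
\<close>

definition proj_dist_subvariety ::
    "real ^ ('i::{finite,linorder}) \<Rightarrow> (real ^ ('i::{finite,linorder})) set \<Rightarrow> real" where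
  "proj_dist_subvariety x V = (INF y\<in>V - {0}. proj_dist x y)"

section \<open>Rational linear subvarieties and their height\<close>

definition rational_subspace :: "(real ^ ('i::finite)) set \<Rightarrow> bool" where
  "rational_subspace V \<longleftrightarrow> (\<exists>S. (\<forall>x\<in>S. \<forall>i. x $ i \<in> \<rat>) \<and> V = span S)"

definition rational_subvarieties :: "nat \<Rightarrow> (real ^ ('i::finite)) set set" where
  "rational_subvarieties d = {V. rational_subspace V \<and> dim V = d + 1}"

text \<open>All systems of Pluecker coordinates of \<open>\<P>(V)\<close>, one for each ordered basis of \<open>V\<close>.\<close>

definition pluecker :: "(real ^ ('i::{finite,linorder})) set \<Rightarrow> (real ^ 'i set) set" where
  "pluecker V = {wedge_list xs | xs. distinct xs \<and> independent (set xs) \<and> span (set xs) = V}"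

text \<open>Coordinates of the wrong degree are zero and do not affect the greatest common divisor.\<close>

definition primitive :: "real ^ ('i::finite) \<Rightarrow> bool" where
  "primitive X \<longleftrightarrow> (\<forall>i. X $ i \<in> \<int>) \<and> Gcd {k::int. \<exists>i. X $ i = of_int k} = 1"

text \<open>For rational \<open>V\<close>, the primitive Pluecker coordinates exist and are unique up to sign.\<close>

definition height :: "(real ^ ('i::{finite,linorder})) set \<Rightarrow> real" where
  "height V = (THE h. \<exists>X\<in>pluecker V. primitive X \<and> h = norm X)"

section \<open>Exponents\<close>

definition omega :: "nat \<Rightarrow> real ^ ('n::{finite,linorder}) \<Rightarrow> ereal" where
  "omega d \<Theta> = Sup {ereal w | w.
     infinite {V \<in> rational_subvarieties d.
       proj_dist_subvariety (homog \<Theta>) V \<le> height V powr (- 1 - w)}}"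

definition one_and_coords_lin_indep_rat :: "real ^ ('n::finite) \<Rightarrow> bool" where
  "one_and_coords_lin_indep_rat \<Theta> \<longleftrightarrow>
     (\<forall>(a::rat) (b::'n \<Rightarrow> rat).
        of_rat a * 1 + (\<Sum>i\<in>UNIV. of_rat (b i) * \<Theta> $ i) = 0 \<longrightarrow> a = 0 \<and> (\<forall>i. b i = 0))"

end

(*
  Write N = n + 1 and xi = (1, Theta). The key step is going up: a rational V of dimension k < N lies
  in a rational V' of dimension k + 1 with H(V') <= C H(V)^(1 - 1/(N - k)). Up to a constant, H(V) is
  the number of integral vectors modulo V and modulo the coordinate directions transverse to V, so
  by the pigeonhole principle some integral z outside V is very close to V, and V' = V + R z.

  Starting from the lines through simultaneous rational approximations of exponent w, going up gives
  omega_d >= n (1 + w)/(n - d) - 1; Dirichlet's w = 1/n is (i). Going up from an arbitrary V to a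
  hyperplane turns a lower bound |a + b.Theta| >= c |b|^(-tau) for integral linear forms into
  omega_d <= (1 + tau)/(n - d) - 1; almost every Theta has such bounds for all tau > n, which
  is (ii).

  The two estimates agree when tau = n (1 + w) - 1. For every w > 1/n a Theta with both properties is
  obtained from Baire's theorem: near a point all of whose linear forms are large there is a ball
  around a Dirichlet approximation p/q, of radius about q^(-1-w), in which the linear forms that are
  too small somewhere only cover a small proportion. This is (iii) for finite values, and a Liouville
  point has omega_d = infinity.
*)

theory Submission
  imports Defs
begin

section \<open>Exterior algebra\<close>

text \<open>Heights are only ever bounded from above, by the norm of some integral Pluecker vector.
  For V' = V + R z this vector is z \<and> X = (z - v) \<and> X with v in V, so the distance
  H(V)^(-1/(N - k)) reached by pigeonhole is directly the gain in height. The exponents 1 - 1/(N -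
  k) telescope to (N - b)/(N - a) between dimensions a and b.

  The obstacle in (iii) is to keep every linear form large while forcing better and better
  approximations p/q. The dangerous forms vanish at p/q itself. Their coefficient vectors b have
  length almost q^(1/n) at least, and where such a form drops below |b|^(-tau) it covers a share of
  about q^(1 + w) |b|^(-tau - 1) of a ball of radius q^(-1 - w). With |b| = q^(1/n) the balance is
  tau = n (1 + w) - 1, the very value at which the two estimates for omega_d agree.

  Infinitely many perturbations must not exhaust the constant in the lower bound. Each starting
  point therefore has a constant strictly above a fixed c0, and each new point is chosen extremal,
  which almost every point is, so that the next perturbation can start from it.\<close>

lemma grade1_singleton [simp]: "grade1 x $ {i} = x $ i"
  by (simp add: grade1_def axis_def if_distrib cong: if_cong)

lemma grade1_eq_0: "(\<And>i. I \<noteq> {i}) \<Longrightarrow> grade1 x $ I = 0"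
  by (simp add: grade1_def axis_def)

lemma linear_grade1: "linear grade1"
proof (rule linearI)
  fix x y :: "real ^ 'a::{finite,linorder}" and c :: real
  show "grade1 (x + y) = grade1 x + grade1 y"
  proof (rule vec_eq_iff[THEN iffD2, OF allI])
    fix I show "grade1 (x + y) $ I = (grade1 x + grade1 y) $ I"
      by (cases "\<exists>i. I = {i}") (auto simp: grade1_eq_0)
  qed
  show "grade1 (c *\<^sub>R x) = c *\<^sub>R grade1 x"
  proof (rule vec_eq_iff[THEN iffD2, OF allI])
    fix I show "grade1 (c *\<^sub>R x) $ I = (c *\<^sub>R grade1 x) $ I"
      by (cases "\<exists>i. I = {i}") (auto simp: grade1_eq_0)
  qed
qed

lemma wedge_sign_singleton: "wedge_sign {i} L = (-1) ^ card {j \<in> L. j < i}"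
proof -
  have "{(a, j). a \<in> {i} \<and> j \<in> L \<and> j < a} = Pair i ` {j \<in> L. j < i}"
    by auto
  then show ?thesis
    by (simp add: wedge_sign_def card_image inj_on_def)
qed

lemma abs_wedge_sign [simp]: "\<bar>wedge_sign I J\<bar> = 1"
  by (simp add: wedge_sign_def power_abs)

lemma bilinear_wedge: "bilinear wedge"
  unfolding bilinear_def
  by (intro conjI allI linearI; vector wedge_def)
     (simp_all add: algebra_simps sum.distrib sum_distrib_left)

text \<open>Laplace expansion along the first factor: \<open>grade1 x\<close> lives on singletons,
  so of all splittings of \<open>K\<close> only those that remove one index survive.\<close>

lemma wedge_grade1_nth:
  "wedge (grade1 x) Y $ K = (\<Sum>i\<in>K. wedge_sign {i} (K - {i}) * x $ i * Y $ (K - {i}))"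
proof -
  have "wedge (grade1 x) Y $ K = (\<Sum>I\<in>(\<lambda>i. {i}) ` K. wedge_sign I (K - I) * grade1 x $ I * Y $ (K - I))"
    unfolding wedge_def vec_lambda_beta
  proof (rule sum.mono_neutral_right)
    show "\<forall>I\<in>Pow K - (\<lambda>i. {i}) ` K. wedge_sign I (K - I) * grade1 x $ I * Y $ (K - I) = 0"
    proof
      fix I assume "I \<in> Pow K - (\<lambda>i. {i}) ` K"
      then have "I \<noteq> {i}" for i by auto
      then show "wedge_sign I (K - I) * grade1 x $ I * Y $ (K - I) = 0"
        by (simp add: grade1_eq_0)
    qed
  qed auto
  then show ?thesis
    by (simp add: sum.reindex)
qed

text \<open>Deleting \<open>j\<close> from \<open>K\<close> changes the number of elements below
  \<open>i\<close> exactly when \<open>j < i\<close>. Of two distinct indices exactly one lies below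
  the other, so exchanging the order of removal flips exactly one sign.\<close>

lemma wedge_sign_swap:
  fixes K :: "'i::{finite,linorder} set"
  assumes "i \<noteq> j" "i \<in> K" "j \<in> K"
  shows "wedge_sign {i} (K - {i}) * wedge_sign {j} (K - {i} - {j}) =
         - (wedge_sign {j} (K - {j}) * wedge_sign {i} (K - {j} - {i}))"
proof -
  have *: "wedge_sign {i} (K - {i}) = (if j < i then - 1 else 1) * wedge_sign {i} (K - {i} - {j})"
    if "i \<noteq> j" "j \<in> K" for i j
  proof -
    have "{l \<in> K - {i}. l < i} = (if j < i then insert j {l \<in> K - {i} - {j}. l < i} else {l \<in> K - {i} - {j}. l < i})"
      using that by auto
    moreover have "card (insert j {l \<in> K - {i} - {j}. l < i}) = Suc (card {l \<in> K - {i} - {j}. l < i})"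
      by (subst card_insert_disjoint) auto
    ultimately show ?thesis
      by (simp add: wedge_sign_singleton del: Diff_iff)
  qed
  have "K - {j} - {i} = K - {i} - {j}" by auto
  then show ?thesis
    using *[of i j] *[of j i] assms by (cases "i < j") auto
qed

lemma wedge_grade1_anticommute:
  "wedge (grade1 x) (wedge (grade1 y) Z) = - wedge (grade1 y) (wedge (grade1 x) Z)"
proof -
  define t where "t x y K i j = wedge_sign {i} (K - {i}) * wedge_sign {j} (K - {i} - {j})
      * x $ i * y $ j * Z $ (K - {i} - {j})" for x y :: "real ^ 'a::{finite,linorder}" and K i j
  \<comment> \<open>The inner index properly ranges over \<open>K - {i}\<close>. Padding the
    diagonal with zeros makes both ranges equal to \<open>K\<close>, so that the two sums can be
    interchanged.\<close>
  have expand: "wedge (grade1 x) (wedge (grade1 y) Z) $ K = (\<Sum>i\<in>K. \<Sum>j\<in>K. if i = j then 0 else t x y K i j)"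
    for x y K
  proof -
    have "(\<Sum>j\<in>K. if i = j then 0 else t x y K i j) = (\<Sum>j\<in>K - {i}. t x y K i j)" for i
      by (rule sum.mono_neutral_cong_right) auto
    then show ?thesis
      by (simp add: wedge_grade1_nth t_def sum_distrib_left mult_ac)
  qed
  have t_swap: "t x y K i j = - t y x K j i" if "i \<noteq> j" "i \<in> K" "j \<in> K" for K i j
  proof -
    have "K - {j} - {i} = K - {i} - {j}" by auto
    then show ?thesis
      using wedge_sign_swap[OF that] by (simp add: t_def)
  qed
  have "wedge (grade1 x) (wedge (grade1 y) Z) $ K = - wedge (grade1 y) (wedge (grade1 x) Z) $ K" for K
  proof -
    have "(\<Sum>i\<in>K. \<Sum>j\<in>K. if i = j then 0 else t x y K i j)
        = (\<Sum>i\<in>K. \<Sum>j\<in>K. - (if j = i then 0 else t y x K j i))"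
      by (intro sum.cong refl) (auto simp: t_swap)
    also have "\<dots> = - (\<Sum>j\<in>K. \<Sum>i\<in>K. if j = i then 0 else t y x K j i)"
      by (subst sum.swap) (simp add: sum_negf)
    finally show ?thesis
      by (simp add: expand)
  qed
  then show ?thesis
    by (simp add: vec_eq_iff)
qed

lemma wedge_grade1_self: "wedge (grade1 x) (wedge (grade1 x) Z) = 0"
  using wedge_grade1_anticommute[of x x Z] by (simp add: vec_eq_iff)

section \<open>Products of lists of vectors\<close>

lemma wedge_list_Nil [simp]: "wedge_list [] = axis {} 1"
  by (simp add: wedge_list_def)

lemma wedge_list_Cons [simp]: "wedge_list (x # xs) = wedge (grade1 x) (wedge_list xs)"
  by (simp add: wedge_list_def)

lemmas wedge_linear_simps =
  bilinear_ladd[OF bilinear_wedge] bilinear_radd[OF bilinear_wedge]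
  bilinear_lmul[OF bilinear_wedge] bilinear_rmul[OF bilinear_wedge]
  bilinear_lneg[OF bilinear_wedge] bilinear_rneg[OF bilinear_wedge]
  bilinear_lzero[OF bilinear_wedge] bilinear_rzero[OF bilinear_wedge]
  linear_add[OF linear_grade1] linear_scale[OF linear_grade1] linear_0[OF linear_grade1]

lemma wedge_list_move_front:
  "wedge_list (as @ z # bs) = (-1) ^ length as *\<^sub>R wedge_list (z # as @ bs)"
  by (induction as) (simp_all add: wedge_linear_simps, metis wedge_grade1_anticommute scaleR_minus_right)

lemma wedge_list_member:
  assumes "z \<in> set xs" shows "wedge (grade1 z) (wedge_list xs) = 0"
proof -
  obtain as bs where "xs = as @ z # bs"
    using assms by (meson split_list)
  then show ?thesis
    by (simp add: wedge_list_move_front wedge_linear_simps wedge_grade1_self)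
qed

lemma wedge_list_not_distinct: "\<not> distinct xs \<Longrightarrow> wedge_list xs = 0"
  by (induction xs) (auto simp: wedge_list_member wedge_linear_simps)

lemma wedge_list_span_member:
  assumes "v \<in> span (set xs)" shows "wedge (grade1 v) (wedge_list xs) = 0"
  using assms
proof (induction rule: span_induct_alt)
  case base
  then show ?case by (simp add: wedge_linear_simps)
next
  case (step c x y)
  then show ?case by (simp add: wedge_linear_simps wedge_list_member)
qed

text \<open>Moving the head of one list to the front of the other costs a sign and leaves shorter
  lists. Which sign arises is left open, because only the line spanned by the product matters
  later.\<close>

lemma wedge_list_permute:
  "distinct xs \<Longrightarrow> distinct ys \<Longrightarrow> set xs = set ys \<Longrightarrow> wedge_list xs \<in> {wedge_list ys, - wedge_list ys}"
proof (induction xs arbitrary: ys)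
  case Nil
  then show ?case by simp
next
  case (Cons x xs)
  then obtain as bs where ys: "ys = as @ x # bs"
    by (metis list.set_intros(1) split_list)
  have "wedge_list xs \<in> {wedge_list (as @ bs), - wedge_list (as @ bs)}"
    using Cons.prems ys by (intro Cons.IH) auto
  then show ?case
    unfolding ys wedge_list_move_front
    by (cases "even (length as)") (auto simp: wedge_linear_simps)
qed

text \<open>Multilinear expansion in a form that avoids coefficients. The lists \<open>zs\<close>
  may repeat entries; these are discarded afterwards, where their product is seen to vanish.\<close>

lemma wedge_list_in_span_sublists:
  assumes "set ys \<subseteq> span B"
  shows "wedge_list ys \<in> span {wedge_list zs | zs. length zs = length ys \<and> set zs \<subseteq> B}"
  using assms
proof (induction ys)
  case Nil
  then show ?case by (auto intro: span_base)
next
  case (Cons y ys)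
  let ?S = "\<lambda>m. {wedge_list zs | zs. length zs = m \<and> set zs \<subseteq> B}"
  have *: "wedge (grade1 b) Z \<in> span (?S (Suc m))" if "b \<in> B" "Z \<in> span (?S m)" for b Z m
    using that(2)
  proof (induction rule: span_induct_alt)
    case base
    then show ?case by (simp add: wedge_linear_simps span_zero)
  next
    case (step c Z W)
    then obtain zs where zs: "Z = wedge_list zs" "length zs = m" "set zs \<subseteq> B" by auto
    have "wedge_list (b # zs) \<in> ?S (Suc m)"
      using zs that(1) by (intro CollectI exI[of _ "b # zs"]) auto
    from span_base[OF this] have "wedge (grade1 b) Z \<in> span (?S (Suc m))"
      unfolding zs(1) wedge_list_Cons .
    then show ?case
      using step by (simp add: wedge_linear_simps span_add span_scale)
  qed
  have "wedge (grade1 y) Z \<in> span (?S (Suc m))" if Z: "Z \<in> span (?S m)" for Z m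
  proof -
    have "y \<in> span B" using Cons.prems by simp
    then show ?thesis
    proof (induction rule: span_induct_alt)
      case base
      then show ?case by (simp add: wedge_linear_simps span_zero)
    next
      case (step c b w)
      then show ?case
        using *[OF _ Z] by (simp add: wedge_linear_simps span_add span_scale)
    qed
  qed
  then show ?case
    using Cons by simp
qed

text \<open>The top exterior power is at most one-dimensional: among the lists of the right length
  with entries in \<open>set xs\<close>, those with a repetition give zero and the others are
  permutations of \<open>xs\<close>.\<close>

lemma wedge_list_proportional:
  assumes "set ys \<subseteq> span (set xs)" "distinct xs" "length ys = length xs"
  obtains t where "wedge_list ys = t *\<^sub>R wedge_list xs"
proof -
  have "wedge_list ys \<in> span {wedge_list zs | zs. length zs = length ys \<and> set zs \<subseteq> set xs}"
    by (rule wedge_list_in_span_sublists[OF assms(1)])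
  also have "\<dots> \<subseteq> span {wedge_list xs}"
  proof (rule span_minimal[OF _ subspace_span], safe)
    fix zs assume zs: "length zs = length ys" "set zs \<subseteq> set xs"
    show "wedge_list zs \<in> span {wedge_list xs}"
    proof (cases "distinct zs")
      case True
      then have "set zs = set xs"
        using zs assms by (metis card_subset_eq distinct_card finite_set)
      then have "wedge_list zs \<in> {wedge_list xs, - wedge_list xs}"
        using True assms(2) by (intro wedge_list_permute)
      then show ?thesis
        using span_base[of "wedge_list xs" "{wedge_list xs}"] by (auto intro: span_neg)
    qed (simp add: wedge_list_not_distinct span_zero)
  qed
  finally show thesis
    using that by (auto simp: span_singleton)
qed

lemma wedge_list_axes:
  "distinct is \<Longrightarrow> \<bar>wedge_list (map (\<lambda>i. axis i 1) is) $ set is\<bar> = 1"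
proof (induction "is")
  case (Cons i "is")
  let ?Y = "wedge_list (map (\<lambda>i. axis i 1) is)"
  have "wedge (grade1 (axis i 1)) ?Y $ insert i (set is)
      = (\<Sum>j\<in>insert i (set is). if j = i then wedge_sign {i} (set is) * ?Y $ (set is) else 0)"
    unfolding wedge_grade1_nth using Cons.prems by (intro sum.cong) (auto simp: axis_def)
  then show ?case
    using Cons by (simp add: abs_mult)
qed (simp add: axis_def)

lemma wedge_list_append_0: "wedge_list xs = 0 \<Longrightarrow> wedge_list (ys @ xs) = 0"
  by (induction ys) (auto simp: wedge_linear_simps)

text \<open>If the product vanished, so would the product of a basis of the whole space that
  contains \<open>set xs\<close>. The product of the unit vectors is a multiple of the latter and
  would vanish too, but it has a coordinate of absolute value 1.\<close>

lemma wedge_list_nonzero: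
  assumes "distinct xs" "independent (set xs)"
  shows "wedge_list xs \<noteq> (0 :: real ^ ('i::{finite,linorder}) set)"
proof
  assume 0: "wedge_list xs = 0"
  obtain B where B: "set xs \<subseteq> B" "independent B" "span B = (UNIV :: (real ^ 'i::{finite,linorder}) set)"
    by (metis assms(2) extend_basis_superset independent_extend_basis span_extend_basis)
  have "finite B" using B(2) by (rule independent_imp_finite)
  then obtain ys where ys: "set ys = B - set xs" "distinct ys"
    by (meson finite_Diff finite_distinct_list)
  have d: "distinct (ys @ xs)" and s: "set (ys @ xs) = B"
    using ys assms B by auto
  obtain "is" :: "'i::{finite,linorder} list" where i: "set is = UNIV" "distinct is"
    using finite_distinct_list[OF finite] by blast
  have "card B = CARD('i)"
    using dim_eq_card_independent[OF B(2)] dim_span[of B] B(3) by simp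
  then have len: "length is = length (ys @ xs)"
    using distinct_card[OF d] distinct_card[OF i(2)] unfolding s i(1) by simp
  obtain t where "wedge_list (map (\<lambda>i. axis i 1) is) = t *\<^sub>R wedge_list (ys @ xs)"
    by (rule wedge_list_proportional[of "map (\<lambda>i. axis i 1) is" "ys @ xs"])
       (simp_all only: d s B(3) len length_map subset_UNIV)
  then show False
    using wedge_list_axes[OF i(2)] wedge_list_append_0[OF 0] by simp
qed

text \<open>The annihilator of the product recovers the span. Later this decides membership in
  \<open>V\<close> through its Pluecker coordinates and shows that they determine
  \<open>V\<close>.\<close>

lemma wedge_list_eq_0_iff:
  assumes "distinct xs" "independent (set xs)"
  shows "wedge (grade1 v) (wedge_list xs) = 0 \<longleftrightarrow> v \<in> span (set xs)"
proof
  assume *: "wedge (grade1 v) (wedge_list xs) = 0"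
  show "v \<in> span (set xs)"
  proof (rule ccontr)
    assume v: "v \<notin> span (set xs)"
    then have "v \<notin> set xs" "independent (set (v # xs))"
      using assms by (auto simp: independent_insert span_base)
    then have "wedge_list (v # xs) \<noteq> 0"
      using assms by (intro wedge_list_nonzero) auto
    then show False using * by simp
  qed
qed (rule wedge_list_span_member)

lemma wedge_list_wrong_grade: "card K \<noteq> length xs \<Longrightarrow> wedge_list xs $ K = 0"
proof (induction xs arbitrary: K)
  case Nil
  then show ?case by (auto simp: axis_def)
next
  case (Cons x xs)
  show ?case
    unfolding wedge_list_Cons wedge_grade1_nth
  proof (rule sum.neutral, safe)
    fix i assume "i \<in> K"
    then have "card (K - {i}) \<noteq> length xs"
      using Cons.prems by (simp add: card_Diff_singleton) (metis Suc_pred card_gt_0_iff empty_iff finite)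
    then show "wedge_sign {i} (K - {i}) * x $ i * wedge_list xs $ (K - {i}) = 0"
      using Cons.IH by simp
  qed
qed

lemma wedge_list_vanish:
  "(\<And>x. x \<in> set xs \<Longrightarrow> x $ i = 0) \<Longrightarrow> i \<in> K \<Longrightarrow> wedge_list xs $ K = 0"
proof (induction xs arbitrary: K)
  case (Cons x xs)
  show ?case
    unfolding wedge_list_Cons wedge_grade1_nth
  proof (rule sum.neutral, safe)
    fix j assume "j \<in> K"
    show "wedge_sign {j} (K - {j}) * x $ j * wedge_list xs $ (K - {j}) = 0"
      using Cons by (cases "j = i") auto
  qed
qed (auto simp: axis_def)

lemma wedge_sign_Ints: "wedge_sign I J \<in> \<int>"
  by (simp add: wedge_sign_def)

lemma wedge_grade1_Ints:
  "(\<And>i. x $ i \<in> \<int>) \<Longrightarrow> (\<And>I. X $ I \<in> \<int>) \<Longrightarrow> wedge (grade1 x) X $ K \<in> \<int>"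
  unfolding wedge_grade1_nth by (intro Ints_sum Ints_mult wedge_sign_Ints)

lemma wedge_list_Ints:
  "(\<And>x i. x \<in> set xs \<Longrightarrow> x $ i \<in> \<int>) \<Longrightarrow> wedge_list xs $ K \<in> \<int>"
  by (induction xs arbitrary: K) (simp add: axis_def, simp add: wedge_grade1_Ints)

section \<open>Heights and integral vectors near a rational subspace\<close>

lemma wedge_list_nonzero_imp_independent:
  assumes "wedge_list xs \<noteq> 0"
  shows "distinct xs" "independent (set xs)"
proof -
  show d: "distinct xs"
    using assms wedge_list_not_distinct by blast
  show "independent (set xs)"
  proof
    assume "dependent (set xs)"
    then obtain x where x: "x \<in> set xs" "x \<in> span (set xs - {x})"
      unfolding dependent_def by blast
    then obtain as bs where xs: "xs = as @ x # bs"
      by (meson split_list)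
    then have "set xs - {x} = set (as @ bs)"
      using d by auto
    then have "wedge (grade1 x) (wedge_list (as @ bs)) = 0"
      using x by (metis wedge_list_span_member)
    then show False
      using assms by (simp add: xs wedge_list_move_front)
  qed
qed

section \<open>Pluecker coordinates and heights\<close>

lemma plueckerI:
  assumes "subspace V" "set xs \<subseteq> V" "length xs = dim V" "wedge_list xs \<noteq> 0"
  shows "wedge_list xs \<in> pluecker V"
proof -
  note xs = wedge_list_nonzero_imp_independent[OF assms(4)]
  have "span (set xs) = V"
    using assms xs by (metis card_eq_dim distinct_card finite_set span_minimal subset_antisym)
  then show ?thesis
    using xs by (auto simp: pluecker_def)
qed

lemma pluecker_nonzero: "X \<in> pluecker V \<Longrightarrow> X \<noteq> 0"
  using wedge_list_nonzero by (auto simp: pluecker_def)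

lemma pluecker_cases:
  assumes "X \<in> pluecker V"
  obtains xs where "X = wedge_list xs" "distinct xs" "independent (set xs)" "span (set xs) = V"
    "length xs = dim V" "set xs \<subseteq> V"
  using assms unfolding pluecker_def
  by (auto simp: distinct_card[symmetric] dim_eq_card_independent span_superset)

lemma pluecker_subspace: "X \<in> pluecker V \<Longrightarrow> subspace V"
  by (auto simp: pluecker_def)

lemma pluecker_proportional:
  assumes "X \<in> pluecker V" "Y \<in> pluecker V"
  obtains t where "t \<noteq> 0" "Y = t *\<^sub>R X"
proof -
  obtain xs ys where "X = wedge_list xs" "distinct xs" "span (set xs) = V" "length xs = dim V"
    "Y = wedge_list ys" "set ys \<subseteq> V" "length ys = dim V"
    using assms by (elim pluecker_cases) auto
  then obtain t where "Y = t *\<^sub>R X"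
    by (metis wedge_list_proportional)
  then show thesis
    using pluecker_nonzero[OF assms(2)] that by force
qed

text \<open>The scalar is put into the first basis vector, which is why the dimension must be
  positive: the zero subspace has \<open>axis {} 1\<close> as its only Pluecker coordinates.\<close>

lemma pluecker_scale:
  assumes "X \<in> pluecker V" "t \<noteq> 0" "dim V \<ge> 1"
  shows "t *\<^sub>R X \<in> pluecker V"
proof -
  obtain xs where xs: "X = wedge_list xs" "length xs = dim V" "set xs \<subseteq> V"
    using assms(1) by (elim pluecker_cases) auto
  then obtain y ys where y: "xs = y # ys"
    using assms(3) by (metis list.exhaust list.size(3) not_one_le_zero)
  have "wedge_list ((t *\<^sub>R y) # ys) = t *\<^sub>R X"
    by (simp add: xs y wedge_linear_simps)
  moreover have "subspace V" using assms(1) by (rule pluecker_subspace)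
  moreover have "wedge_list ((t *\<^sub>R y) # ys) \<in> pluecker V"
    using xs y assms pluecker_nonzero[OF assms(1)] \<open>subspace V\<close> calculation(1)
    by (intro plueckerI) (auto intro: subspace_scale)
  ultimately show ?thesis by simp
qed

lemma pluecker_mem_iff:
  assumes "X \<in> pluecker V"
  shows "v \<in> V \<longleftrightarrow> wedge (grade1 v) X = 0"
  using assms wedge_list_eq_0_iff by (auto simp: pluecker_def)

text \<open>In lowest terms \<open>t = a / b\<close>, the denominator divides every coordinate of
  \<open>X\<close>, hence their greatest common divisor 1. This turns real proportionality to
  primitive coordinates into integral proportionality.\<close>

lemma primitive_multiple_Ints:
  assumes X: "primitive X" and t: "\<And>i. t * X $ i \<in> \<int>"
  shows "t \<in> \<int>"
proof -
  let ?A = "{k::int. \<exists>i. X $ i = of_int k}"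
  have int: "X $ i \<in> \<int>" for i
    using X by (auto simp: primitive_def)
  \<comment> \<open>A greatest common divisor of 1 excludes that all coordinates vanish; a nonzero
    one shows that \<open>t\<close> is rational.\<close>
  have "\<not> ?A \<subseteq> {0}"
    using X by (auto simp: primitive_def simp flip: Gcd_0_iff)
  then obtain k i where k: "X $ i = of_int k" "k \<noteq> 0" by auto
  obtain l where "t * of_int k = of_int l"
    using t[of i] k by (auto elim: Ints_cases)
  then have "t = of_int l / of_int k"
    using k by (simp add: field_simps)
  then have "t \<in> \<rat>" by simp
  then obtain a b where ab: "b > 0" "coprime a b" "t = of_int a / of_int b"
    by (rule Rats_cases')
  have "b dvd k" if "k \<in> ?A" for k
  proof -
    obtain i where i: "X $ i = of_int k" using \<open>k \<in> ?A\<close> by auto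
    obtain l where "t * of_int k = of_int l"
      using t[of i] i by (auto elim: Ints_cases)
    then have "of_int (a * k) = (of_int (b * l) :: real)"
      using ab by (simp add: field_simps)
    then have "a * k = b * l" by linarith
    then show "b dvd k"
      using ab(2) by (metis coprime_commute coprime_dvd_mult_right_iff dvd_triv_left)
  qed
  then have "b dvd Gcd ?A" by (rule Gcd_greatest)
  then have "b = 1"
    using X ab(1) by (simp add: primitive_def)
  then show ?thesis using ab by simp
qed

text \<open>Two primitive systems differ by a factor \<open>t\<close> such that \<open>t\<close> and
  its inverse are both integers, so \<open>\<bar>t\<bar> = 1\<close>. This is the uniqueness behind
  \<open>THE\<close>.\<close>

lemma height_eq:
  assumes "X \<in> pluecker V" "primitive X"
  shows "height V = norm X"
  unfolding height_def
proof (rule the_equality)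
  fix h assume "\<exists>Y\<in>pluecker V. primitive Y \<and> h = norm Y"
  then obtain Y where Y: "Y \<in> pluecker V" "primitive Y" "h = norm Y" by blast
  obtain t where t: "t \<noteq> 0" "Y = t *\<^sub>R X"
    using pluecker_proportional[OF assms(1) Y(1)] .
  have "t \<in> \<int>"
    by (rule primitive_multiple_Ints[OF assms(2)]) (use Y t in \<open>auto simp: primitive_def\<close>)
  moreover have "inverse t \<in> \<int>"
    by (rule primitive_multiple_Ints[OF Y(2)]) (use assms t in \<open>auto simp: primitive_def mult.assoc[symmetric]\<close>)
  ultimately have "\<bar>t\<bar> \<ge> 1" "\<bar>inverse t\<bar> \<ge> 1"
    using t(1) Ints_nonzero_abs_ge1[of t] Ints_nonzero_abs_ge1[of "inverse t"] by simp_all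
  then have "\<bar>t\<bar> = 1"
    unfolding abs_inverse one_le_inverse_iff by linarith
  then show "h = norm X"
    using Y t by simp
qed (use assms in auto)

lemma primitive_divide_Gcd:
  assumes int: "\<And>i. X $ i \<in> \<int>" and "X \<noteq> 0"
  obtains g where "g \<ge> 1" "primitive ((1 / real_of_int g) *\<^sub>R X)"
proof -
  define A where "A = {k::int. \<exists>i. X $ i = of_int k}"
  define g where "g = Gcd A"
  obtain i where i: "X $ i \<noteq> 0" using \<open>X \<noteq> 0\<close> by (auto simp: vec_eq_iff)
  obtain k where k: "X $ i = of_int k" using int[of i] by (auto elim: Ints_cases)
  have "g dvd k" unfolding g_def A_def using k by (intro Gcd_dvd) auto
  then have "g \<noteq> 0" using i k by auto
  then have g: "g > 0"
    unfolding g_def using Gcd_int_greater_eq_0 by (metis order_le_less)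
  let ?Y = "(1 / real_of_int g) *\<^sub>R X"
  define A' where "A' = {k::int. \<exists>i. ?Y $ i = of_int k}"
  have Y: "\<exists>l. X $ i = of_int (g * l) \<and> ?Y $ i = of_int l" for i
  proof -
    obtain k where k: "X $ i = of_int k" using int[of i] by (auto elim: Ints_cases)
    have "g dvd k" unfolding g_def A_def using k by (intro Gcd_dvd) auto
    then show ?thesis using k g by auto
  qed
  have "A = (*) g ` A'"
  proof (intro equalityI subsetI)
    fix k assume "k \<in> A"
    then obtain i where "X $ i = of_int k" by (auto simp: A_def)
    with Y[of i] obtain l where "k = g * l" "?Y $ i = of_int l"
      by (metis of_int_eq_iff)
    then show "k \<in> (*) g ` A'" by (auto simp: A'_def)
  next
    fix k assume "k \<in> (*) g ` A'"
    then obtain l i where "k = g * l" "?Y $ i = of_int l" by (auto simp: A'_def)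
    with Y[of i] show "k \<in> A" by (auto simp: A_def)
  qed
  then have "Gcd A = normalize (g * Gcd A')"
    by (simp add: Gcd_mult)
  then have "g = g * Gcd A'"
    using g by (simp add: g_def[symmetric] abs_mult)
  then have "Gcd A' = 1" using g by simp
  moreover have "?Y $ i \<in> \<int>" for i using Y[of i] by (metis Ints_of_int)
  ultimately have "primitive ?Y"
    unfolding primitive_def A'_def by blast
  then show thesis using g by (intro that[of g]) auto
qed

text \<open>Dividing by the greatest common divisor can only shorten the vector. Upper bounds for
  heights of newly built subspaces come from here, so that their primitive coordinates need not be
  known.\<close>

lemma pluecker_integral_height_le:
  assumes "X \<in> pluecker V" "dim V \<ge> 1" "\<And>i. X $ i \<in> \<int>"
  shows "\<exists>Y\<in>pluecker V. primitive Y" "height V \<le> norm X"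
proof -
  obtain g where g: "g \<ge> 1" "primitive ((1 / real_of_int g) *\<^sub>R X)"
    using primitive_divide_Gcd assms pluecker_nonzero by metis
  have *: "(1 / real_of_int g) *\<^sub>R X \<in> pluecker V"
    using assms g by (intro pluecker_scale) auto
  then show "\<exists>Y\<in>pluecker V. primitive Y" using g by blast
  have "height V = norm X / g"
    using height_eq[OF * g(2)] g by simp
  then show "height V \<le> norm X"
    using g divide_left_mono[of 1 "real_of_int g" "norm X"] by simp
qed

section \<open>Integral points of rational subspaces\<close>

abbreviation integral_vectors :: "(real ^ 'i::finite) set" where
  "integral_vectors \<equiv> {x. \<forall>i. x $ i \<in> \<int>}"

lemma rational_vector_multiple:
  fixes x :: "real ^ 'i::finite"
  assumes "\<And>i. x $ i \<in> \<rat>"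
  obtains D :: int where "D > 0" "of_int D *\<^sub>R x \<in> integral_vectors"
proof -
  have "\<exists>b::int. b > 0 \<and> of_int b * x $ i \<in> \<int>" for i
  proof -
    obtain a b where "b > 0" "x $ i = of_int a / of_int b"
      using assms[of i] by (auto elim: Rats_cases')
    then have "of_int b * x $ i = of_int a" by simp
    then show ?thesis using \<open>b > 0\<close> by (metis Ints_of_int)
  qed
  then obtain b where b: "\<And>i. b i > (0::int)" "\<And>i. of_int (b i) * x $ i \<in> \<int>"
    by metis
  have "of_int (prod b UNIV) * x $ i \<in> \<int>" for i
  proof -
    have "prod b UNIV = prod b (UNIV - {i}) * b i"
      by (simp add: prod.remove[of UNIV i])
    then have "of_int (prod b UNIV) * x $ i = of_int (prod b (UNIV - {i})) * (of_int (b i) * x $ i)"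
      by (simp only: of_int_mult mult.assoc)
    then show ?thesis
      using Ints_mult[OF Ints_of_int b(2)] by (simp only:)
  qed
  then show thesis
    using b(1) by (intro that[of "prod b UNIV"]) (auto intro: prod_pos)
qed

lemma rational_subspace_span_integral:
  assumes "rational_subspace V"
  shows "subspace V" "span (V \<inter> integral_vectors) = V"
proof -
  obtain S where S: "\<And>x i. x \<in> S \<Longrightarrow> x $ i \<in> \<rat>" "V = span S"
    using assms by (auto simp: rational_subspace_def)
  show V: "subspace V" using S by simp
  have "S \<subseteq> span (V \<inter> integral_vectors)"
  proof
    fix x assume x: "x \<in> S"
    then obtain D :: int where D: "D > 0" "of_int D *\<^sub>R x \<in> integral_vectors"
      using S(1) rational_vector_multiple by metis
    then have "of_int D *\<^sub>R x \<in> V \<inter> integral_vectors"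
      using S(2) x by (auto intro: span_scale span_base)
    then have "(1 / of_int D) *\<^sub>R of_int D *\<^sub>R x \<in> span (V \<inter> integral_vectors)"
      by (intro span_scale span_base)
    then show "x \<in> span (V \<inter> integral_vectors)"
      using D by simp
  qed
  then show "span (V \<inter> integral_vectors) = V"
    using span_minimal[OF _ subspace_span, of S] span_minimal[OF Int_lower1 V] S(2) by blast
qed

lemma rational_subspaceI: "S \<subseteq> integral_vectors \<Longrightarrow> rational_subspace (span S)"
  unfolding rational_subspace_def using Ints_subset_Rats by blast

lemma primitive_pluecker_exists:
  assumes "rational_subspace V" "dim V \<ge> 1"
  obtains X where "X \<in> pluecker V" "primitive X"
proof -
  note V = rational_subspace_span_integral[OF assms(1)]
  obtain B where B: "B \<subseteq> V \<inter> integral_vectors" "independent B" "V \<inter> integral_vectors \<subseteq> span B"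
    by (rule maximal_independent_subset)
  have "span B = V"
    using B V span_mono[OF B(1)] span_minimal[OF B(3) subspace_span] by auto
  obtain xs where "set xs = B" "distinct xs"
    using finite_distinct_list independent_imp_finite[OF B(2)] by blast
  then have "wedge_list xs \<in> pluecker V" "wedge_list xs $ i \<in> \<int>" for i
    using B \<open>span B = V\<close> by (auto simp: pluecker_def intro!: wedge_list_Ints)
  then show thesis
    using pluecker_integral_height_le(1) assms(2) that by blast
qed

text \<open>
  A Hermite normal form that needs no choice of a lattice basis: the minimal absolute values \<open>m i\<close>
  come from eliminating one coordinate at a time, in an order that adapts to \<open>L\<close>.
\<close>

lemma triangular_generators:
  fixes L :: "(real ^ 'i::{finite,linorder}) set"
  assumes "L \<subseteq> integral_vectors" "0 \<in> L" "\<And>x y. x \<in> L \<Longrightarrow> y \<in> L \<Longrightarrow> x - y \<in> L"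
    and "\<And>x. x \<in> L \<Longrightarrow> (\<forall>i\<in>I. x $ i = 0) \<Longrightarrow> x = 0"
    and "dim L \<ge> card I"
  shows "\<exists>xs m. set xs \<subseteq> L \<and> length xs = card I \<and> (\<forall>i\<in>I. m i > (0::nat)) \<and>
    \<bar>wedge_list xs $ I\<bar> = (\<Prod>i\<in>I. real (m i)) \<and>
    (\<forall>x\<in>L. (\<forall>i\<in>I. \<bar>x $ i\<bar> < real (m i)) \<longrightarrow> x = 0)"
  using assms
proof (induction "card I" arbitrary: I L)
  case 0
  then have "I = {}" by simp
  show ?case
    using 0(5) by (intro exI[of _ "[]"]) (auto simp: \<open>I = {}\<close> axis_def)
next
  case (Suc k)
  have int: "x $ i \<in> \<int>" if "x \<in> L" for x i
    using Suc.prems(1) that by auto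
  note zero = Suc.prems(2) and diff = Suc.prems(3)
    and inj = Suc.prems(4) and dim = Suc.prems(5)
  have "\<not> L \<subseteq> {0}"
    using dim Suc.hyps(2) by (metis dim_eq_0 not_less_eq_eq zero_le)
  then obtain x0 where x0: "x0 \<in> L" "x0 \<noteq> 0" by auto
  then obtain i where i: "i \<in> I" "x0 $ i \<noteq> 0" using inj by blast
  define P where "P n \<longleftrightarrow> n > 0 \<and> (\<exists>x\<in>L. \<bar>x $ i\<bar> = real n)" for n
  have absnat: "\<exists>n::nat. \<bar>x $ i\<bar> = real n" if "x \<in> L" for x
  proof -
    obtain k where "x $ i = of_int k" using int[OF \<open>x \<in> L\<close>] by (rule Ints_cases)
    then show ?thesis by (intro exI[of _ "nat \<bar>k\<bar>"]) auto
  qed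
  have "\<exists>n. P n"
    using absnat[OF x0(1)] i x0(1) unfolding P_def by (metis abs_eq_0 bot_nat_0.not_eq_extremum of_nat_0)
  \<comment> \<open>The least positive absolute value at \<open>i\<close> on the lattice: a lattice
    vector that is smaller at \<open>i\<close> must vanish there.\<close>
  define m0 where "m0 = (LEAST n. P n)"
  have "P m0" unfolding m0_def using \<open>\<exists>n. P n\<close> by (rule LeastI_ex)
  then obtain x1 where x1: "x1 \<in> L" "\<bar>x1 $ i\<bar> = real m0" "m0 > 0" by (auto simp: P_def)
  have small: "x $ i = 0" if "x \<in> L" "\<bar>x $ i\<bar> < real m0" for x
  proof (rule ccontr)
    assume "x $ i \<noteq> 0"
    obtain n where n: "\<bar>x $ i\<bar> = real n" using absnat[OF \<open>x \<in> L\<close>] by blast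
    then have "P n" using \<open>x $ i \<noteq> 0\<close> that by (auto simp: P_def)
    then have "m0 \<le> n" unfolding m0_def by (rule Least_le)
    then show False using n that by simp
  qed
  have neg: "- x \<in> L" if "x \<in> L" for x using diff[OF zero that] by simp
  have add: "x + y \<in> L" if "x \<in> L" "y \<in> L" for x y using diff[OF that(1) neg[OF that(2)]] by simp
  have natmul: "real n *\<^sub>R x \<in> L" if "x \<in> L" for n x
    by (induction n) (auto simp: zero scaleR_left_distrib intro: add that)
  have intmul: "of_int a *\<^sub>R x \<in> L" if "x \<in> L" for a x
  proof (cases "a \<ge> 0")
    case True
    then show ?thesis using natmul[OF that, of "nat a"] by simp
  next
    case False
    then show ?thesis using neg[OF natmul[OF that, of "nat (- a)"]] by simp
  qed
  define L1 where "L1 = {x \<in> L. x $ i = 0}"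
  have "L \<subseteq> span (insert x1 L1)"
  proof
    fix x assume x: "x \<in> L"
    obtain a where a: "x1 $ i = of_int a" using int[OF x1(1)] by (rule Ints_cases)
    obtain b where b: "x $ i = of_int b" using int[OF x] by (rule Ints_cases)
    have "a \<noteq> 0" using x1 a by auto
    \<comment> \<open>Elimination over the integers: \<open>y\<close> vanishes at \<open>i\<close>,
      so adjoining the single vector \<open>x1\<close> to \<open>L1\<close> recovers the span of
      \<open>L\<close>, and the dimension drops by at most one.\<close>
    define y where "y = of_int a *\<^sub>R x - of_int b *\<^sub>R x1"
    have "y \<in> L1" using x x1 a b by (auto simp: L1_def y_def intro: diff intmul)
    then have "(1 / of_int a) *\<^sub>R (y + of_int b *\<^sub>R x1) \<in> span (insert x1 L1)"
      by (intro span_scale span_add) (auto intro: span_base span_scale)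
    then show "x \<in> span (insert x1 L1)" using \<open>a \<noteq> 0\<close> by (simp add: y_def)
  qed
  then have "dim L \<le> dim (insert x1 L1)" by (rule dim_mono)
  also have "\<dots> \<le> Suc (dim L1)" by (simp add: dim_insert)
  finally have dim1: "k \<le> dim L1" using dim Suc.hyps(2) by simp
  define I1 where "I1 = I - {i}"
  have I1: "card I1 = k" "i \<notin> I1" "I = insert i I1"
    using i Suc.hyps(2) by (auto simp: I1_def)
  have "\<exists>xs m. set xs \<subseteq> L1 \<and> length xs = card I1 \<and> (\<forall>i\<in>I1. m i > (0::nat)) \<and>
    \<bar>wedge_list xs $ I1\<bar> = (\<Prod>i\<in>I1. real (m i)) \<and>
    (\<forall>x\<in>L1. (\<forall>i\<in>I1. \<bar>x $ i\<bar> < real (m i)) \<longrightarrow> x = 0)"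
  proof (rule Suc.hyps(1))
    show "x = 0" if "x \<in> L1" "\<forall>i\<in>I1. x $ i = 0" for x
      using that by (intro inj) (auto simp: L1_def I1)
  qed (use int zero dim1 I1 in \<open>auto simp: L1_def intro: diff\<close>)
  then obtain xs m where xs: "set xs \<subseteq> L1" "length xs = k" and m: "\<And>i. i \<in> I1 \<Longrightarrow> m i > (0::nat)"
    and w: "\<bar>wedge_list xs $ I1\<bar> = (\<Prod>i\<in>I1. real (m i))"
    and sep: "\<And>x. x \<in> L1 \<Longrightarrow> (\<forall>i\<in>I1. \<bar>x $ i\<bar> < real (m i)) \<Longrightarrow> x = 0"
    using I1(1) by metis
  let ?m = "m(i := m0)"
  \<comment> \<open>Only the term that removes \<open>i\<close> survives: after removing any other
    index, \<open>i\<close> remains, and all of \<open>xs\<close> vanish there. This is the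
    triangular shape of the determinant.\<close>
  have "wedge_list (x1 # xs) $ I = (\<Sum>j\<in>I. if j = i then wedge_sign {i} I1 * x1 $ i * wedge_list xs $ I1 else 0)"
    unfolding wedge_list_Cons wedge_grade1_nth
  proof (intro sum.cong refl)
    fix j assume "j \<in> I"
    have "wedge_list xs $ (I - {j}) = 0" if "j \<noteq> i"
      using that i xs by (intro wedge_list_vanish[of _ i]) (auto simp: L1_def)
    then show "wedge_sign {j} (I - {j}) * x1 $ j * wedge_list xs $ (I - {j})
      = (if j = i then wedge_sign {i} I1 * x1 $ i * wedge_list xs $ I1 else 0)"
      by (auto simp: I1_def)
  qed
  then have "\<bar>wedge_list (x1 # xs) $ I\<bar> = real m0 * (\<Prod>i\<in>I1. real (m i))"
    using i x1 w by (simp add: abs_mult)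
  also have "\<dots> = (\<Prod>i\<in>I. real (?m i))"
    unfolding I1(3) using I1(2) by (subst prod.insert) (auto intro!: prod.cong)
  finally have "\<bar>wedge_list (x1 # xs) $ I\<bar> = (\<Prod>i\<in>I. real (?m i))" .
  moreover have "x = 0" if x: "x \<in> L" "\<forall>j\<in>I. \<bar>x $ j\<bar> < real (?m j)" for x
  proof (rule sep)
    have "\<bar>x $ i\<bar> < real m0" using x i by force
    then show "x \<in> L1" using small x by (auto simp: L1_def)
    show "\<forall>j\<in>I1. \<bar>x $ j\<bar> < real (m j)" using x I1 by (metis fun_upd_other insertCI)
  qed
  ultimately show ?case
    using xs x1 m I1 by (intro exI[of _ "x1 # xs"] exI[of _ ?m]) (auto simp: L1_def)
qed

text \<open>A nonzero coordinate at \<open>I\<close> makes \<open>V\<close> a graph over the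
  coordinate plane of \<open>I\<close>. If a nonzero \<open>v\<close> in \<open>V\<close> vanished
  on \<open>I\<close>, expanding along \<open>v\<close> as the first basis vector would give
  \<open>X $ I = 0\<close>; surjectivity is then a dimension count.\<close>

lemma pluecker_coordinate_graph:
  fixes V :: "(real ^ 'i::{finite,linorder}) set"
  assumes X: "X \<in> pluecker V" "X $ I \<noteq> 0"
  shows "card I = dim V"
    and "\<And>v. v \<in> V \<Longrightarrow> (\<forall>i\<in>I. v $ i = 0) \<Longrightarrow> v = 0"
    and "\<And>g. \<exists>v\<in>V. \<forall>i\<in>I. v $ i = g i"
proof -
  obtain xs where xs: "X = wedge_list xs" "length xs = dim V"
    using X by (elim pluecker_cases) auto
  have V: "subspace V" using X by (intro pluecker_subspace)
  show I: "card I = dim V"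
    using X xs wedge_list_wrong_grade by metis
  show inj: "v = 0" if v: "v \<in> V" "\<forall>i\<in>I. v $ i = 0" for v
  proof (rule ccontr)
    assume "v \<noteq> 0"
    then have "{v} \<subseteq> V" "independent {v}" using v by (auto simp: dependent_single)
    then obtain B where B: "{v} \<subseteq> B" "B \<subseteq> V" "independent B" "V \<subseteq> span B"
      by (rule maximal_independent_subset_extend)
    then have "finite B" by (intro independent_imp_finite)
    then obtain ys where ys: "set ys = B - {v}" "distinct ys"
      by (meson finite_Diff finite_distinct_list)
    have "span (set (v # ys)) = V" "distinct (v # ys)" "set (v # ys) = B"
      using B ys V span_minimal[of B V] by (auto simp: insert_absorb)
    then have "wedge_list (v # ys) \<in> pluecker V"
      using B by (auto simp: pluecker_def intro!: exI[of _ "v # ys"])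
    then obtain t where "X = t *\<^sub>R wedge_list (v # ys)"
      using X pluecker_proportional by blast
    moreover have "wedge_list (v # ys) $ I = 0"
      unfolding wedge_list_Cons wedge_grade1_nth by (rule sum.neutral) (use v in auto)
    ultimately show False using X by simp
  qed
  fix g
  define p where "p x = (\<chi> i. if i \<in> I then x $ i else 0)" for x :: "real ^ 'i::{finite,linorder}"
  let ?W = "{x :: real ^ 'i::{finite,linorder}. \<forall>i. i \<notin> I \<longrightarrow> x $ i = 0}"
  have "linear p"
    by (rule linearI) (auto simp: p_def vec_eq_iff)
  have "inj_on p V"
    using inj by (subst linear_inj_on_iff_eq_0) (auto simp: p_def vec_eq_iff \<open>linear p\<close> V)
  then have "dim (p ` V) = dim V"
    using \<open>linear p\<close> V by (intro dim_image_eq) (auto simp: span_eq_iff[THEN iffD2])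
  moreover have "dim ?W = card I"
    using dim_substandard_cart[where ?'a = real and d = I] unfolding dim_vec_eq .
  ultimately have "dim ?W \<le> dim (p ` V)"
    using I by simp
  moreover have "subspace (p ` V)" using \<open>linear p\<close> V by (rule linear_subspace_image)
  moreover have "subspace ?W" by (auto simp: subspace_def)
  moreover have "p ` V \<subseteq> ?W" by (auto simp: p_def)
  ultimately have "p ` V = ?W" by (intro subspace_dim_equal)
  moreover have "(\<chi> i. if i \<in> I then g i else 0) \<in> ?W" by auto
  ultimately obtain v where "v \<in> V" "p v = (\<chi> i. if i \<in> I then g i else 0)"
    by (metis (no_types, lifting) imageE)
  then show "\<exists>v\<in>V. \<forall>i\<in>I. v $ i = g i"
    by (intro bexI[of _ v]) (auto simp: p_def vec_eq_iff, metis)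
qed


text \<open>The product of the triangular generators is \<open>t\<close> times the primitive
  \<open>X\<close> for a nonzero integer \<open>t\<close>. Integrality of \<open>t\<close> gives the
  inequality, whatever the index of the generators in the lattice.\<close>

lemma triangular_generators_pluecker:
  fixes V :: "(real ^ 'i::{finite,linorder}) set"
  assumes X: "X \<in> pluecker V" "primitive X" "X $ I \<noteq> 0" and V: "rational_subspace V"
  shows "\<exists>m. (\<forall>i\<in>I. m i > (0::nat)) \<and> \<bar>X $ I\<bar> \<le> (\<Prod>i\<in>I. real (m i)) \<and>
    (\<forall>x\<in>V \<inter> integral_vectors. (\<forall>i\<in>I. \<bar>x $ i\<bar> < real (m i)) \<longrightarrow> x = 0)"
proof -
  note graph = pluecker_coordinate_graph[OF X(1,3)]
  note rat = rational_subspace_span_integral[OF V]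
  let ?L = "V \<inter> integral_vectors"
  have "\<exists>xs m. set xs \<subseteq> ?L \<and> length xs = card I \<and> (\<forall>i\<in>I. m i > (0::nat)) \<and>
    \<bar>wedge_list xs $ I\<bar> = (\<Prod>i\<in>I. real (m i)) \<and>
    (\<forall>x\<in>?L. (\<forall>i\<in>I. \<bar>x $ i\<bar> < real (m i)) \<longrightarrow> x = 0)"
  proof (rule triangular_generators)
    show "card I \<le> dim ?L"
      using graph(1) rat(2) dim_span[of ?L] by simp
  qed (use rat(1) graph(2) in \<open>auto intro: subspace_diff simp: subspace_0\<close>)
  then obtain xs m where xs: "set xs \<subseteq> ?L" "length xs = card I" and m: "\<And>i. i \<in> I \<Longrightarrow> m i > (0::nat)"
    and w: "\<bar>wedge_list xs $ I\<bar> = (\<Prod>i\<in>I. real (m i))"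
    and sep: "\<And>x. x \<in> ?L \<Longrightarrow> (\<forall>i\<in>I. \<bar>x $ i\<bar> < real (m i)) \<Longrightarrow> x = 0"
    by blast
  have pos: "(\<Prod>i\<in>I. real (m i)) > 0" using m by (simp add: prod_pos)
  have "wedge_list xs \<noteq> 0"
    using w pos by (metis abs_zero less_irrefl zero_index)
  then have "wedge_list xs \<in> pluecker V"
    using xs rat(1) graph(1) by (intro plueckerI) auto
  then obtain t where t: "t \<noteq> 0" "wedge_list xs = t *\<^sub>R X"
    using pluecker_proportional[OF X(1)] by blast
  have "t * X $ J \<in> \<int>" for J
  proof -
    have "wedge_list xs $ J \<in> \<int>" using xs by (intro wedge_list_Ints) auto
    then show ?thesis by (simp add: t(2))
  qed
  then have "t \<in> \<int>" by (rule primitive_multiple_Ints[OF X(2)])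
  then have "\<bar>t\<bar> \<ge> 1" using t(1) by (rule Ints_nonzero_abs_ge1)
  then have "\<bar>X $ I\<bar> \<le> \<bar>t * X $ I\<bar>"
    by (simp add: abs_mult mult_le_cancel_right1)
  also have "\<dots> = (\<Prod>i\<in>I. real (m i))"
    using w t(2) by simp
  finally show ?thesis
    using m sep by blast
qed

text \<open>
  The box with sides \<open>m i\<close> contains at least \<open>\<bar>X\<^sub>I\<bar>\<close> integral points of the \<open>I\<close>-plane, pairwise
  incongruent modulo \<open>V\<close>. Lifting them to \<open>V\<close> and reducing the other coordinates modulo 1, two of
  the lifts come close.
\<close>

lemma integral_vector_near_subspace:
  fixes V :: "(real ^ 'i::{finite,linorder}) set"
  assumes X: "X \<in> pluecker V" "primitive X" "X $ I \<noteq> 0" and V: "rational_subspace V"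
    and dim: "dim V < CARD('i)"
  obtains z v where "z \<in> integral_vectors" "z \<notin> V" "v \<in> V"
    "\<And>j. \<bar>(z - v) $ j\<bar> \<le> 2 * \<bar>X $ I\<bar> powr (- 1 / real (CARD('i) - dim V))"
proof -
  define M where "M = \<bar>X $ I\<bar>"
  define r where "r = CARD('i) - dim V"
  note graph = pluecker_coordinate_graph[OF X(1,3)]
  have r: "r > 0" "real r = real CARD('i) - real (dim V)" using dim by (auto simp: r_def)
  have card_compl: "card (- I) = r" using graph(1) by (simp add: Compl_eq_Diff_UNIV card_Diff_subset r_def)
  have M: "M \<ge> 1"
    using X(2,3) unfolding M_def primitive_def by (intro Ints_nonzero_abs_ge1) auto
  define a where "a = M powr (1 / r)"
  have a: "a \<ge> 1" "a ^ r = M" "M powr (- 1 / r) = 1 / a"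
    using M r(1) by (auto simp: a_def ge_one_powr_ge_zero powr_powr powr_minus_divide simp flip: powr_realpow)
  \<comment> \<open>The largest integer strictly below \<open>a\<close>. With \<open>Q\<close> bins
    for each coordinate outside \<open>I\<close> there are \<open>Q ^ r < a ^ r = M\<close> boxes,
    fewer than points.\<close>
  define Q where "Q = nat (\<lceil>a\<rceil> - 1)"
  have Q: "real Q < a" "a \<le> real Q + 1" using a(1) unfolding Q_def by linarith+
  have sub: "subspace V" using X(1) by (rule pluecker_subspace)
  show thesis
  proof (cases "Q = 0")
    \<comment> \<open>There are no bins only if \<open>M = 1\<close>. The required bound is then 2,
      and a unit vector outside \<open>I\<close> satisfies it with \<open>v = 0\<close>.\<close>
    case True
    then have "a = 1" using Q a by simp
    have "I \<noteq> UNIV" using graph(1) dim by auto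
    then obtain j where j: "j \<notin> I" by blast
    have notin: "(axis j 1 :: real ^ 'i::{finite,linorder}) \<notin> V"
    proof
      assume "(axis j 1 :: real ^ 'i::{finite,linorder}) \<in> V"
      then have "(axis j 1 :: real ^ 'i::{finite,linorder}) = 0"
        using j by (intro graph(2)) (auto simp: axis_def)
      then show False by (simp add: axis_eq_0_iff)
    qed
    have near: "\<bar>(axis j 1 - 0 :: real ^ 'i::{finite,linorder}) $ l\<bar> \<le> 2 * M powr (- 1 / r)" for l
      unfolding a(3) \<open>a = 1\<close> by (simp add: axis_def)
    have int: "(axis j 1 :: real ^ 'i::{finite,linorder}) \<in> integral_vectors"
      by (simp add: axis_def)
    show thesis
      by (rule that[OF int notin subspace_0[OF sub] near[unfolded M_def r_def]])
  next
    case False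
    obtain m where m: "\<forall>i\<in>I. m i > (0::nat)" "\<bar>X $ I\<bar> \<le> (\<Prod>i\<in>I. real (m i))"
      and sep: "\<forall>x\<in>V \<inter> integral_vectors. (\<forall>i\<in>I. \<bar>x $ i\<bar> < real (m i)) \<longrightarrow> x = 0"
      using triangular_generators_pluecker[OF X V] by blast
    define G where "G = (\<Pi>\<^sub>E i\<in>I. {..<m i})"
    obtain v where v: "\<And>g. v g \<in> V" "\<And>g i. i \<in> I \<Longrightarrow> v g $ i = g i"
      using graph(3) by metis
    define h where "h g = restrict (\<lambda>j. nat \<lfloor>frac (v (\<lambda>i. real (g i)) $ j) * Q\<rfloor>) (- I)" for g :: "'i::{finite,linorder} \<Rightarrow> nat"
    have "h ` G \<subseteq> (\<Pi>\<^sub>E j\<in>- I. {..<Q})"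
    proof (intro image_subsetI PiE_I)
      fix g j assume "j \<in> - I"
      have "frac (v (\<lambda>i. real (g i)) $ j) * Q < Q"
        using False by (simp add: frac_lt_1)
      then have "\<lfloor>frac (v (\<lambda>i. real (g i)) $ j) * Q\<rfloor> < int Q" by linarith
      moreover have "\<lfloor>frac (v (\<lambda>i. real (g i)) $ j) * Q\<rfloor> \<ge> 0" by simp
      ultimately show "h g j \<in> {..<Q}" using \<open>j \<in> - I\<close> by (simp add: h_def nat_less_iff)
    qed (auto simp: h_def)
    moreover have "finite (\<Pi>\<^sub>E j\<in>- I. {..<Q})" by (intro finite_PiE) auto
    ultimately have "card (h ` G) \<le> Q ^ r"
      using card_mono[of "\<Pi>\<^sub>E j\<in>- I. {..<Q}" "h ` G"] by (simp add: card_PiE card_compl)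
    moreover have "real (Q ^ r) < real (card G)"
    proof -
      have "real (Q ^ r) < a ^ r" using Q r(1) by (simp add: power_strict_mono)
      also have "\<dots> \<le> real (card G)" using m(2) a(2) by (simp add: G_def card_PiE M_def)
      finally show ?thesis .
    qed
    ultimately have "\<not> inj_on h G" by (intro pigeonhole) linarith
    then obtain g g' where g: "g \<in> G" "g' \<in> G" "g \<noteq> g'" "h g = h g'" by (auto simp: inj_on_def)
    define x where "x = v (\<lambda>i. real (g i))"
    define y where "y = v (\<lambda>i. real (g' i))"
    \<comment> \<open>On \<open>I\<close> it agrees with \<open>x - y\<close>. Elsewhere
      \<open>x\<close> and \<open>y\<close> are replaced by their integral parts, so the distance to
      \<open>x - y\<close> only involves fractional parts.\<close>
    define z where "z = (\<chi> j. if j \<in> I then real (g j) - real (g' j) else of_int (\<lfloor>x $ j\<rfloor> - \<lfloor>y $ j\<rfloor>))"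
    have xy: "x - y \<in> V" unfolding x_def y_def by (intro subspace_diff sub v)
    have z_int: "z \<in> integral_vectors" by (auto simp: z_def)
    have diff_I: "(z - (x - y)) $ j = 0" if "j \<in> I" for j
      using that by (simp add: z_def x_def y_def v)
    have "z \<notin> V"
    proof
      assume "z \<in> V"
      then have "z - (x - y) = 0"
        using diff_I xy sub by (intro graph(2)) (auto intro: subspace_diff)
      have "z = 0"
      proof (rule sep[rule_format, OF IntI[OF \<open>z \<in> V\<close> z_int]])
        fix i assume "i \<in> I"
        then have "g i < m i" "g' i < m i" using g by (auto simp: G_def PiE_iff)
        then show "\<bar>z $ i\<bar> < real (m i)" using \<open>i \<in> I\<close> by (simp add: z_def abs_less_iff)
      qed
      then have z0: "z $ i = 0" for i by simp
      have "g i = g' i" if "i \<in> I" for i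
        using that z0[of i] by (simp add: z_def)
      then show False
        using g by (metis G_def PiE_ext)
    qed
    have near: "\<bar>(z - (x - y)) $ j\<bar> \<le> 2 * M powr (- 1 / r)" for j
    proof (cases "j \<in> I")
      case False
      define s where "s = frac (x $ j)"
      define t where "t = frac (y $ j)"
      have "nat \<lfloor>s * Q\<rfloor> = nat \<lfloor>t * Q\<rfloor>"
        using fun_cong[OF g(4), of j] False by (simp add: h_def x_def y_def s_def t_def)
      moreover have "\<lfloor>s * Q\<rfloor> \<ge> 0" "\<lfloor>t * Q\<rfloor> \<ge> 0" by (simp_all add: s_def t_def)
      ultimately have "\<lfloor>s * Q\<rfloor> = \<lfloor>t * Q\<rfloor>" using eq_nat_nat_iff by blast
      then have "\<bar>s * Q - t * Q\<bar> < 1" by linarith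
      then have "\<bar>s - t\<bar> * Q < 1" by (simp add: abs_mult flip: left_diff_distrib)
      then have "\<bar>s - t\<bar> < 1 / Q" using \<open>Q \<noteq> 0\<close> by (simp add: field_simps)
      \<comment> \<open>The factor 2 of the statement:
        \<open>a \<le> Q + 1 \<le> 2 * Q\<close>.\<close>
      also have "1 / real Q \<le> 2 / a"
      proof -
        have "a \<le> 2 * real Q" using Q(2) \<open>Q \<noteq> 0\<close> by linarith
        then show ?thesis using a(1) \<open>Q \<noteq> 0\<close> by (simp add: field_simps)
      qed
      finally have "\<bar>s - t\<bar> \<le> 2 * M powr (- 1 / r)" unfolding a(3) by simp
      moreover have "(z - (x - y)) $ j = t - s" using False by (simp add: z_def s_def t_def frac_def)
      ultimately show ?thesis by (simp add: abs_minus_commute)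
    next
      case True
      show ?thesis unfolding diff_I[OF True] by simp
    qed
    show thesis
      by (rule that[OF z_int \<open>z \<notin> V\<close> xy near[unfolded M_def r_def]])
  qed
qed

lemma norm_wedge_le:
  obtains B where "B > 0" "\<And>X Y :: real ^ ('i::{finite,linorder}) set. norm (wedge X Y) \<le> B * norm X * norm Y"
  using bilinear_bounded_pos[OF bilinear_wedge] by metis

lemma norm_grade1: "norm (grade1 x) = norm x"
proof -
  have "(\<Sum>I\<in>UNIV. (grade1 x $ I)\<^sup>2) = (\<Sum>I\<in>range (\<lambda>i. {i}). (grade1 x $ I)\<^sup>2)"
    by (rule sum.mono_neutral_right) (auto intro!: grade1_eq_0)
  also have "\<dots> = (\<Sum>i\<in>UNIV. (x $ i)\<^sup>2)"
    by (simp add: sum.reindex)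
  finally show ?thesis
    by (simp add: norm_vec_def L2_set_def)
qed

lemma max_coordinate:
  fixes X :: "real ^ 'i::finite"
  obtains i where "norm X \<le> CARD('i) * \<bar>X $ i\<bar>"
proof -
  let ?A = "range (\<lambda>j. \<bar>X $ j\<bar>)"
  have "Max ?A \<in> ?A" by (rule Max_in) auto
  then obtain i where "Max ?A = \<bar>X $ i\<bar>" by blast
  then have i: "\<bar>X $ j\<bar> \<le> \<bar>X $ i\<bar>" for j
    using Max_ge[of ?A "\<bar>X $ j\<bar>"] by simp
  have "norm X \<le> (\<Sum>j\<in>UNIV. \<bar>X $ j\<bar>)" by (rule norm_le_l1_cart)
  also have "\<dots> \<le> (\<Sum>j\<in>(UNIV :: 'i set). \<bar>X $ i\<bar>)" by (intro sum_mono i)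
  finally show thesis using that by simp
qed

section \<open>Going up\<close>

text \<open>The integral coordinates \<open>z \<and> X\<close> of the enlarged subspace equal
  \<open>(z - v) \<and> X\<close>, because \<open>X\<close> annihilates \<open>v\<close>. Their norm
  is at most a constant times \<open>norm (z - v) * norm X\<close>, and the first factor contributes
  the negative power of the height.\<close>

lemma going_up:
  obtains C where "C > 0"
    "\<And>V :: (real ^ 'i::{finite,linorder}) set. rational_subspace V \<Longrightarrow> 1 \<le> dim V \<Longrightarrow> dim V < CARD('i) \<Longrightarrow>
      \<exists>V'. rational_subspace V' \<and> V \<subseteq> V' \<and> dim V' = dim V + 1 \<and>
           height V' \<le> C * height V powr (1 - 1 / real (CARD('i) - dim V))"
proof -
  obtain B where B: "B > 0" "\<And>X Y :: real ^ ('i::{finite,linorder}) set. norm (wedge X Y) \<le> B * norm X * norm Y"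
    using norm_wedge_le[where ?'i = 'i] by metis
  \<comment> \<open>The number of coordinates of the Grassmann algebra: some coordinate of
    \<open>X\<close> is at least \<open>norm X / N\<close> in absolute value, and it serves as
    \<open>X $ I\<close>.\<close>
  define N where "N = real CARD('i set)"
  have "CARD('i set) \<ge> 1" by (simp add: Suc_leI)
  then have N: "N \<ge> 1" unfolding N_def by linarith
  let ?C = "B * (CARD('i) * (2 * N))"
  have bound: "\<exists>V'. rational_subspace V' \<and> V \<subseteq> V' \<and> dim V' = dim V + 1 \<and>
           height V' \<le> ?C * height V powr (1 - 1 / real (CARD('i) - dim V))"
    if V: "rational_subspace V" "1 \<le> dim V" "dim V < CARD('i)" for V :: "(real ^ 'i::{finite,linorder}) set"
  proof -
    note rat = rational_subspace_span_integral[OF V(1)]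
    define r where "r = real (CARD('i) - dim V)"
    have r: "r \<ge> 1" using V(3) by (auto simp: r_def)
    obtain X where X: "X \<in> pluecker V" "primitive X"
      using V primitive_pluecker_exists by blast
    have hX: "height V = norm X" using X by (rule height_eq)
    have X0: "norm X > 0" using pluecker_nonzero[OF X(1)] by simp
    obtain I where I: "norm X \<le> N * \<bar>X $ I\<bar>"
      using max_coordinate[of X] by (auto simp: N_def)
    then have XI: "X $ I \<noteq> 0" using X0 by auto
    obtain z v where z: "z \<in> integral_vectors" "z \<notin> V" "v \<in> V"
      and zv: "\<And>j. \<bar>(z - v) $ j\<bar> \<le> 2 * \<bar>X $ I\<bar> powr (- 1 / r)"
      using integral_vector_near_subspace[OF X XI V(1,3)] unfolding r_def by blast
    obtain xs where xs: "X = wedge_list xs" "distinct xs" "independent (set xs)" "span (set xs) = V" "length xs = dim V"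
      using X(1) by (elim pluecker_cases) auto
    let ?V' = "span (insert z V)"
    let ?Z = "wedge (grade1 z) X"
    have dim': "dim ?V' = dim V + 1"
      using z(2) rat(1) by (simp add: dim_insert span_eq_iff[THEN iffD2])
    have "?Z \<noteq> 0" using z(2) pluecker_mem_iff[OF X(1)] by blast
    moreover have "?Z = wedge_list (z # xs)" by (simp add: xs)
    moreover have "set (z # xs) \<subseteq> ?V'" using xs(4) by (auto intro: span_base span_superset[THEN subsetD])
    ultimately have Z: "?Z \<in> pluecker ?V'"
      using dim' xs(5) by (metis plueckerI subspace_span Suc_eq_plus1 length_Cons)
    have "?V' = span (insert z (V \<inter> integral_vectors))"
    proof (rule span_eq[THEN iffD2], safe)
      fix x assume "x \<in> V"
      then have "x \<in> span (V \<inter> integral_vectors)" using rat(2) by simp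
      then show "x \<in> span (insert z (V \<inter> integral_vectors))"
        by (meson span_mono subset_insertI subsetD)
    qed (auto intro: span_base)
    then have "rational_subspace ?V'" using z(1) by (auto intro: rational_subspaceI)
    moreover have "height ?V' \<le> ?C * height V powr (1 - 1 / r)"
    proof -
      have "height ?V' \<le> norm ?Z"
        using Z dim' z(1) X(2) by (intro pluecker_integral_height_le(2)) (auto simp: primitive_def intro: wedge_grade1_Ints)
      also have "?Z = wedge (grade1 (z - v)) X"
        using z(3) pluecker_mem_iff[OF X(1)] linear_diff[OF linear_grade1, of z v]
        by (simp add: bilinear_lsub[OF bilinear_wedge])
      also have "norm \<dots> \<le> B * norm (z - v) * norm X"
        using B(2) norm_grade1 by metis
      also have "\<dots> \<le> B * (CARD('i) * (2 * (norm X powr (- 1 / r) * N))) * norm X"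
      proof (intro mult_right_mono mult_left_mono)
        have "norm (z - v) \<le> CARD('i) * (2 * \<bar>X $ I\<bar> powr (- 1 / r))"
          using norm_le_l1_cart[of "z - v"] sum_mono[of UNIV "\<lambda>j. \<bar>(z - v) $ j\<bar>", OF zv] by simp
        also have "\<bar>X $ I\<bar> powr (- 1 / r) \<le> (norm X / N) powr (- 1 / r)"
          using I X0 N r by (intro powr_mono2') (auto simp: field_simps)
        also have "(norm X / N) powr (- 1 / r) = norm X powr (- 1 / r) * N powr (1 / r)"
          using X0 N by (simp add: powr_divide powr_minus_divide)
        \<comment> \<open>As \<open>r \<ge> 1\<close>, this removes \<open>r\<close> from the
          constant, which must not depend on \<open>V\<close>.\<close>
        also have "N powr (1 / r) \<le> N powr 1"
          using N r by (intro powr_mono) auto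
        finally show "norm (z - v) \<le> CARD('i) * (2 * (norm X powr (- 1 / r) * N))"
          using N by (simp add: mult_left_mono)
      qed (use B(1) in auto)
      also have "\<dots> = ?C * (norm X powr (- 1 / r) * norm X powr 1)"
        using X0 by simp
      also have "norm X powr (- 1 / r) * norm X powr 1 = height V powr (1 - 1 / r)"
        unfolding hX powr_add[symmetric] by simp
      finally show ?thesis .
    qed
    ultimately show ?thesis
      using dim' span_superset[of "insert z V"] unfolding r_def by blast
  qed
  have "?C > 0" using B(1) N by simp
  then show thesis using bound by (rule that)
qed


lemma height_ge_1:
  assumes "rational_subspace V" "dim V \<ge> 1"
  shows "height V \<ge> 1"
proof -
  obtain X where X: "X \<in> pluecker V" "primitive X"
    using primitive_pluecker_exists[OF assms] by blast
  obtain i where i: "X $ i \<noteq> 0"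
    using pluecker_nonzero[OF X(1)] by (auto simp: vec_eq_iff)
  have "1 \<le> \<bar>X $ i\<bar>"
    using X(2) i by (intro Ints_nonzero_abs_ge1) (auto simp: primitive_def)
  also have "\<dots> \<le> norm X" by (rule component_le_norm_cart)
  finally show ?thesis using height_eq[OF X] by simp
qed

text \<open>The exponents telescope: with \<open>u = CARD('i) - b\<close>, the step from
  \<open>b\<close> to \<open>b + 1\<close> multiplies \<open>u / (CARD('i) - a)\<close> by
  \<open>1 - 1 / u\<close>.\<close>

lemma going_up_iterated:
  assumes a: "1 \<le> a" "a < CARD('i::{finite,linorder})" and ab: "a \<le> b" "b \<le> CARD('i)"
  shows "\<exists>C>0. \<forall>V :: (real ^ 'i::{finite,linorder}) set. rational_subspace V \<longrightarrow> dim V = a \<longrightarrow>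
    (\<exists>V'. rational_subspace V' \<and> V \<subseteq> V' \<and> dim V' = b \<and>
      height V' \<le> C * height V powr ((real CARD('i) - real b) / (real CARD('i) - real a)))"
  using ab
proof (induction b rule: dec_induct)
  case base
  show ?case
  proof (rule exI[of _ 1], intro conjI allI impI)
    fix V :: "(real ^ 'i::{finite,linorder}) set" assume V: "rational_subspace V" "dim V = a"
    then have "height V powr ((real CARD('i) - real a) / (real CARD('i) - real a)) = height V"
      using a height_ge_1[of V] by simp
    then show "\<exists>V'. rational_subspace V' \<and> V \<subseteq> V' \<and> dim V' = a \<and>
      height V' \<le> 1 * height V powr ((real CARD('i) - real a) / (real CARD('i) - real a))"
      using V by (intro exI[of _ V]) simp
  qed simp
next
  case (step b)
  let ?N = "real CARD('i)"
  define e where "e = 1 - 1 / real (CARD('i) - b)"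
  have u: "real (CARD('i) - b) = ?N - real b" "?N - real b \<ge> 1"
    using step.prems by (simp_all add: of_nat_diff)
  then have e: "e \<ge> 0" by (simp add: e_def)
  have "u / v * (1 - 1 / u) = (u - 1) / v" if "u \<ge> 1" for u v :: real
    using that by (simp add: right_diff_distrib diff_divide_distrib)
  from this[OF u(2), of "?N - real a"]
  have e2: "(?N - real b) / (?N - real a) * e = (?N - real (Suc b)) / (?N - real a)"
    by (simp add: e_def u(1) algebra_simps)
  obtain C where C: "C > 0" and up: "\<And>V :: (real ^ 'i::{finite,linorder}) set. rational_subspace V \<Longrightarrow> dim V = a \<Longrightarrow>
      \<exists>V'. rational_subspace V' \<and> V \<subseteq> V' \<and> dim V' = b \<and> height V' \<le> C * height V powr ((?N - real b) / (?N - real a))"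
    using step by force
  obtain D where D: "D > 0" and up': "\<And>V :: (real ^ 'i::{finite,linorder}) set. rational_subspace V \<Longrightarrow> 1 \<le> dim V \<Longrightarrow> dim V < CARD('i) \<Longrightarrow>
      \<exists>V'. rational_subspace V' \<and> V \<subseteq> V' \<and> dim V' = dim V + 1 \<and>
           height V' \<le> D * height V powr (1 - 1 / real (CARD('i) - dim V))"
    using going_up[where ?'i = 'i] by blast
  show ?case
  proof (rule exI[of _ "D * C powr e"], intro conjI allI impI)
    show "0 < D * C powr e" using C D by simp
    fix V :: "(real ^ 'i::{finite,linorder}) set" assume V: "rational_subspace V" "dim V = a"
    obtain V' where V': "rational_subspace V'" "V \<subseteq> V'" "dim V' = b"
      "height V' \<le> C * height V powr ((?N - real b) / (?N - real a))"
      using up[OF V] by blast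
    obtain V'' where V'': "rational_subspace V''" "V' \<subseteq> V''" "dim V'' = b + 1" "height V'' \<le> D * height V' powr e"
      using up'[OF V'(1)] V'(3) step.hyps step.prems a unfolding e_def by auto
    have "1 \<le> height V'" using V' step.hyps a by (intro height_ge_1) auto
    then have "height V' powr e \<le> (C * height V powr ((?N - real b) / (?N - real a))) powr e"
      using V'(4) e by (intro powr_mono2) auto
    also have "\<dots> = C powr e * height V powr ((?N - real (Suc b)) / (?N - real a))"
      using C unfolding e2[symmetric] by (simp add: powr_mult powr_powr)
    finally have "D * height V' powr e \<le> D * C powr e * height V powr ((?N - real (Suc b)) / (?N - real a))"
      using D by simp
    then show "\<exists>V'. rational_subspace V' \<and> V \<subseteq> V' \<and> dim V' = Suc b \<and>
        height V' \<le> D * C powr e * height V powr ((?N - real (Suc b)) / (?N - real a))"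
      using V'(2) V'' by (intro exI[of _ V'']) auto
  qed
qed

section \<open>Finiteness of the subspaces of bounded height\<close>

lemma finite_integral_vectors: "finite {x :: real ^ 'i::finite. x \<in> integral_vectors \<and> norm x \<le> B}"
proof (rule finite_subset)
  let ?F = "\<Pi>\<^sub>E i\<in>(UNIV :: 'i set). {- \<lceil>B\<rceil>..\<lceil>B\<rceil>}"
  show "finite ((\<lambda>f. \<chi> i. real_of_int (f i)) ` ?F)"
    by (intro finite_imageI finite_PiE) auto
  show "{x :: real ^ 'i::finite. x \<in> integral_vectors \<and> norm x \<le> B} \<subseteq> (\<lambda>f. \<chi> i. real_of_int (f i)) ` ?F"
  proof
    fix x :: "real ^ 'i::finite" assume x: "x \<in> {x. x \<in> integral_vectors \<and> norm x \<le> B}"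
    have le: "\<bar>x $ i\<bar> \<le> B" for i
      using x component_le_norm_cart[of x i] by simp
    have "\<lfloor>x $ i\<rfloor> \<in> {- \<lceil>B\<rceil>..\<lceil>B\<rceil>}" for i
      using le[of i] unfolding atLeastAtMost_iff by linarith
    then have "(\<lambda>i. \<lfloor>x $ i\<rfloor>) \<in> ?F"
      by auto
    moreover have "x = (\<chi> i. real_of_int \<lfloor>x $ i\<rfloor>)"
      using x by (simp add: vec_eq_iff)
    ultimately show "x \<in> (\<lambda>f. \<chi> i. real_of_int (f i)) ` ?F"
      unfolding image_iff by (intro bexI[of _ "\<lambda>i. \<lfloor>x $ i\<rfloor>"])
  qed
qed

text \<open>Northcott property: a subspace is determined by its primitive Pluecker coordinates,
  which form an integral vector of norm at most \<open>B\<close>.\<close>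

lemma finite_bounded_height:
  "finite {V :: (real ^ 'i::{finite,linorder}) set. rational_subspace V \<and> dim V \<ge> 1 \<and> height V \<le> B}" (is "finite ?A")
proof -
  define X where "X V = (SOME X. X \<in> pluecker V \<and> primitive X)" for V :: "(real ^ 'i::{finite,linorder}) set"
  have X: "X V \<in> pluecker V \<and> primitive (X V)" if "V \<in> ?A" for V
  proof -
    have "\<exists>X. X \<in> pluecker V \<and> primitive X"
      using that primitive_pluecker_exists[of V] by blast
    then show ?thesis unfolding X_def by (rule someI_ex)
  qed
  have "inj_on X ?A"
  proof (intro inj_onI set_eqI)
    fix V W v assume VW: "V \<in> ?A" "W \<in> ?A" "X V = X W"
    then show "v \<in> V \<longleftrightarrow> v \<in> W"
      using pluecker_mem_iff[of "X V" V v] pluecker_mem_iff[of "X W" W v] X[of V] X[of W] by simp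
  qed
  moreover have "X ` ?A \<subseteq> {x. x \<in> integral_vectors \<and> norm x \<le> B}"
  proof (rule image_subsetI)
    fix V assume V: "V \<in> ?A"
    then show "X V \<in> {x. x \<in> integral_vectors \<and> norm x \<le> B}"
      using X[OF V] height_eq[of "X V" V] by (simp add: primitive_def)
  qed
  ultimately show ?thesis
    by (rule inj_on_finite[OF _ _ finite_integral_vectors])
qed

lemma wedge_list_single: "wedge_list [x] = grade1 x"
proof -
  have "wedge (grade1 x) (axis {} 1) $ K = grade1 x $ K" for K
  proof (cases "\<exists>i. K = {i}")
    case True
    then obtain i where K: "K = {i}" by blast
    have "wedge_sign {i} {} = 1" by (simp add: wedge_sign_singleton)
    then show ?thesis by (simp add: K wedge_grade1_nth axis_def)
  next
    case False
    then have "(\<Sum>i\<in>K. wedge_sign {i} (K - {i}) * x $ i * axis {} 1 $ (K - {i})) = 0"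
      by (intro sum.neutral) (auto simp: axis_def)
    moreover have "grade1 x $ K = 0" using False by (intro grade1_eq_0) auto
    ultimately show ?thesis
      unfolding wedge_grade1_nth by (rule trans[OF _ sym])
  qed
  then show ?thesis by (simp add: vec_eq_iff)
qed

section \<open>Estimates for the projective distance\<close>

lemma proj_dist_nonneg: "proj_dist x y \<ge> 0"
  by (simp add: proj_dist_def)

text \<open>Subtracting a multiple of \<open>\<xi>\<close> from \<open>x\<close> does not change
  \<open>\<xi> \<and> x\<close>, so a point of \<open>V\<close> close to the line of
  \<open>\<xi>\<close> bounds the distance. The constant is uniform in all data.\<close>

lemma proj_dist_subvariety_le:
  obtains B where "B > 0" "\<And>(\<xi> :: real ^ 'i::{finite,linorder}) (V :: (real ^ 'i::{finite,linorder}) set) x t. x \<in> V \<Longrightarrow> x \<noteq> 0 \<Longrightarrow> \<xi> \<noteq> 0 \<Longrightarrow>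
    proj_dist_subvariety \<xi> V \<le> B * norm (x - t *\<^sub>R \<xi>) / norm x"
proof -
  obtain B where B: "B > 0" "\<And>X Y :: real ^ ('i::{finite,linorder}) set. norm (wedge X Y) \<le> B * norm X * norm Y"
    by (rule norm_wedge_le) blast
  show thesis
  proof (rule that[OF B(1)])
    fix \<xi> :: "real ^ 'i::{finite,linorder}" and V :: "(real ^ 'i::{finite,linorder}) set" and x t assume x: "x \<in> V" "x \<noteq> 0" "\<xi> \<noteq> 0"
    have self: "wedge (grade1 \<xi>) (grade1 \<xi>) = 0"
      using wedge_list_member[of \<xi> "[\<xi>]"] by (simp only: wedge_list_single list.set_intros(1))
    have "proj_dist_subvariety \<xi> V \<le> proj_dist \<xi> x"
      unfolding proj_dist_subvariety_def
      using x proj_dist_nonneg by (intro cINF_lower bdd_belowI2[of _ 0]) auto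
    also have "\<dots> = norm (wedge (grade1 \<xi>) (grade1 (x - t *\<^sub>R \<xi>))) / (norm \<xi> * norm x)"
      using self linear_diff[OF linear_grade1, of x "t *\<^sub>R \<xi>"]
      by (simp add: proj_dist_def bilinear_rsub[OF bilinear_wedge] wedge_linear_simps)
    also have "\<dots> \<le> (B * norm \<xi> * norm (x - t *\<^sub>R \<xi>)) / (norm \<xi> * norm x)"
      using B(2)[of "grade1 \<xi>" "grade1 (x - t *\<^sub>R \<xi>)"] by (intro divide_right_mono) (auto simp: norm_grade1)
    also have "\<dots> = B * norm (x - t *\<^sub>R \<xi>) / norm x"
      using x by simp
    finally show "proj_dist_subvariety \<xi> V \<le> B * norm (x - t *\<^sub>R \<xi>) / norm x" .
  qed
qed

lemma minor_le_norm_wedge: "\<bar>x $ i * y $ j - x $ j * y $ i\<bar> \<le> norm (wedge (grade1 x) (grade1 y))"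
proof -
  have *: "\<bar>x $ i * y $ j - x $ j * y $ i\<bar> \<le> norm (wedge (grade1 x) (grade1 y))" if "i < j" for i j
  proof -
    have s: "wedge_sign {i} {j} = 1" "wedge_sign {j} {i} = - 1"
    proof -
      have "{l \<in> {j}. l < i} = {}" "{l \<in> {i}. l < j} = {i}" using that by auto
      then show "wedge_sign {i} {j} = 1" "wedge_sign {j} {i} = - 1"
        by (simp_all only: wedge_sign_singleton) simp_all
    qed
    have "{i, j} - {i} = {j}" "{i, j} - {j} = {i}" using that by auto
    then have "wedge (grade1 x) (grade1 y) $ {i, j} = x $ i * y $ j - x $ j * y $ i"
      using that s by (simp add: wedge_grade1_nth)
    then show ?thesis
      by (metis component_le_norm_cart)
  qed
  show ?thesis
    using *[of i j] *[of j i] by (cases i j rule: linorder_cases) (auto simp: abs_minus_commute)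
qed

text \<open>For \<open>v\<close> orthogonal to \<open>y\<close>, each
  \<open>(y \<bullet> \<xi>) * v $ j\<close> is a combination of 2 by 2 minors of
  \<open>\<xi>\<close> and \<open>v\<close> with coefficients from \<open>y\<close>. Bounding every
  minor by the wedge product costs one factor \<open>CARD('i)\<close> for the sum over
  \<open>i\<close> and one for the sum over \<open>j\<close>.\<close>

lemma proj_dist_subvariety_ge:
  fixes \<xi> y :: "real ^ 'i::{finite,linorder}"
  assumes y: "\<And>v. v \<in> V \<Longrightarrow> y \<bullet> v = 0" "y \<noteq> 0" and "\<xi> \<noteq> 0" "dim V \<ge> 1"
  shows "\<bar>y \<bullet> \<xi>\<bar> / ((real CARD('i))\<^sup>2 * norm y * norm \<xi>) \<le> proj_dist_subvariety \<xi> V"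
  unfolding proj_dist_subvariety_def
proof (rule cINF_greatest)
  show "V - {0} \<noteq> {}" using assms(4) by (metis Diff_eq_empty_iff dim_eq_0 not_one_le_zero)
  fix v assume v: "v \<in> V - {0}"
  let ?W = "norm (wedge (grade1 \<xi>) (grade1 v))"
  have "\<bar>y \<bullet> \<xi>\<bar> * \<bar>v $ j\<bar> \<le> CARD('i) * (norm y * ?W)" for j
  proof -
    have "(y \<bullet> \<xi>) * v $ j = (\<Sum>i\<in>UNIV. y $ i * (\<xi> $ i * v $ j)) - \<xi> $ j * (y \<bullet> v)"
      using y(1) v by (simp add: inner_vec_def sum_distrib_right mult.assoc)
    also have "\<dots> = (\<Sum>i\<in>UNIV. y $ i * (\<xi> $ i * v $ j - \<xi> $ j * v $ i))"
      by (simp add: inner_vec_def sum_distrib_left algebra_simps sum_subtractf)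
    also have "\<bar>\<dots>\<bar> \<le> (\<Sum>i\<in>(UNIV :: 'i set). norm y * ?W)"
      by (intro order_trans[OF sum_abs] sum_mono)
         (auto simp: abs_mult intro!: mult_mono component_le_norm_cart minor_le_norm_wedge)
    finally show ?thesis by (simp add: abs_mult)
  qed
  then have "(\<Sum>j\<in>UNIV. \<bar>y \<bullet> \<xi>\<bar> * \<bar>v $ j\<bar>) \<le> (\<Sum>j\<in>(UNIV :: 'i set). CARD('i) * (norm y * ?W))"
    by (intro sum_mono)
  moreover have "\<bar>y \<bullet> \<xi>\<bar> * norm v \<le> (\<Sum>j\<in>UNIV. \<bar>y \<bullet> \<xi>\<bar> * \<bar>v $ j\<bar>)"
    using norm_le_l1_cart[of v] by (simp add: mult_left_mono flip: sum_distrib_left)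
  ultimately have "\<bar>y \<bullet> \<xi>\<bar> * norm v \<le> (real CARD('i))\<^sup>2 * norm y * ?W"
    by (simp add: power2_eq_square mult.assoc)
  then have *: "\<bar>y \<bullet> \<xi>\<bar> * norm v / ((real CARD('i))\<^sup>2 * norm y * norm \<xi> * norm v)
      \<le> (real CARD('i))\<^sup>2 * norm y * ?W / ((real CARD('i))\<^sup>2 * norm y * norm \<xi> * norm v)"
    by (intro divide_right_mono) auto
  have "norm v \<noteq> 0" "norm y \<noteq> 0" "((real CARD('i))\<^sup>2) \<noteq> 0" using v y(2) by auto
  then show "\<bar>y \<bullet> \<xi>\<bar> / ((real CARD('i))\<^sup>2 * norm y * norm \<xi>) \<le> proj_dist \<xi> v"
    using * unfolding proj_dist_def mult.assoc by simp
qed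

text \<open>The normal vector is the Hodge dual of the primitive Pluecker coordinates.\<close>

lemma hyperplane_normal:
  fixes W :: "(real ^ 'i::{finite,linorder}) set"
  assumes W: "rational_subspace W" "dim W = CARD('i) - 1" "dim W \<ge> 1"
  shows "\<exists>y\<in>integral_vectors. y \<noteq> 0 \<and> norm y \<le> height W \<and> (\<forall>v\<in>W. y \<bullet> v = 0)"
proof -
  obtain X where X: "X \<in> pluecker W" "primitive X"
    using primitive_pluecker_exists[OF W(1,3)] by blast
  define s where "s i = wedge_sign {i} (UNIV - {i})" for i :: "'i::{finite,linorder}"
  define y where "y = (\<chi> i. s i * X $ (UNIV - {i}))"
  have "y \<in> integral_vectors"
    using X(2) by (auto simp: y_def s_def primitive_def intro!: Ints_mult wedge_sign_Ints)
  moreover have "y \<noteq> 0"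
  proof -
    obtain K where K: "X $ K \<noteq> 0"
      using pluecker_nonzero[OF X(1)] by (auto simp: vec_eq_iff)
    have "card K = CARD('i) - 1"
      using pluecker_coordinate_graph(1)[OF X(1) K] W(2) by simp
    then have "card (UNIV - K) = 1"
      using W(2,3) by (simp add: card_Diff_subset)
    then obtain i where "UNIV - K = {i}" by (rule card_1_singletonE)
    then have "K = UNIV - {i}" by blast
    moreover have "s i \<noteq> 0"
      using abs_wedge_sign[of "{i}" "UNIV - {i}"] unfolding s_def by linarith
    ultimately have "y $ i \<noteq> 0"
      using K by (simp add: y_def)
    then show ?thesis by auto
  qed
  moreover have "norm y \<le> height W"
  proof -
    have s2: "(s i)\<^sup>2 = 1" for i
      by (metis abs_wedge_sign power2_abs power_one s_def)
    have "(\<Sum>i\<in>UNIV. (y $ i)\<^sup>2) = (\<Sum>K\<in>range (\<lambda>i. UNIV - {i}). (X $ K)\<^sup>2)"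
      by (subst sum.reindex) (auto simp: inj_on_def y_def power_mult_distrib s2)
    also have "\<dots> \<le> (\<Sum>K\<in>UNIV. (X $ K)\<^sup>2)"
      by (rule sum_mono2) auto
    finally have "norm y \<le> norm X"
      by (simp add: norm_vec_def L2_set_def)
    then show ?thesis by (simp add: height_eq[OF X])
  qed
  moreover have "y \<bullet> v = 0" if "v \<in> W" for v
  proof -
    \<comment> \<open>The top coordinate of \<open>v \<and> X\<close> expands to
      \<open>y \<bullet> v\<close>; this is where the signs in \<open>y\<close> come from.\<close>
    have "wedge (grade1 v) X $ UNIV = 0"
      using pluecker_mem_iff[OF X(1)] that by simp
    then show ?thesis
      by (simp add: wedge_grade1_nth y_def s_def inner_vec_def mult_ac)
  qed
  ultimately show ?thesis by blast
qed

section \<open>Bounds for the exponents\<close>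

lemma inner_homog: "y \<bullet> homog \<Theta> = y $ None + (\<Sum>i\<in>UNIV. y $ Some i * \<Theta> $ i)"
  by (simp add: inner_vec_def UNIV_option_conv homog_def sum.reindex)

lemma homog_nonzero: "homog \<Theta> \<noteq> 0"
  by (auto simp: homog_def vec_eq_iff intro!: exI[of _ None])

text \<open>Clearing denominators replaces rational coefficients by integral linear forms, the shape
  in which all approximation bounds are stated.\<close>

lemma lin_indep_rat_iff:
  "one_and_coords_lin_indep_rat \<Theta> \<longleftrightarrow> (\<forall>y\<in>integral_vectors. y \<noteq> 0 \<longrightarrow> y \<bullet> homog \<Theta> \<noteq> 0)"
proof (intro iffI ballI impI notI)
  fix y assume ind: "one_and_coords_lin_indep_rat \<Theta>" and y: "y \<in> integral_vectors" "y \<noteq> 0" "y \<bullet> homog \<Theta> = 0"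
  have fl: "of_rat (of_int \<lfloor>y $ j\<rfloor>) = y $ j" for j
    using y(1) by simp
  have "of_rat (of_int \<lfloor>y $ None\<rfloor>) * 1 + (\<Sum>i\<in>UNIV. of_rat (of_int \<lfloor>y $ Some i\<rfloor>) * \<Theta> $ i) = 0"
    using y(3) unfolding fl inner_homog by simp
  then have "(of_int \<lfloor>y $ None\<rfloor> :: rat) = 0 \<and> (\<forall>i. (of_int \<lfloor>y $ Some i\<rfloor> :: rat) = 0)"
    using ind[unfolded one_and_coords_lin_indep_rat_def, rule_format, of "of_int \<lfloor>y $ None\<rfloor>" "\<lambda>i. of_int \<lfloor>y $ Some i\<rfloor>"] by simp
  then have "y $ j = 0" for j
    using fl[of j] by (cases j) (metis of_rat_0)+
  then show False using y(2) by (simp add: vec_eq_iff)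
next
  assume *: "\<forall>y\<in>integral_vectors. y \<noteq> 0 \<longrightarrow> y \<bullet> homog \<Theta> \<noteq> 0"
  show "one_and_coords_lin_indep_rat \<Theta>"
    unfolding one_and_coords_lin_indep_rat_def
  proof (intro allI impI)
    fix a :: rat and b :: "'a \<Rightarrow> rat"
    assume zero: "of_rat a * 1 + (\<Sum>i\<in>UNIV. of_rat (b i) * \<Theta> $ i) = 0"
    define v :: "real ^ 'a option" where "v = (\<chi> j. case j of None \<Rightarrow> of_rat a | Some i \<Rightarrow> of_rat (b i))"
    have "v $ j \<in> \<rat>" for j by (cases j) (auto simp: v_def)
    then obtain D :: int where D: "D > 0" "of_int D *\<^sub>R v \<in> integral_vectors"
      by (rule rational_vector_multiple)
    have "v \<bullet> homog \<Theta> = 0" using zero by (simp add: inner_homog v_def)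
    then have "of_int D *\<^sub>R v = 0"
      using *[rule_format, OF D(2)] by auto
    then have v0: "v $ j = 0" for j using D(1) by simp
    show "a = 0 \<and> (\<forall>i. b i = 0)"
      using v0[of None] v0[of "Some i" for i] by (simp add: v_def)
  qed
qed

text \<open>Let \<open>y\<close> be the integral normal of a hyperplane \<open>W\<close> that
  contains \<open>V\<close>. Its norm is at most \<open>height W\<close>, hence at most a constant
  times \<open>height V\<close> to the power \<open>1 / (CARD('n) - d)\<close>. The distance formula
  contributes one negative power of \<open>norm y\<close> and the linear form contributes
  \<open>\<tau>\<close> of them.\<close>

lemma proj_dist_subvariety_ge_height:
  fixes \<Theta> :: "real ^ 'n::{finite,linorder}"
  assumes d: "d < CARD('n)" and c: "c > 0" "\<tau> \<ge> 0"
    and approx: "\<And>y. y \<in> integral_vectors \<Longrightarrow> y \<noteq> 0 \<Longrightarrow> \<bar>y \<bullet> homog \<Theta>\<bar> \<ge> c * norm y powr (- \<tau>)"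
  shows "\<exists>c'>0. \<forall>V\<in>rational_subvarieties d.
    proj_dist_subvariety (homog \<Theta>) V \<ge> c' * height V powr (- ((1 + \<tau>) / (real CARD('n) - real d)))"
proof -
  let ?\<xi> = "homog \<Theta>" and ?N = "real CARD('n option)"
  define e where "e = 1 / (real CARD('n) - real d)"
  obtain C where C: "C > 0" and up: "\<And>V :: (real ^ 'n option) set. rational_subspace V \<Longrightarrow> dim V = d + 1 \<Longrightarrow>
    (\<exists>W. rational_subspace W \<and> V \<subseteq> W \<and> dim W = CARD('n) \<and> height W \<le> C * height V powr e)"
    using going_up_iterated[where ?'i = "'n option", of "d + 1" "CARD('n)"] d by (auto simp: e_def)
  define c' where "c' = c / (?N\<^sup>2 * norm ?\<xi>) * C powr (- 1 - \<tau>)"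
  have "c' > 0" using c C homog_nonzero[of \<Theta>] by (simp add: c'_def)
  moreover have "proj_dist_subvariety ?\<xi> V \<ge> c' * height V powr (- ((1 + \<tau>) / (real CARD('n) - real d)))"
    if "V \<in> rational_subvarieties d" for V
  proof -
    have V: "rational_subspace V" "dim V = d + 1"
      using that by (auto simp: rational_subvarieties_def)
    obtain W where W: "rational_subspace W" "V \<subseteq> W" "dim W = CARD('n)" "height W \<le> C * height V powr e"
      using up[OF V] by blast
    obtain y where y: "y \<in> integral_vectors" "y \<noteq> 0" "norm y \<le> height W" "\<And>v. v \<in> W \<Longrightarrow> y \<bullet> v = 0"
      using hyperplane_normal[OF W(1)] W(3) d by auto
    have hV: "height V \<ge> 1" using V by (intro height_ge_1) auto
    have "c' * height V powr (- ((1 + \<tau>) / (real CARD('n) - real d)))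
        = c / (?N\<^sup>2 * norm ?\<xi>) * (C * height V powr e) powr (- 1 - \<tau>)"
      using C by (simp add: c'_def powr_mult powr_powr e_def algebra_simps add_divide_distrib diff_divide_distrib)
    also have "\<dots> \<le> c / (?N\<^sup>2 * norm ?\<xi>) * norm y powr (- 1 - \<tau>)"
      using c y(2,3) W(4) by (intro mult_left_mono powr_mono2') auto
    also have "\<dots> = c * norm y powr (- \<tau>) / (?N\<^sup>2 * norm y * norm ?\<xi>)"
      using y(2) by (simp add: powr_diff powr_minus_divide divide_simps powr_add)
    also have "\<dots> \<le> \<bar>y \<bullet> ?\<xi>\<bar> / (?N\<^sup>2 * norm y * norm ?\<xi>)"
      using approx[OF y(1,2)] by (intro divide_right_mono) auto
    also have "\<dots> \<le> proj_dist_subvariety ?\<xi> V"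
      using y W(2) V(2) homog_nonzero[of \<Theta>] by (intro proj_dist_subvariety_ge) auto
    finally show ?thesis .
  qed
  ultimately show ?thesis by blast
qed

text \<open>For \<open>w\<close> above the bound, the lower and the upper estimate of the distance
  together bound the height, which leaves only finitely many subspaces.\<close>

lemma omega_le:
  fixes \<Theta> :: "real ^ 'n::{finite,linorder}"
  assumes d: "d < CARD('n)" and c: "c > 0" "\<tau> \<ge> 0"
    and approx: "\<And>y. y \<in> integral_vectors \<Longrightarrow> y \<noteq> 0 \<Longrightarrow> \<bar>y \<bullet> homog \<Theta>\<bar> \<ge> c * norm y powr (- \<tau>)"
  shows "omega d \<Theta> \<le> ereal ((1 + \<tau>) / (real CARD('n) - real d) - 1)"
  unfolding omega_def
proof (rule Sup_least)
  let ?\<xi> = "homog \<Theta>"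
  define a where "a = (1 + \<tau>) / (real CARD('n) - real d)"
  obtain c' where c': "c' > 0"
    "\<And>V. V \<in> rational_subvarieties d \<Longrightarrow> proj_dist_subvariety ?\<xi> V \<ge> c' * height V powr (- a)"
    using proj_dist_subvariety_ge_height[OF d c approx] unfolding a_def by blast
  fix z assume "z \<in> {ereal w |w. infinite {V \<in> rational_subvarieties d. proj_dist_subvariety ?\<xi> V \<le> height V powr (- 1 - w)}}"
  then obtain w where w: "z = ereal w"
    "infinite {V \<in> rational_subvarieties d. proj_dist_subvariety ?\<xi> V \<le> height V powr (- 1 - w)}" (is "infinite ?S")
    by blast
  have "w \<le> a - 1"
  proof (rule ccontr)
    assume "\<not> w \<le> a - 1"
    then have s: "1 + w - a > 0" by simp
    have "height V \<le> (1 / c') powr (1 / (1 + w - a))" if "V \<in> ?S" for V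
    proof -
      have V: "rational_subspace V" "dim V = d + 1" and le: "proj_dist_subvariety ?\<xi> V \<le> height V powr (- 1 - w)"
        using that by (auto simp: rational_subvarieties_def)
      have h: "height V \<ge> 1" using V by (intro height_ge_1) auto
      have "c' * height V powr (- a) \<le> height V powr (- 1 - w)"
        using c'(2)[of V] that le by simp
      then have "c' * height V powr (- a) * height V powr (1 + w) \<le> height V powr (- 1 - w) * height V powr (1 + w)"
        by (intro mult_right_mono) auto
      then have "c' * height V powr (1 + w - a) \<le> 1"
        using h by (simp add: mult.assoc flip: powr_add)
      then have "height V powr (1 + w - a) \<le> 1 / c'"
        using c'(1) by (simp add: field_simps)
      then have "(height V powr (1 + w - a)) powr (1 / (1 + w - a)) \<le> (1 / c') powr (1 / (1 + w - a))"
        using s by (intro powr_mono2) auto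
      then show ?thesis using s h by (simp add: powr_powr)
    qed
    then have "?S \<subseteq> {V. rational_subspace V \<and> dim V \<ge> 1 \<and> height V \<le> (1 / c') powr (1 / (1 + w - a))}"
      by (auto simp: rational_subvarieties_def)
    then show False
      using w(2) finite_bounded_height finite_subset by blast
  qed
  then show "z \<le> ereal ((1 + \<tau>) / (real CARD('n) - real d) - 1)"
    by (simp add: w(1) a_def)
qed

text \<open>Going up may return the same \<open>V\<close> for many approximations. Since each single
  distance is positive, distances tending to zero force infinitely many different
  \<open>V\<close>.\<close>

lemma lin_indep_dist_pos:
  fixes \<Theta> :: "real ^ 'n::{finite,linorder}"
  assumes d: "d < CARD('n)" and ind: "one_and_coords_lin_indep_rat \<Theta>" and V: "V \<in> rational_subvarieties d"
  shows "proj_dist_subvariety (homog \<Theta>) V > 0"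
proof -
  have V: "rational_subspace V" "dim V = d + 1"
    using V by (auto simp: rational_subvarieties_def)
  obtain W where W: "rational_subspace W" "V \<subseteq> W" "dim W = CARD('n)"
    using going_up_iterated[where ?'i = "'n option", of "d + 1" "CARD('n)"] d V by auto
  obtain y where y: "y \<in> integral_vectors" "y \<noteq> 0" "\<And>v. v \<in> W \<Longrightarrow> y \<bullet> v = 0"
    using hyperplane_normal[OF W(1)] W(3) d by auto
  have "0 < \<bar>y \<bullet> homog \<Theta>\<bar> / ((real CARD('n option))\<^sup>2 * norm y * norm (homog \<Theta>))"
    using ind y homog_nonzero[of \<Theta>] unfolding lin_indep_rat_iff by simp
  also have "\<dots> \<le> proj_dist_subvariety (homog \<Theta>) V"
    using y W(2) V(2) homog_nonzero[of \<Theta>] by (intro proj_dist_subvariety_ge) auto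
  finally show ?thesis .
qed

lemma eventually_powr_compare:
  fixes A B \<alpha> \<beta> :: real
  assumes "A > 0" "\<alpha> < \<beta>"
  shows "\<exists>q0\<ge>1. \<forall>q\<ge>q0. B * q powr \<alpha> \<le> A * q powr \<beta>"
proof -
  define q0 where "q0 = max 1 (B / A) powr (1 / (\<beta> - \<alpha>))"
  have q0: "B / A \<le> q powr (\<beta> - \<alpha>)" if "q \<ge> q0" for q
  proof -
    have "max 1 (B / A) = q0 powr (\<beta> - \<alpha>)"
      using assms(2) by (simp add: q0_def powr_powr)
    also have "\<dots> \<le> q powr (\<beta> - \<alpha>)"
      using that assms(2) by (intro powr_mono2) (auto simp: q0_def)
    finally show ?thesis by simp
  qed
  show ?thesis
  proof (intro exI[of _ "max 1 q0"] conjI allI impI)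
    fix q assume q: "max 1 q0 \<le> q"
    have "B * q powr \<alpha> \<le> (A * q powr (\<beta> - \<alpha>)) * q powr \<alpha>"
      using q0[of q] q assms(1) by (intro mult_right_mono) (auto simp: field_simps)
    also have "\<dots> = A * q powr \<beta>" by (simp add: mult.assoc flip: powr_add)
    finally show "B * q powr \<alpha> \<le> A * q powr \<beta>" .
  qed simp
qed

text \<open>The line through \<open>x\<close> with \<open>x $ None = q\<close> has height of order
  at most \<open>q\<close> and distance of order at most \<open>q powr (- 1 - w)\<close>. Going up
  keeps the bound for the distance and raises the height only to the power \<open>e\<close>, so
  every \<open>u\<close> with \<open>e * (1 + u) < 1 + w\<close> is reached.\<close>

lemma omega_ge:
  fixes \<Theta> :: "real ^ 'n::{finite,linorder}"
  assumes d: "d < CARD('n)" and ind: "one_and_coords_lin_indep_rat \<Theta>" and w: "w \<ge> 0" and D: "D > 0"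
    and approx: "\<And>M. \<exists>x\<in>integral_vectors. x $ None > M \<and>
      norm (x - x $ None *\<^sub>R homog \<Theta>) \<le> D * (x $ None) powr (- w)"
  shows "omega d \<Theta> \<ge> ereal (real CARD('n) * (1 + w) / (real CARD('n) - real d) - 1)"
proof (rule ereal_le_epsilon2)
  let ?\<xi> = "homog \<Theta>"
  let ?n = "real CARD('n)"
  define e where "e = (?n - real d) / ?n"
  have e: "e > 0" using d by (simp add: e_def)
  obtain C where C: "C > 0" and up: "\<And>V :: (real ^ 'n option) set. rational_subspace V \<Longrightarrow> dim V = 1 \<Longrightarrow>
    (\<exists>W. rational_subspace W \<and> V \<subseteq> W \<and> dim W = d + 1 \<and> height W \<le> C * height V powr e)"
    using going_up_iterated[where ?'i = "'n option", of "1" "d + 1"] d by (auto simp: e_def)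
  obtain B0 where B0: "B0 > 0" "\<And>(\<xi> :: real ^ 'n option) (V :: (real ^ 'n option) set) x t. x \<in> V \<Longrightarrow> x \<noteq> 0 \<Longrightarrow> \<xi> \<noteq> 0 \<Longrightarrow>
    proj_dist_subvariety \<xi> V \<le> B0 * norm (x - t *\<^sub>R \<xi>) / norm x"
    using proj_dist_subvariety_le[where ?'i = "'n option"] by blast
  define B where "B = B0 * D"
  have B: "B > 0" using B0(1) D by (simp add: B_def)
  define K where "K = norm ?\<xi> + D"
  have K: "K > 0" unfolding K_def using norm_ge_zero[of ?\<xi>] D by linarith
  have good: "\<exists>V\<in>rational_subvarieties d. \<exists>q>M. proj_dist_subvariety ?\<xi> V \<le> B * q powr (- 1 - w) \<and>
    height V \<le> C * K powr e * q powr e" if M: "M \<ge> 1" for M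
  proof -
    obtain x where x: "x \<in> integral_vectors" "x $ None > M" "norm (x - x $ None *\<^sub>R ?\<xi>) \<le> D * (x $ None) powr (- w)"
      using approx[of M] by blast
    define q where "q = x $ None"
    have q: "q > M" "q \<ge> 1" using x(2) M by (auto simp: q_def)
    have x0: "x \<noteq> 0" using q by (auto simp: q_def)
    have "q \<le> norm x"
      using component_le_norm_cart[of x None] by (simp add: q_def)
    have "norm x \<le> norm (q *\<^sub>R ?\<xi>) + norm (x - q *\<^sub>R ?\<xi>)"
      by (metis add.commute diff_add_cancel norm_triangle_ineq)
    also have "\<dots> \<le> q * norm ?\<xi> + D * 1"
    proof -
      have "q powr (- w) \<le> 1" using q w powr_mono[of "- w" 0 q] by simp
      then have "D * q powr (- w) \<le> D * 1" using D by (intro mult_left_mono) auto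
      then show ?thesis using x(3) q unfolding q_def[symmetric] by simp
    qed
    also have "\<dots> \<le> K * q"
      using q(2) D mult_left_mono[of 1 q D] by (simp add: K_def algebra_simps)
    finally have xK: "norm x \<le> K * q" .
    let ?L = "span {x}"
    have L: "rational_subspace ?L" "dim ?L = 1"
      using x(1) x0 by (auto intro: rational_subspaceI)
    have gr: "grade1 x \<in> pluecker ?L"
      using x0 unfolding pluecker_def wedge_list_single[symmetric]
      by (intro CollectI exI[of _ "[x]"]) auto
    have "grade1 x $ I \<in> \<int>" for I
      using x(1) by (cases "\<exists>i. I = {i}") (auto simp: grade1_eq_0)
    then have "height ?L \<le> norm x"
      using pluecker_integral_height_le(2)[OF gr] L(2) norm_grade1[of x] by simp
    obtain W where W: "rational_subspace W" "?L \<subseteq> W" "dim W = d + 1" "height W \<le> C * height ?L powr e"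
      using up[OF L] by blast
    have "height ?L powr e \<le> (K * q) powr e"
      using \<open>height ?L \<le> norm x\<close> xK e height_ge_1[OF L(1)] L(2) by (intro powr_mono2) auto
    then have "height W \<le> C * K powr e * q powr e"
      using W(4) C K q by (simp add: powr_mult mult.assoc) (meson mult_left_mono less_imp_le order_trans)
    moreover have "proj_dist_subvariety ?\<xi> W \<le> B * q powr (- 1 - w)"
    proof -
      have "x \<in> W" using W(2) by (auto intro: span_base)
      then have "proj_dist_subvariety ?\<xi> W \<le> B0 * norm (x - q *\<^sub>R ?\<xi>) / norm x"
        using x0 homog_nonzero by (rule B0(2))
      also have "\<dots> \<le> B0 * (D * q powr (- w)) / q"
        using x(3) B0(1) D q \<open>q \<le> norm x\<close> unfolding q_def by (intro frac_le mult_left_mono) auto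
      also have "\<dots> = B * q powr (- 1 - w)"
        using q by (simp add: B_def powr_diff powr_minus_divide)
      finally show ?thesis .
    qed
    ultimately show ?thesis
      using W(1,3) q(1) unfolding rational_subvarieties_def by blast
  qed
  define t where "t = ?n * (1 + w) / (?n - real d) - 1"
  have te: "e * (1 + t) = 1 + w" using d by (simp add: t_def e_def)
  have "(1 + w) / 1 \<le> (1 + w) / e" using d w e by (intro divide_left_mono) (auto simp: e_def)
  moreover have "1 + t = (1 + w) / e" using te e by (simp add: field_simps)
  ultimately have t: "t \<ge> 0" using w by simp
  fix \<epsilon> :: real assume \<epsilon>: "\<epsilon> > 0"
  \<comment> \<open>Cut off at 1 so that \<open>u \<ge> - 1\<close>: then an upper bound for the
    height gives a lower bound for \<open>height V powr (- 1 - u)\<close>.\<close>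
  define u where "u = t - min \<epsilon> 1"
  have u: "u \<ge> - 1" "u < t" using t \<epsilon> by (auto simp: u_def)
  let ?S = "{V \<in> rational_subvarieties d. proj_dist_subvariety ?\<xi> V \<le> height V powr (- 1 - u)}"
  have "infinite ?S"
  proof
    assume fin: "finite ?S"
    \<comment> \<open>The inserted 1 keeps the minimum meaningful when \<open>?S\<close> is
      empty.\<close>
    define \<delta> where "\<delta> = Min (insert 1 (proj_dist_subvariety ?\<xi> ` ?S))"
    have \<delta>: "\<delta> > 0" "\<And>V. V \<in> ?S \<Longrightarrow> \<delta> \<le> proj_dist_subvariety ?\<xi> V"
      using fin lin_indep_dist_pos[OF d ind] by (auto simp: \<delta>_def)
    define A where "A = (C * K powr e) powr (- 1 - u)"
    have A: "A > 0" using C K by (simp add: A_def)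
    have "e * (1 + u) < e * (1 + t)" using e u by simp
    then have "- 1 - w < e * (- 1 - u)" using te by (simp add: algebra_simps)
    then obtain q1 where q1: "q1 \<ge> 1" "\<And>q. q \<ge> q1 \<Longrightarrow> B * q powr (- 1 - w) \<le> A * q powr (e * (- 1 - u))"
      using eventually_powr_compare[OF A] by blast
    have "\<delta> / 2 > 0" "- 1 - w < 0" using \<delta>(1) w by auto
    then obtain q2 where q2: "q2 \<ge> 1" "\<And>q. q \<ge> q2 \<Longrightarrow> B * q powr (- 1 - w) \<le> (\<delta> / 2) * q powr 0"
      using eventually_powr_compare by blast
    have "max q1 q2 \<ge> 1" using q1(1) by simp
    then obtain V q where V: "V \<in> rational_subvarieties d" "q > max q1 q2"
      "proj_dist_subvariety ?\<xi> V \<le> B * q powr (- 1 - w)" "height V \<le> C * K powr e * q powr e"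
      using good[of "max q1 q2"] by blast
    have hV: "height V \<ge> 1" using V(1) by (intro height_ge_1) (auto simp: rational_subvarieties_def)
    have "proj_dist_subvariety ?\<xi> V \<le> A * q powr (e * (- 1 - u))"
      using V(2,3) q1(2)[of q] by simp
    also have "\<dots> = (C * K powr e * q powr e) powr (- 1 - u)"
      using C by (simp add: A_def powr_mult powr_powr)
    also have "\<dots> \<le> height V powr (- 1 - u)"
      using V(4) hV u(1) by (intro powr_mono2') auto
    finally have "V \<in> ?S" using V(1) by simp
    then have "\<delta> \<le> proj_dist_subvariety ?\<xi> V" by (rule \<delta>(2))
    also have "\<dots> \<le> \<delta> / 2"
      using V(2,3) q2(1) q2(2)[of q] by simp
    finally show False using \<delta>(1) by simp
  qed
  then have "ereal u \<le> omega d \<Theta>"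
    unfolding omega_def by (intro Sup_upper) blast
  moreover have "ereal t \<le> ereal u + ereal \<epsilon>" by (simp add: u_def)
  ultimately have "ereal t \<le> omega d \<Theta> + ereal \<epsilon>"
    by (meson add_right_mono order_trans)
  then show "ereal (?n * (1 + w) / (?n - real d) - 1) \<le> omega d \<Theta> + ereal \<epsilon>"
    by (simp add: t_def)
qed

section \<open>Measure of the set where some linear form is small\<close>

lemma measure_ball_double:
  fixes p :: "'a::euclidean_space"
  shows "measure lebesgue (ball p (2 * r)) = 2 ^ DIM('a) * measure lebesgue (ball p r)"
proof (cases "r \<ge> 0")
  case True
  then show ?thesis by (simp add: measure_completion content_ball power_mult_distrib)
next
  case False
  then have "ball p (2 * r) = {}" "ball p r = {}" by (auto simp: ball_empty)
  then show ?thesis by (simp only: measure_empty mult_zero_right)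
qed

lemma slab_lmeasurable:
  fixes b p :: "'a::euclidean_space"
  shows "{x \<in> ball p \<rho>. \<bar>s + b \<bullet> x\<bar> \<le> \<delta>} \<in> lmeasurable"
proof (rule bounded_set_imp_lmeasurable)
  have "closed {x. \<bar>s + b \<bullet> x\<bar> \<le> \<delta>}"
    by (intro closed_Collect_le continuous_intros)
  then have "{x. \<bar>s + b \<bullet> x\<bar> \<le> \<delta>} \<inter> ball p \<rho> \<in> sets lebesgue"
    by (intro sets.Int) auto
  then show "{x \<in> ball p \<rho>. \<bar>s + b \<bullet> x\<bar> \<le> \<delta>} \<in> sets lebesgue"
    by (simp add: Int_def conj_commute)
  show "bounded {x \<in> ball p \<rho>. \<bar>s + b \<bullet> x\<bar> \<le> \<delta>}"
    by (rule bounded_subset[OF bounded_ball]) auto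
qed

text \<open>Translating the slab along \<open>b\<close> in steps of length \<open>h\<close> gives
  disjoint copies, as \<open>b \<bullet> x\<close> moves by \<open>3 * \<delta>\<close> while the
  slab has width \<open>2 * \<delta>\<close>. About \<open>\<rho> / h\<close> copies fit into the
  doubled ball, which takes the place of an integration over slices.\<close>

lemma slab_measure_le:
  fixes b p :: "'a::euclidean_space"
  assumes b: "b \<noteq> 0" and \<delta>: "\<delta> > 0" and \<rho>: "\<rho> > 0"
  shows "measure lebesgue {x \<in> ball p \<rho>. \<bar>s + b \<bullet> x\<bar> \<le> \<delta>}
    \<le> 6 * 2 ^ DIM('a) * (\<delta> / (\<rho> * norm b)) * measure lebesgue (ball p \<rho>)"
proof -
  let ?S = "{x \<in> ball p \<rho>. \<bar>s + b \<bullet> x\<bar> \<le> \<delta>}"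
  let ?\<mu> = "measure lebesgue :: 'a set \<Rightarrow> real"
  define h where "h = 3 * \<delta> / norm b"
  have h: "h > 0" using b \<delta> by (simp add: h_def)
  have eq: "6 * 2 ^ DIM('a) * (\<delta> / (\<rho> * norm b)) = 2 ^ DIM('a) * (2 * h / \<rho>)" by (simp add: h_def mult_ac)
  show ?thesis
  proof (cases "\<rho> < h")
    \<comment> \<open>When not even one translation fits, the claimed bound is at least the measure
      of the whole ball.\<close>
    case True
    then have "1 \<le> 2 * h / \<rho>" using \<rho> h by (simp add: field_simps)
    moreover have "(1::real) \<le> 2 ^ DIM('a)" by simp
    ultimately have "1 * 1 \<le> (2 ^ DIM('a)) * (2 * h / \<rho>)" by (intro mult_mono) auto
    then have "1 \<le> 6 * 2 ^ DIM('a) * (\<delta> / (\<rho> * norm b))" using eq by simp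
    moreover have "?\<mu> ?S \<le> ?\<mu> (ball p \<rho>)"
      by (intro measure_mono_fmeasurable) (auto simp: slab_lmeasurable fmeasurableD)
    ultimately show ?thesis
      using mult_right_mono[of 1 "6 * 2 ^ DIM('a) * (\<delta> / (\<rho> * norm b))" "?\<mu> (ball p \<rho>)"] by simp
  next
    case False
    \<comment> \<open>Rounding down costs a factor 2, since \<open>\<rho> / h \<ge> 1\<close>; with
      the 3 in \<open>h\<close> this gives the constant 6.\<close>
    define m where "m = nat \<lfloor>\<rho> / h\<rfloor>"
    have "1 \<le> \<lfloor>\<rho> / h\<rfloor>" using False h by simp
    then have "real m = of_int \<lfloor>\<rho> / h\<rfloor>" "1 \<le> real_of_int \<lfloor>\<rho> / h\<rfloor>" by (simp_all add: m_def)
    then have m: "real m \<le> \<rho> / h" "\<rho> / h \<le> 2 * real m" "real m \<ge> 1"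
      using real_of_int_floor_add_one_ge[of "\<rho> / h"] by linarith+
    define T where "T k = (+) ((real k * h / norm b) *\<^sub>R b) ` ?S" for k
    have T: "T k \<in> lmeasurable" "?\<mu> (T k) = ?\<mu> ?S" for k
      unfolding T_def by (rule measurable_translation[OF slab_lmeasurable] measure_translation)+
    have disj: "disjoint_family_on T {..<m}"
      unfolding disjoint_family_on_def
    proof (intro ballI impI, rule ccontr)
      fix k l assume kl: "k \<noteq> l" "T k \<inter> T l \<noteq> {}"
      then obtain x y where xy: "\<bar>s + b \<bullet> x\<bar> \<le> \<delta>" "\<bar>s + b \<bullet> y\<bar> \<le> \<delta>"
        "(real k * h / norm b) *\<^sub>R b + x = (real l * h / norm b) *\<^sub>R b + y"
        by (auto simp: T_def)
      have "b \<bullet> ((real k * h / norm b) *\<^sub>R b + x) = b \<bullet> ((real l * h / norm b) *\<^sub>R b + y)"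
        using xy(3) by simp
      then have "(real k - real l) * (3 * \<delta>) = b \<bullet> y - b \<bullet> x"
        using b by (simp add: inner_add_right h_def power2_norm_eq_inner[symmetric] power2_eq_square algebra_simps)
      moreover have "\<bar>b \<bullet> y - b \<bullet> x\<bar> \<le> 2 * \<delta>" using xy(1,2) by linarith
      moreover have "1 * (3 * \<delta>) \<le> \<bar>real k - real l\<bar> * (3 * \<delta>)"
        using kl(1) \<delta> by (intro mult_right_mono) linarith+
      moreover have "\<bar>(real k - real l) * (3 * \<delta>)\<bar> = \<bar>real k - real l\<bar> * (3 * \<delta>)"
        using \<delta> by (simp add: abs_mult)
      ultimately show False using \<delta> by linarith
    qed
    have sub: "(\<Union>k<m. T k) \<subseteq> ball p (2 * \<rho>)"
    proof (clarsimp simp: T_def simp del: mem_ball)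
      fix k x assume k: "k < m" and x: "x \<in> ball p \<rho>"
      have "norm ((real k * h / norm b) *\<^sub>R b) = real k * h" using b h by simp
      also have "\<dots> \<le> real m * h" using k h by simp
      also have "\<dots> \<le> \<rho>" using m(1) h by (simp add: field_simps)
      finally have "dist p ((real k * h / norm b) *\<^sub>R b + x) \<le> \<rho> + dist p x"
        using norm_triangle_ineq[of "(real k * h / norm b) *\<^sub>R b" "x - p"]
        by (simp add: dist_norm norm_minus_commute add_diff_eq)
      then show "(real k * h / norm b) *\<^sub>R b + x \<in> ball p (2 * \<rho>)" using x by simp
    qed
    have "real m * ?\<mu> ?S = (\<Sum>k<m. ?\<mu> (T k))" using T(2) by simp
    also have "\<dots> = ?\<mu> (\<Union>k<m. T k)"
    proof (rule measure_finite_Union[symmetric])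
      show "emeasure lebesgue (T k) \<noteq> \<infinity>" for k
        unfolding infinity_ennreal_def by (rule fmeasurableD2[OF T(1)])
    qed (use disj fmeasurableD[OF T(1)] in auto)
    also have "\<dots> \<le> ?\<mu> (ball p (2 * \<rho>))"
      using T(1) sub by (intro measure_mono_fmeasurable) (auto intro!: sets.finite_UN fmeasurableD)
    also have "\<dots> = 2 ^ DIM('a) * ?\<mu> (ball p \<rho>)" by (rule measure_ball_double)
    finally have "?\<mu> ?S \<le> 2 ^ DIM('a) * ?\<mu> (ball p \<rho>) / real m"
      using m(3) by (simp add: field_simps)
    also have "\<dots> \<le> 2 ^ DIM('a) * ?\<mu> (ball p \<rho>) * (2 * h / \<rho>)"
    proof -
      have "1 / real m \<le> 2 * h / \<rho>" using m(2,3) h \<rho> by (simp add: field_simps)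
      then have "2 ^ DIM('a) * ?\<mu> (ball p \<rho>) * (1 / real m) \<le> 2 ^ DIM('a) * ?\<mu> (ball p \<rho>) * (2 * h / \<rho>)"
        by (intro mult_left_mono) auto
      then show ?thesis by simp
    qed
    finally show ?thesis unfolding eq by (simp only: mult_ac)
  qed
qed

text \<open>Packing: the balls of radius \<open>s / 2\<close> around the points are disjoint and lie
  in a ball of radius \<open>R + s / 2\<close>.\<close>

lemma card_separated_le:
  fixes F :: "'a::euclidean_space set"
  assumes F: "finite F" "\<And>x. x \<in> F \<Longrightarrow> norm x \<le> R" and s: "s > 0" and R: "R \<ge> 0"
    and sep: "\<And>x y. x \<in> F \<Longrightarrow> y \<in> F \<Longrightarrow> x \<noteq> y \<Longrightarrow> dist x y \<ge> s"
  shows "real (card F) \<le> ((2 * R + s) / s) ^ DIM('a)"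
proof -
  let ?\<mu> = "measure lebesgue :: 'a set \<Rightarrow> real"
  let ?D = "DIM('a)"
  have vol: "?\<mu> (ball c r) = unit_ball_vol ?D * r ^ ?D" if "r \<ge> 0" for c r
    using that by (simp add: measure_completion content_ball)
  have "disjoint_family_on (\<lambda>x. ball x (s / 2)) F"
    unfolding disjoint_family_on_def
  proof (intro ballI impI)
    fix x y assume "x \<in> F" "y \<in> F" "x \<noteq> y"
    then have "s \<le> dist x y" by (rule sep)
    then show "ball x (s / 2) \<inter> ball y (s / 2) = {}"
      by (intro disjoint_ballI) simp
  qed
  moreover have "emeasure lebesgue (ball x (s / 2)) \<noteq> \<infinity>" for x :: 'a
    unfolding infinity_ennreal_def by (rule fmeasurableD2[OF lmeasurable_ball])
  ultimately have "(\<Sum>x\<in>F. ?\<mu> (ball x (s / 2))) = ?\<mu> (\<Union>x\<in>F. ball x (s / 2))"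
    using F(1) by (intro measure_finite_Union[symmetric]) auto
  also have "\<dots> \<le> ?\<mu> (ball 0 (R + s / 2))"
  proof (rule measure_mono_fmeasurable)
    show "(\<Union>x\<in>F. ball x (s / 2)) \<subseteq> ball 0 (R + s / 2)"
    proof
      fix z assume "z \<in> (\<Union>x\<in>F. ball x (s / 2))"
      then obtain x where x: "x \<in> F" "dist x z < s / 2" by auto
      have "norm z \<le> norm x + dist x z"
        using norm_triangle_ineq[of x "z - x"] by (simp add: dist_norm norm_minus_commute)
      then show "z \<in> ball 0 (R + s / 2)" using F(2)[OF x(1)] x(2) by simp
    qed
    show "(\<Union>x\<in>F. ball x (s / 2)) \<in> sets lebesgue"
      using F(1) by (intro sets.finite_UN) auto
  qed auto
  finally have "real (card F) * (unit_ball_vol ?D * (s / 2) ^ ?D) \<le> unit_ball_vol ?D * (R + s / 2) ^ ?D"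
  proof -
    assume le: "(\<Sum>x\<in>F. ?\<mu> (ball x (s / 2))) \<le> ?\<mu> (ball 0 (R + s / 2))"
    have v: "?\<mu> (ball x (s / 2)) = unit_ball_vol ?D * (s / 2) ^ ?D"
      "?\<mu> (ball 0 (R + s / 2)) = unit_ball_vol ?D * (R + s / 2) ^ ?D" for x
      using s R by (intro vol; simp)+
    show ?thesis using le by (simp only: v sum_constant)
  qed
  then have "unit_ball_vol ?D * (real (card F) * (s / 2) ^ ?D) \<le> unit_ball_vol ?D * (R + s / 2) ^ ?D"
    by (simp only: mult_ac)
  then have "real (card F) * (s / 2) ^ ?D \<le> (R + s / 2) ^ ?D"
    using unit_ball_vol_pos[of ?D] by (simp only: mult_le_cancel_left_pos)
  then have "real (card F) \<le> (R + s / 2) ^ ?D / (s / 2) ^ ?D"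
    using s by (simp add: pos_le_divide_eq)
  also have "\<dots> = ((R + s / 2) / (s / 2)) ^ ?D" by (rule power_divide[symmetric])
  also have "(R + s / 2) / (s / 2) = (2 * R + s) / s" using s by (simp add: field_simps)
  finally show ?thesis .
qed

lemma card_int_abs_le:
  assumes "M \<ge> 0"
  shows "finite {m::int. \<bar>real_of_int m\<bar> \<le> M}" "real (card {m::int. \<bar>real_of_int m\<bar> \<le> M}) \<le> 2 * M + 1"
proof -
  have eq: "{m::int. \<bar>real_of_int m\<bar> \<le> M} = {- \<lfloor>M\<rfloor>..\<lfloor>M\<rfloor>}"
    by (rule set_eqI, unfold mem_Collect_eq atLeastAtMost_iff, rule iffI; linarith)
  show "finite {m::int. \<bar>real_of_int m\<bar> \<le> M}" unfolding eq by simp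
  have "\<lfloor>M\<rfloor> \<ge> 0" using assms by simp
  then have "real (card {- \<lfloor>M\<rfloor>..\<lfloor>M\<rfloor>}) = of_int (2 * \<lfloor>M\<rfloor> + 1)" by simp
  also have "\<dots> \<le> 2 * M + 1" by simp
  finally show "real (card {m::int. \<bar>real_of_int m\<bar> \<le> M}) \<le> 2 * M + 1" unfolding eq .
qed

lemma Ints_inner: "x \<in> integral_vectors \<Longrightarrow> y \<in> integral_vectors \<Longrightarrow> x \<bullet> y \<in> \<int>"
  by (auto simp: inner_vec_def intro!: Ints_sum Ints_mult)

lemma integral_vectors_diff: "x \<in> integral_vectors \<Longrightarrow> y \<in> integral_vectors \<Longrightarrow> x - y \<in> integral_vectors"
  by auto

text \<open>
  The linear forms with \<open>T \<le> \<bar>b\<bar> < 2 T\<close> that are small somewhere on the ball have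
  \<open>q a + p \<bullet> b\<close> in a short interval, and those with a given value of it have \<open>Y\<close>-separated \<open>b\<close>.
\<close>

lemma bad_shell_measure_le:
  fixes p :: "real ^ 'n::finite" and q :: int and \<rho> \<delta> T Y :: real
  defines "\<mu> \<equiv> measure lebesgue (ball ((1 / of_int q) *\<^sub>R p) \<rho>)"
  defines "E \<equiv> {x \<in> ball ((1 / of_int q) *\<^sub>R p) \<rho>. \<exists>a::int. \<exists>b\<in>integral_vectors.
    T \<le> norm b \<and> norm b < 2 * T \<and> \<bar>of_int a + b \<bullet> x\<bar> \<le> \<delta>}"
  assumes q: "q \<ge> 1" and p: "p \<in> integral_vectors" and pos: "\<rho> > 0" "\<delta> > 0" "0 < Y" "Y \<le> T"
    and sep: "\<And>a b. b \<in> integral_vectors \<Longrightarrow> b \<noteq> 0 \<Longrightarrow> norm b < Y \<Longrightarrow> of_int (q * a) + p \<bullet> b \<noteq> 0"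
  shows "E \<in> lmeasurable"
    "measure lebesgue E \<le> (2 * (of_int q * (\<delta> + 2 * T * \<rho>)) + 1) * (5 * T / Y) ^ CARD('n) *
       (6 * 2 ^ CARD('n) * (\<delta> / (\<rho> * T)) * \<mu>)"
proof -
  define M where "M = of_int q * (\<delta> + 2 * T * \<rho>)"
  have M: "M \<ge> 0" using q pos by (simp add: M_def)
  define F where "F = {b :: real ^ 'n. b \<in> integral_vectors \<and> T \<le> norm b \<and> norm b < 2 * T}"
  have F: "finite F"
    by (rule finite_subset[OF _ finite_integral_vectors[of "2 * T"]]) (auto simp: F_def)
  \<comment> \<open>The pairs with a prescribed value \<open>m\<close> of \<open>q\<close> times the
    linear form at the centre. As \<open>q \<noteq> 0\<close>, the value and \<open>b\<close>
    determine \<open>a\<close>, so it suffices to count the vectors \<open>b\<close>.\<close>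
  define P where "P m = {(a::int, b). b \<in> F \<and> of_int (q * a) + p \<bullet> b = of_int m}" for m :: int
  define A where "A = {m::int. \<bar>real_of_int m\<bar> \<le> M}"
  have inj: "inj_on snd (P m)" for m
  proof (rule inj_onI)
    fix x y assume xy: "x \<in> P m" "y \<in> P m" "snd x = snd y"
    have "real_of_int (q * fst x) + p \<bullet> snd x = of_int m" "real_of_int (q * fst y) + p \<bullet> snd y = of_int m"
      using xy(1,2) by (simp_all add: P_def case_prod_beta del: of_int_mult)
    then have "real_of_int (q * fst x) = real_of_int (q * fst y)"
      unfolding xy(3) by linarith
    then have "q * fst x = q * fst y" by linarith
    then show "x = y" using q xy(3) by (simp add: prod_eq_iff)
  qed
  have sndP: "snd ` P m \<subseteq> F" for m by (auto simp: P_def)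
  have finP: "finite (P m)" for m
    using inj sndP F by (rule inj_on_finite)
  have cardP: "real (card (P m)) \<le> (5 * T / Y) ^ CARD('n)" for m
  proof -
    have "real (card (snd ` P m)) \<le> ((2 * (2 * T) + Y) / Y) ^ DIM(real ^ 'n)"
    proof (rule card_separated_le)
      fix x y assume "x \<in> snd ` P m" "y \<in> snd ` P m" and ne: "x \<noteq> y"
      then obtain a a' where x: "x \<in> F" "of_int (q * a) + p \<bullet> x = of_int m"
        and y: "y \<in> F" "of_int (q * a') + p \<bullet> y = of_int m"
        by (auto simp: P_def)
      show "Y \<le> dist x y"
      proof (rule ccontr)
        assume "\<not> Y \<le> dist x y"
        \<comment> \<open>Two pairs with the same value differ by a form that vanishes at the
          centre, and here its coefficient vector would be shorter than \<open>Y\<close>.\<close>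
        then have "of_int (q * (a - a')) + p \<bullet> (x - y) \<noteq> 0"
          using x(1) y(1) ne by (intro sep integral_vectors_diff) (auto simp: F_def dist_norm)
        then show False using x(2) y(2) by (simp add: inner_diff_right algebra_simps)
      qed
    next
      fix x assume "x \<in> snd ` P m"
      then have "x \<in> F" using sndP by blast
      then show "norm x \<le> 2 * T" by (simp add: F_def)
    qed (use finP pos in auto)
    \<comment> \<open>The 5 comes from \<open>4 * T + Y \<le> 5 * T\<close>.\<close>
    also have "\<dots> \<le> (5 * T / Y) ^ CARD('n)"
      using pos by (simp, intro power_mono divide_right_mono) auto
    finally show ?thesis using inj by (simp add: card_image)
  qed
  let ?S = "\<lambda>(a, b). {x \<in> ball ((1 / of_int q) *\<^sub>R p) \<rho>. \<bar>real_of_int a + b \<bullet> x\<bar> \<le> \<delta>}"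
  have E: "E = (\<Union>ab\<in>(\<Union>m\<in>A. P m). ?S ab)"
  proof (intro equalityI subsetI)
    fix x assume "x \<in> E"
    then obtain a b where x: "x \<in> ball ((1 / of_int q) *\<^sub>R p) \<rho>" and b: "b \<in> F"
      and le: "\<bar>of_int a + b \<bullet> x\<bar> \<le> \<delta>" by (auto simp: E_def F_def)
    have "p \<bullet> b \<in> \<int>" using p b by (intro Ints_inner) (auto simp: F_def)
    then obtain m0 where "p \<bullet> b = of_int m0" by (rule Ints_cases)
    then obtain m where m: "of_int (q * a) + p \<bullet> b = of_int m"
      by (metis of_int_add)
    \<comment> \<open>A form that is at most \<open>\<delta>\<close> somewhere on the ball is at
      most \<open>\<delta> + 2 * T * \<rho>\<close> at the centre, which confines
      \<open>m\<close>.\<close>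
    have "of_int m = of_int q * (of_int a + b \<bullet> ((1 / of_int q) *\<^sub>R p))"
      using m q by (simp add: algebra_simps inner_commute)
    also have "\<dots> = of_int q * ((of_int a + b \<bullet> x) - b \<bullet> (x - (1 / of_int q) *\<^sub>R p))"
      by (simp add: inner_diff_right)
    also have "\<bar>\<dots>\<bar> \<le> of_int q * (\<delta> + 2 * T * \<rho>)"
    proof -
      have "\<bar>b \<bullet> (x - (1 / of_int q) *\<^sub>R p)\<bar> \<le> norm b * norm (x - (1 / of_int q) *\<^sub>R p)"
        by (rule Cauchy_Schwarz_ineq2)
      also have "\<dots> \<le> 2 * T * \<rho>"
        using b x by (intro mult_mono) (auto simp: F_def dist_norm norm_minus_commute)
      finally show ?thesis using le q by (simp add: abs_mult mult_left_mono)
    qed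
    finally have "m \<in> A" by (simp add: A_def M_def)
    then show "x \<in> (\<Union>ab\<in>(\<Union>m\<in>A. P m). ?S ab)" using x b le m by (fastforce simp: P_def)
  next
    fix x assume "x \<in> (\<Union>ab\<in>(\<Union>m\<in>A. P m). ?S ab)"
    then show "x \<in> E" by (auto simp: E_def P_def F_def)
  qed
  have finA: "finite A" "real (card A) \<le> 2 * M + 1"
    using card_int_abs_le[OF M] by (auto simp: A_def)
  have fin: "finite (\<Union>m\<in>A. P m)" using finA finP by auto
  have meas: "?S ab \<in> lmeasurable" for ab
    using slab_lmeasurable by (auto split: prod.split)
  show "E \<in> lmeasurable"
    unfolding E using fin meas by (intro fmeasurable.finite_UN) auto
  let ?K = "6 * 2 ^ CARD('n) * (\<delta> / (\<rho> * T)) * \<mu>"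
  have "\<mu> \<ge> 0" by (simp add: \<mu>_def)
  have "measure lebesgue E \<le> (\<Sum>ab\<in>(\<Union>m\<in>A. P m). measure lebesgue (?S ab))"
    unfolding E using fin meas by (intro measure_UNION_le) (auto intro: fmeasurableD)
  also have "\<dots> \<le> (\<Sum>ab\<in>(\<Union>m\<in>A. P m). ?K)"
  proof (rule sum_mono)
    fix ab assume "ab \<in> (\<Union>m\<in>A. P m)"
    then obtain a b where ab: "ab = (a, b)" "T \<le> norm b" by (auto simp: P_def F_def)
    have "measure lebesgue (?S ab) \<le> 6 * 2 ^ DIM(real ^ 'n) * (\<delta> / (\<rho> * norm b)) * \<mu>"
      unfolding ab(1) prod.case \<mu>_def using ab(2) pos by (intro slab_measure_le) auto
    have "T > 0" "norm b > 0" using ab(2) pos by linarith+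
    note \<open>measure lebesgue (?S ab) \<le> 6 * 2 ^ DIM(real ^ 'n) * (\<delta> / (\<rho> * norm b)) * \<mu>\<close>
    also have "6 * 2 ^ DIM(real ^ 'n) * (\<delta> / (\<rho> * norm b)) * \<mu> \<le> ?K"
      using \<open>T > 0\<close> \<open>norm b > 0\<close> ab(2) pos \<open>\<mu> \<ge> 0\<close> by (simp, intro mult_right_mono mult_left_mono divide_left_mono) auto
    finally show "measure lebesgue (?S ab) \<le> ?K" .
  qed
  also have "\<dots> = real (card (\<Union>m\<in>A. P m)) * ?K" by simp
  also have "\<dots> \<le> (2 * M + 1) * (5 * T / Y) ^ CARD('n) * ?K"
  proof (rule mult_right_mono)
    have "real (card (\<Union>m\<in>A. P m)) \<le> (\<Sum>m\<in>A. real (card (P m)))"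
      using card_UN_le[OF finA(1), of P] by (simp flip: of_nat_sum)
    also have "\<dots> \<le> real (card A) * (5 * T / Y) ^ CARD('n)"
      using sum_mono[of A, OF cardP] by simp
    also have "\<dots> \<le> (2 * M + 1) * (5 * T / Y) ^ CARD('n)"
      using finA(2) pos by (intro mult_right_mono) auto
    finally show "real (card (\<Union>m\<in>A. P m)) \<le> (2 * M + 1) * (5 * T / Y) ^ CARD('n)" .
    show "0 \<le> ?K" using pos \<open>\<mu> \<ge> 0\<close> by simp
  qed
  finally show "measure lebesgue E \<le> (2 * (of_int q * (\<delta> + 2 * T * \<rho>)) + 1) * (5 * T / Y) ^ CARD('n) * ?K"
    by (simp add: M_def)
qed

section \<open>Extremal points\<close>

text \<open>Extremality of metric Diophantine approximation, for a single linear form: Dirichlet's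
  exponent \<open>CARD('n)\<close> cannot be improved. The bound at every nonzero \<open>b\<close>
  also yields linear independence over the rationals.\<close>

definition extremal :: "real ^ 'n::finite \<Rightarrow> bool" where
  "extremal \<Theta> \<longleftrightarrow> (\<forall>\<epsilon>>0. \<exists>c>0. \<forall>a::int. \<forall>b\<in>integral_vectors. b \<noteq> 0 \<longrightarrow>
     c * norm b powr (- (real CARD('n) + \<epsilon>)) \<le> \<bar>of_int a + b \<bullet> \<Theta>\<bar>)"

lemma norm_integral_ge_1:
  assumes "b \<in> integral_vectors" "b \<noteq> 0"
  shows "norm b \<ge> 1"
proof -
  obtain i where "b $ i \<noteq> 0" using assms(2) by (auto simp: vec_eq_iff)
  then have "1 \<le> \<bar>b $ i\<bar>" using assms(1) by (intro Ints_nonzero_abs_ge1) auto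
  then show ?thesis using component_le_norm_cart[of b i] by linarith
qed

lemma dyadic_interval:
  assumes "(x::real) \<ge> 1"
  obtains i :: nat where "2 ^ i \<le> x" "x < 2 * 2 ^ i"
proof -
  define k where "k = (LEAST k::nat. x < 2 ^ k)"
  have k: "x < 2 ^ k" unfolding k_def by (rule LeastI_ex) (simp add: real_arch_pow)
  with assms have "k \<noteq> 0" by (intro notI) simp
  then obtain i where i: "k = Suc i" by (cases k) auto
  have "\<not> x < 2 ^ i" using not_less_Least[of i "\<lambda>k. x < 2 ^ k"] i unfolding k_def by simp
  then show thesis using that[of i] k i by simp
qed

text \<open>The shell estimate with \<open>q = 1\<close>, \<open>p = 0\<close>,
  \<open>Y = 1\<close>, where the separation is that nonzero integral vectors have norm at least 1.
  The shell has about \<open>2 ^ (i * (CARD('n) + 1))\<close> relevant forms, each bad on a share of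
  about \<open>\<delta> / 2 ^ i\<close>, which leaves
  \<open>(2 powr (- \<epsilon>)) ^ i\<close>.\<close>

lemma summable_dyadic_shells:
  fixes \<epsilon> R :: real
  assumes "\<epsilon> > 0" "R \<ge> 1"
  defines "E \<equiv> \<lambda>i::nat. {x :: real ^ 'n::finite \<in> ball 0 R. \<exists>a::int. \<exists>b\<in>integral_vectors.
    2 ^ i \<le> norm b \<and> norm b < 2 * 2 ^ i \<and> \<bar>of_int a + b \<bullet> x\<bar> \<le> 2 powr (- ((real CARD('n) + \<epsilon>) * i))}"
  shows "E i \<in> lmeasurable" "summable (\<lambda>i. measure lebesgue (E i))"
proof -
  let ?\<mu> = "measure lebesgue (ball (0 :: real ^ 'n) R)"
  have E: "E i \<in> lmeasurable \<and> measure lebesgue (E i) \<le> 42 * 10 ^ CARD('n) * ?\<mu> * (2 powr (- \<epsilon>)) ^ i" for i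
  proof -
    define \<delta> where "\<delta> = 2 powr (- ((real CARD('n) + \<epsilon>) * real i))"
    have \<delta>: "\<delta> > 0" "\<delta> \<le> 1"
      using assms(1) powr_mono[of "- ((real CARD('n) + \<epsilon>) * real i)" 0 2] by (simp_all add: \<delta>_def)
    have sep: "of_int (1 * a) + 0 \<bullet> b \<noteq> (0 :: real)" if "b \<in> integral_vectors" "b \<noteq> 0" "norm b < 1" for a :: int and b :: "real ^ 'n"
      using norm_integral_ge_1[OF that(1,2)] that(3) by simp
    have T: "(1::real) \<le> 2 ^ i" "0 < R" using assms(2) by simp_all
    have EE: "E i = {x \<in> ball ((1 / of_int 1) *\<^sub>R 0) R. \<exists>a::int. \<exists>b\<in>integral_vectors.
      2 ^ i \<le> norm b \<and> norm b < 2 * 2 ^ i \<and> \<bar>of_int a + b \<bullet> x\<bar> \<le> \<delta>}"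
      by (simp add: E_def \<delta>_def)
    have zero: "(0 :: real ^ 'n) \<in> integral_vectors" by simp
    note shell = bad_shell_measure_le[of 1 "0 :: real ^ 'n" R \<delta> 1 "2 ^ i", OF order_refl zero T(2) \<delta>(1) zero_less_one T(1) sep]
    have meas: "E i \<in> lmeasurable"
      using shell(1) unfolding EE by simp
    have "measure lebesgue (E i) \<le> (2 * (\<delta> + 2 * 2 ^ i * R) + 1) * (5 * 2 ^ i) ^ CARD('n) *
       (6 * 2 ^ CARD('n) * (\<delta> / (R * 2 ^ i)) * ?\<mu>)"
      using shell(2) unfolding EE by simp
    also have "\<dots> \<le> (7 * 2 ^ i * R) * (5 * 2 ^ i) ^ CARD('n) * (6 * 2 ^ CARD('n) * (\<delta> / (R * 2 ^ i)) * ?\<mu>)"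
    proof (intro mult_right_mono)
      have "1 * 1 \<le> 2 ^ i * R" using T assms(2) by (intro mult_mono) auto
      moreover have "2 * (\<delta> + 2 * 2 ^ i * R) + 1 = 2 * \<delta> + 1 + 4 * (2 ^ i * R)" "7 * 2 ^ i * R = 7 * (2 ^ i * R)"
        by simp_all
      ultimately show "2 * (\<delta> + 2 * 2 ^ i * R) + 1 \<le> 7 * 2 ^ i * R" using \<delta>(2) by linarith
    qed (use \<delta> T in auto)
    also have "\<dots> = 42 * 10 ^ CARD('n) * ?\<mu> * (2 ^ (i * CARD('n)) * \<delta>)"
    proof -
      have "(10::real) ^ CARD('n) = 5 ^ CARD('n) * 2 ^ CARD('n)" by (simp flip: power_mult_distrib)
      then show ?thesis using T(2) by (simp add: power_mult_distrib power_mult)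
    qed
    also have "2 ^ (i * CARD('n)) * \<delta> = (2 powr (- \<epsilon>)) ^ i"
      unfolding \<delta>_def powr_realpow[of 2, symmetric, simplified]
      by (simp add: powr_powr algebra_simps flip: powr_realpow powr_add)
    finally show ?thesis using meas by blast
  qed
  then show "E i \<in> lmeasurable" by blast
  show "summable (\<lambda>i. measure lebesgue (E i))"
  proof (rule summable_comparison_test')
    have "(2::real) powr (- \<epsilon>) < 2 powr 0" using assms(1) by (intro powr_less_mono) auto
    then show "summable (\<lambda>i. 42 * 10 ^ CARD('n) * ?\<mu> * (2 powr (- \<epsilon>)) ^ i)"
      by (intro summable_mult summable_geometric) simp
    show "norm (measure lebesgue (E i)) \<le> 42 * 10 ^ CARD('n) * ?\<mu> * (2 powr (- \<epsilon>)) ^ i" for i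
      using E[of i] by simp
  qed
qed

text \<open>
  The bound at \<open>b\<close> follows from the one at \<open>2\<^sup>I b\<close> for large \<open>I\<close>, so a bound for large \<open>b\<close> suffices.
\<close>

lemma AE_extremal: "AE \<Theta> :: real ^ 'n::finite in lebesgue. extremal \<Theta>"
proof -
  define E where "E \<epsilon> R i = {x :: real ^ 'n \<in> ball 0 R. \<exists>a::int. \<exists>b\<in>integral_vectors.
    2 ^ i \<le> norm b \<and> norm b < 2 * 2 ^ i \<and> \<bar>of_int a + b \<bullet> x\<bar> \<le> 2 powr (- ((real CARD('n) + \<epsilon>) * i))}"
    for \<epsilon> R :: real and i :: nat
  have "AE \<Theta> in lebesgue. eventually (\<lambda>i. \<Theta> \<in> space lebesgue - E \<epsilon> R i) sequentially"
    if "\<epsilon> > 0" "R \<ge> 1" for \<epsilon> R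
  proof (rule borel_cantelli_AE1)
    show "E \<epsilon> R i \<in> sets lebesgue" "emeasure lebesgue (E \<epsilon> R i) < \<infinity>" for i
      using summable_dyadic_shells(1)[OF that, where ?'n = 'n, of i] unfolding E_def fmeasurable_def by auto
    show "summable (\<lambda>i. measure lebesgue (E \<epsilon> R i))"
      using summable_dyadic_shells(2)[OF that, where ?'n = 'n] unfolding E_def .
  qed
  \<comment> \<open>The exponents \<open>1 / (m + 1)\<close> and radii \<open>R + 1\<close> suffice,
    and being countably many they allow the quantifiers to move inside \<open>AE\<close>.\<close>
  then have "AE \<Theta> in lebesgue. \<forall>m R::nat. eventually (\<lambda>i. \<Theta> \<notin> E (1 / (real m + 1)) (real R + 1) i) sequentially"
    by (simp add: AE_all_countable)
  then show ?thesis
  proof (rule eventually_mono)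
    fix \<Theta> :: "real ^ 'n"
    assume ev: "\<forall>m R::nat. eventually (\<lambda>i. \<Theta> \<notin> E (1 / (real m + 1)) (real R + 1) i) sequentially"
    show "extremal \<Theta>"
      unfolding extremal_def
    proof (intro allI impI)
      fix \<epsilon> :: real assume "\<epsilon> > 0"
      then obtain m :: nat where m: "1 / (real m + 1) < \<epsilon>"
        by (metis add.commute nat_approx_posE of_nat_Suc)
      obtain R :: nat where R: "norm \<Theta> < real R" using reals_Archimedean2 by blast
      define s where "s = real CARD('n) + 1 / (real m + 1)"
      then have "s \<ge> 0" by simp
      obtain I where I: "\<And>i. i \<ge> I \<Longrightarrow> \<Theta> \<notin> E (1 / (real m + 1)) (real R + 1) i"
        using ev[rule_format, of m R] by (auto simp: eventually_sequentially)
      have big: "norm b powr (- s) \<le> \<bar>of_int a + b \<bullet> \<Theta>\<bar>"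
        if b: "b \<in> integral_vectors" "norm b \<ge> 2 ^ I" for a b
      proof -
        have "norm b \<ge> 1" using b(2) by (rule order_trans[rotated]) simp
        then obtain i where i: "2 ^ i \<le> norm b" "norm b < 2 * 2 ^ i" by (rule dyadic_interval)
        have "(2::real) ^ I < 2 ^ Suc i" using b(2) i(2) by simp
        then have "I \<le> i" by (simp only: power_strict_increasing_iff)
        then have "\<not> \<bar>of_int a + b \<bullet> \<Theta>\<bar> \<le> 2 powr (- (s * i))"
          using I[of i] R b i unfolding E_def s_def by auto
        moreover have "norm b powr (- s) \<le> (2 ^ i) powr (- s)"
          using i(1) \<open>s \<ge> 0\<close> by (intro powr_mono2') auto
        moreover have "(2 ^ i) powr (- s) = 2 powr (- (s * i))"
          by (simp add: powr_powr mult.commute flip: powr_realpow)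
        ultimately show ?thesis by simp
      qed
      show "\<exists>c>0. \<forall>a::int. \<forall>b\<in>integral_vectors. b \<noteq> 0 \<longrightarrow>
          c * norm b powr (- (real CARD('n) + \<epsilon>)) \<le> \<bar>of_int a + b \<bullet> \<Theta>\<bar>"
      proof (intro exI[of _ "(2 ^ I) powr (- s) / 2 ^ I"] conjI allI ballI impI)
        fix a :: int and b :: "real ^ 'n" assume b: "b \<in> integral_vectors" "b \<noteq> 0"
        have b1: "norm b \<ge> 1" using b by (rule norm_integral_ge_1)
        have "norm b powr (- (real CARD('n) + \<epsilon>)) \<le> norm b powr (- s)"
          using b1 m by (intro powr_mono) (auto simp: s_def)
        then have "(2 ^ I) powr (- s) * norm b powr (- (real CARD('n) + \<epsilon>)) \<le> (2 ^ I) powr (- s) * norm b powr (- s)"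
          by (intro mult_left_mono) auto
        also have "\<dots> = norm ((2 ^ I) *\<^sub>R b) powr (- s)" by (simp add: powr_mult)
        also have "\<dots> \<le> \<bar>of_int (2 ^ I * a) + ((2 ^ I) *\<^sub>R b) \<bullet> \<Theta>\<bar>"
          using b b1 by (intro big) auto
        also have "\<dots> = \<bar>2 ^ I * (of_int a + b \<bullet> \<Theta>)\<bar>" by (simp add: algebra_simps)
        also have "\<dots> = 2 ^ I * \<bar>of_int a + b \<bullet> \<Theta>\<bar>" by (simp add: abs_mult)
        finally show "(2 ^ I) powr (- s) / 2 ^ I * norm b powr (- (real CARD('n) + \<epsilon>)) \<le> \<bar>of_int a + b \<bullet> \<Theta>\<bar>"
          by (simp add: field_simps)
      qed simp
    qed
  qed
qed

section \<open>From linear forms to exponents\<close>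

lemma inner_homog_split: "y \<bullet> homog \<Theta> = y $ None + (\<chi> i. y $ Some i) \<bullet> \<Theta>"
  unfolding inner_homog by (simp add: inner_vec_def)

lemma norm_affine_part_le: "norm (\<chi> i. y $ Some i) \<le> norm (y :: real ^ 'n::finite option)"
proof -
  have "(\<Sum>i\<in>UNIV. (y $ Some i)\<^sup>2) = (\<Sum>j\<in>range Some. (y $ j)\<^sup>2)" by (simp add: sum.reindex)
  also have "\<dots> \<le> (\<Sum>j\<in>UNIV. (y $ j)\<^sup>2)" by (rule sum_mono2) auto
  finally show ?thesis by (simp add: norm_vec_def L2_set_def)
qed

text \<open>The measure estimates see only the coefficient vector \<open>b\<close>, the normals of
  hyperplanes are full vectors \<open>y\<close>. Nothing is lost as
  \<open>norm b \<le> norm y\<close>; for \<open>b = 0\<close> the form is a nonzero integer, whence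
  \<open>min c 1\<close>.\<close>

lemma linear_form_lower_bound:
  fixes \<Theta> :: "real ^ 'n::finite"
  assumes c: "c > 0" "\<tau> \<ge> 0"
    and lb: "\<And>(a::int) b. b \<in> integral_vectors \<Longrightarrow> b \<noteq> 0 \<Longrightarrow> c * norm b powr (- \<tau>) \<le> \<bar>of_int a + b \<bullet> \<Theta>\<bar>"
    and y: "y \<in> integral_vectors" "y \<noteq> 0"
  shows "min c 1 * norm y powr (- \<tau>) \<le> \<bar>y \<bullet> homog \<Theta>\<bar>"
proof -
  define b where "b = (\<chi> i. y $ Some i)"
  obtain a where a: "y $ None = of_int a" using y(1) by (auto elim: Ints_cases)
  have eq: "y \<bullet> homog \<Theta> = of_int a + b \<bullet> \<Theta>" by (simp add: inner_homog_split a b_def)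
  have y1: "norm y \<ge> 1" using y by (rule norm_integral_ge_1)
  show ?thesis
  proof (cases "b = 0")
    case True
    have "a \<noteq> 0"
    proof
      assume "a = 0"
      then have "y $ j = 0" for j using True a by (cases j) (auto simp: b_def vec_eq_iff)
      then show False using y(2) by (simp add: vec_eq_iff)
    qed
    then have "1 \<le> \<bar>real_of_int a\<bar>" by linarith
    moreover have "norm y powr (- \<tau>) \<le> 1" using y1 y(2) c(2) powr_mono[of "- \<tau>" 0 "norm y"] by simp
    then have "min c 1 * norm y powr (- \<tau>) \<le> 1 * 1" using c(1) by (intro mult_mono) auto
    ultimately show ?thesis by (simp add: eq True)
  next
    case False
    have b: "b \<in> integral_vectors" using y(1) by (simp add: b_def)
    have "norm y powr (- \<tau>) \<le> norm b powr (- \<tau>)"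
      using norm_affine_part_le[of y] False c(2) by (intro powr_mono2') (auto simp: b_def)
    then have "min c 1 * norm y powr (- \<tau>) \<le> c * norm b powr (- \<tau>)"
      using c(1) by (intro mult_mono) auto
    then show ?thesis using lb[OF b False, of a] by (simp add: eq)
  qed
qed

lemma linear_form_lower_bound_lin_indep:
  fixes \<Theta> :: "real ^ 'n::finite"
  assumes "c > 0" "\<tau> \<ge> 0"
    and "\<And>(a::int) b. b \<in> integral_vectors \<Longrightarrow> b \<noteq> 0 \<Longrightarrow> c * norm b powr (- \<tau>) \<le> \<bar>of_int a + b \<bullet> \<Theta>\<bar>"
  shows "one_and_coords_lin_indep_rat \<Theta>"
  unfolding lin_indep_rat_iff
proof (intro ballI impI notI)
  fix y assume y: "y \<in> integral_vectors" "y \<noteq> 0" "y \<bullet> homog \<Theta> = 0"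
  have "0 < min c 1 * norm y powr (- \<tau>)" using assms(1) y(2) by simp
  then show False using linear_form_lower_bound[OF assms y(1,2)] y(3) by simp
qed

lemma omega_le_linear_form:
  fixes \<Theta> :: "real ^ 'n::{finite,linorder}"
  assumes "d < CARD('n)" "c > 0" "\<tau> \<ge> 0"
    and "\<And>(a::int) b. b \<in> integral_vectors \<Longrightarrow> b \<noteq> 0 \<Longrightarrow> c * norm b powr (- \<tau>) \<le> \<bar>of_int a + b \<bullet> \<Theta>\<bar>"
  shows "omega d \<Theta> \<le> ereal ((1 + \<tau>) / (real CARD('n) - real d) - 1)"
  by (rule omega_le[OF assms(1) _ assms(3) linear_form_lower_bound[OF assms(2-)]]) (use assms(2) in auto)

lemma extremal_lin_indep:
  fixes \<Theta> :: "real ^ 'n::finite"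
  assumes "extremal \<Theta>"
  shows "one_and_coords_lin_indep_rat \<Theta>"
proof -
  obtain c where "c > 0" "\<And>(a::int) b. b \<in> integral_vectors \<Longrightarrow> b \<noteq> 0 \<Longrightarrow>
      c * norm b powr (- (real CARD('n) + 1)) \<le> \<bar>of_int a + b \<bullet> \<Theta>\<bar>"
    using assms[unfolded extremal_def, rule_format, of 1] by auto
  then show ?thesis
    by (intro linear_form_lower_bound_lin_indep[of c "real CARD('n) + 1"]) auto
qed

lemma omega_le_extremal:
  fixes \<Theta> :: "real ^ 'n::{finite,linorder}"
  assumes d: "d < CARD('n)" and "extremal \<Theta>"
  shows "omega d \<Theta> \<le> ereal ((real d + 1) / (real CARD('n) - real d))"
proof (rule ereal_le_epsilon2)
  fix e :: real assume e: "e > 0"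
  let ?m = "real CARD('n) - real d"
  have m: "?m > 0" using d by simp
  define \<epsilon> where "\<epsilon> = e * ?m"
  have "\<epsilon> > 0" using e m by (simp add: \<epsilon>_def)
  then obtain c where c: "c > 0" "\<And>(a::int) b. b \<in> integral_vectors \<Longrightarrow> b \<noteq> 0 \<Longrightarrow>
     c * norm b powr (- (real CARD('n) + \<epsilon>)) \<le> \<bar>of_int a + b \<bullet> \<Theta>\<bar>"
    using assms(2)[unfolded extremal_def, rule_format, OF \<open>\<epsilon> > 0\<close>] by auto
  have "omega d \<Theta> \<le> ereal ((1 + (real CARD('n) + \<epsilon>)) / ?m - 1)"
    using \<open>\<epsilon> > 0\<close> by (intro omega_le_linear_form[OF d c(1) _ c(2)]) auto
  also have "(1 + (real CARD('n) + \<epsilon>)) / ?m - 1 = (real d + 1) / ?m + e"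
    using m by (simp add: \<epsilon>_def field_simps)
  finally show "omega d \<Theta> \<le> ereal ((real d + 1) / ?m) + ereal e" by simp
qed

text \<open>Dirichlet's theorem bounds \<open>q\<close> only from above. To force
  \<open>q > M\<close>, the quality \<open>1 / N\<close> is taken below the least distance
  \<open>\<mu>\<close> of \<open>q * \<Theta> $ i0\<close> to an integer over the positive
  \<open>q\<close> up to \<lceil>M\<rceil>, which is positive because \<open>\<Theta> $ i0\<close>
  is irrational.\<close>

lemma simultaneous_approximation:
  fixes \<Theta> :: "real ^ 'n::finite" and M :: real
  assumes ind: "one_and_coords_lin_indep_rat \<Theta>"
  obtains q :: int and p where "of_int q > M" "q \<ge> 1" "p \<in> integral_vectors"
    "norm (of_int q *\<^sub>R \<Theta> - p) \<le> CARD('n) * of_int q powr (- 1 / CARD('n))"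
proof -
  let ?n = "CARD('n)"
  define i0 :: 'n where "i0 = undefined"
  define \<mu> where "\<mu> = Min (insert 1 ((\<lambda>q::int. \<bar>of_int q * \<Theta> $ i0 - of_int (round (of_int q * \<Theta> $ i0))\<bar>) ` {1..\<lceil>M\<rceil>}))"
  have irr: "of_int q * \<Theta> $ i0 - of_int r \<noteq> 0" if "q \<ge> 1" for q r :: int
  proof -
    define y :: "real ^ 'n option" where "y = (\<chi> j. case j of None \<Rightarrow> - of_int r | Some i \<Rightarrow> if i = i0 then of_int q else 0)"
    have "y \<in> integral_vectors" by (auto simp: y_def split: option.split)
    moreover have "y $ Some i0 \<noteq> 0" using that by (simp add: y_def)
    then have "y \<noteq> 0" by auto
    moreover have "y \<bullet> homog \<Theta> = of_int q * \<Theta> $ i0 - of_int r"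
      by (simp add: inner_homog y_def if_distrib[of "\<lambda>x. x * _"] cong: if_cong)
    ultimately show ?thesis using ind unfolding lin_indep_rat_iff by metis
  qed
  have "\<mu> > 0"
    using irr unfolding \<mu>_def by (subst Min_gr_iff) auto
  obtain N :: nat where N: "1 / \<mu> < real N" using reals_Archimedean2 by blast
  then have N0: "N > 0" using \<open>\<mu> > 0\<close> by (metis divide_pos_pos less_trans of_nat_0_less_iff zero_less_one)
  obtain e :: "nat \<Rightarrow> 'n" where e: "bij_betw e {0..<?n} UNIV"
    using ex_bij_betw_nat_finite[of "UNIV :: 'n set"] by auto
  obtain q p where q: "0 < q" "q \<le> int (N ^ ?n)" and p: "\<And>i. i < ?n \<Longrightarrow> \<bar>of_int q * \<Theta> $ e i - of_int (p i)\<bar> < 1 / N"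
    using Dirichlet_approx_simult[OF N0, of ?n "\<lambda>i. \<Theta> $ e i"] by blast
  define f where "f = inv_into {0..<?n} e"
  have f: "f i < ?n" "e (f i) = i" for i
    using e inv_into_into[of i e "{0..<?n}"] f_inv_into_f[of i e "{0..<?n}"] by (auto simp: f_def bij_betw_def)
  define P where "P = (\<chi> i. real_of_int (p (f i)))"
  have comp: "\<bar>(of_int q *\<^sub>R \<Theta> - P) $ i\<bar> < 1 / N" for i
    using p[OF f(1), of i] f(2)[of i] by (simp add: P_def)
  have "norm (of_int q *\<^sub>R \<Theta> - P) \<le> (\<Sum>i\<in>UNIV. \<bar>(of_int q *\<^sub>R \<Theta> - P) $ i\<bar>)"
    by (rule norm_le_l1_cart)
  also have "\<dots> \<le> (\<Sum>i\<in>(UNIV :: 'n set). 1 / N)"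
    using comp by (intro sum_mono less_imp_le)
  also have "\<dots> = ?n * (1 / N)" by simp
  also have "1 / N \<le> of_int q powr (- 1 / ?n)"
  proof -
    have "of_int q \<le> real N ^ ?n" using q(2) by (metis of_int_le_iff of_int_of_nat_eq of_nat_power)
    then have "(real N ^ ?n) powr (- 1 / ?n) \<le> of_int q powr (- 1 / ?n)"
      using q(1) by (intro powr_mono2') auto
    moreover have "(real N ^ ?n) powr (- 1 / ?n) = 1 / N"
      using N0 by (simp add: powr_powr powr_minus_divide flip: powr_realpow)
    ultimately show ?thesis by simp
  qed
  finally have "norm (of_int q *\<^sub>R \<Theta> - P) \<le> ?n * of_int q powr (- 1 / ?n)" by (simp add: mult_left_mono)
  moreover have "of_int q > M"
  proof (rule ccontr)
    assume "\<not> of_int q > M"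
    then have "q \<in> {1..\<lceil>M\<rceil>}" using q(1) by (auto simp: le_ceiling_iff)
    then have "\<mu> \<le> \<bar>of_int q * \<Theta> $ i0 - of_int (round (of_int q * \<Theta> $ i0))\<bar>"
      unfolding \<mu>_def by (intro Min_le) auto
    also have "\<dots> \<le> \<bar>of_int q * \<Theta> $ i0 - of_int (p (f i0))\<bar>"
      using round_diff_minimal by blast
    also have "\<dots> < 1 / N" using comp[of i0] by (simp add: P_def)
    finally show False using N \<open>\<mu> > 0\<close> N0 by (simp add: field_simps)
  qed
  moreover have "P \<in> integral_vectors" by (simp add: P_def)
  ultimately show thesis using q(1) by (intro that[of q P]) auto
qed

lemma omega_ge_approximable:
  fixes \<Theta> :: "real ^ 'n::{finite,linorder}"
  assumes d: "d < CARD('n)" and ind: "one_and_coords_lin_indep_rat \<Theta>" and w: "w \<ge> 0" and D: "D > 0"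
    and approx: "\<And>M::real. \<exists>q::int. \<exists>p\<in>integral_vectors. of_int q > M \<and>
      norm (of_int q *\<^sub>R \<Theta> - p) \<le> D * of_int q powr (- w)"
  shows "omega d \<Theta> \<ge> ereal (real CARD('n) * (1 + w) / (real CARD('n) - real d) - 1)"
proof (rule omega_ge[OF d ind w D])
  fix M :: real
  obtain q :: int and p where q: "of_int q > M" "p \<in> integral_vectors" "norm (of_int q *\<^sub>R \<Theta> - p) \<le> D * of_int q powr (- w)"
    using approx by blast
  define x :: "real ^ 'n option" where "x = (\<chi> j. case j of None \<Rightarrow> of_int q | Some i \<Rightarrow> p $ i)"
  have "x \<in> integral_vectors" using q(2) by (auto simp: x_def split: option.split)
  moreover have "norm (x - x $ None *\<^sub>R homog \<Theta>) = norm (of_int q *\<^sub>R \<Theta> - p)"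
  proof -
    have "(\<Sum>j\<in>UNIV. ((x - x $ None *\<^sub>R homog \<Theta>) $ j)\<^sup>2) = (\<Sum>i\<in>UNIV. ((of_int q *\<^sub>R \<Theta> - p) $ i)\<^sup>2)"
      by (simp add: UNIV_option_conv sum.reindex x_def homog_def power2_commute)
    then show ?thesis by (simp add: norm_vec_def L2_set_def)
  qed
  ultimately show "\<exists>x\<in>integral_vectors. x $ None > M \<and> norm (x - x $ None *\<^sub>R homog \<Theta>) \<le> D * (x $ None) powr (- w)"
    using q by (intro bexI[of _ x]) (auto simp: x_def)
qed

lemma omega_ge_lin_indep:
  fixes \<Theta> :: "real ^ 'n::{finite,linorder}"
  assumes d: "d < CARD('n)" and ind: "one_and_coords_lin_indep_rat \<Theta>"
  shows "omega d \<Theta> \<ge> ereal ((real d + 1) / (real CARD('n) - real d))"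
proof -
  have "omega d \<Theta> \<ge> ereal (real CARD('n) * (1 + 1 / CARD('n)) / (real CARD('n) - real d) - 1)"
  proof (rule omega_ge_approximable[OF d ind])
    fix M :: real
    obtain q :: int and p where "of_int q > M" "p \<in> integral_vectors"
      "norm (of_int q *\<^sub>R \<Theta> - p) \<le> CARD('n) * of_int q powr (- 1 / CARD('n))"
      using simultaneous_approximation[OF ind, of M] by blast
    then show "\<exists>q::int. \<exists>p\<in>integral_vectors. of_int q > M \<and>
      norm (of_int q *\<^sub>R \<Theta> - p) \<le> real CARD('n) * of_int q powr (- (1 / CARD('n)))"
      by auto
  qed auto
  also have "real CARD('n) * (1 + 1 / CARD('n)) / (real CARD('n) - real d) - 1 = (real d + 1) / (real CARD('n) - real d)"
    using d by (simp add: field_simps)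
  finally show ?thesis .
qed

section \<open>The spectrum\<close>

text \<open>The weights \<open>(1 - g) * g ^ i\<close> sum to 1, so all \<open>E i\<close> together
  have at most half the measure of the ball, and a null set cannot fill the rest.\<close>

lemma exists_outside_small_sets:
  fixes p :: "'a::euclidean_space"
  assumes r: "r > 0" and g: "0 \<le> g" "g < 1"
    and E: "\<And>i. E i \<in> lmeasurable" "\<And>i. measure lebesgue (E i) \<le> (1 - g) * g ^ i * (measure lebesgue (ball p r) / 2)"
    and P: "AE x in lebesgue. P x"
  shows "\<exists>x\<in>ball p r. P x \<and> (\<forall>i::nat. x \<notin> E i)"
proof (rule ccontr)
  let ?\<mu> = "measure lebesgue (ball p r)"
  assume no: "\<not> (\<exists>x\<in>ball p r. P x \<and> (\<forall>i. x \<notin> E i))"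
  obtain N where N: "{x \<in> space lebesgue. \<not> P x} \<subseteq> N" "emeasure lebesgue N = 0" "N \<in> sets lebesgue"
    using P by (rule AE_E)
  then have null: "N \<in> null_sets lebesgue" by (intro null_setsI)
  have sets: "E i \<in> sets lebesgue" for i using E(1) by (rule fmeasurableD)
  have "x \<in> N" if "\<not> P x" for x using N(1) that by auto
  then have "ball p r \<subseteq> (\<Union>i. E i) \<union> N" using no by blast
  then have "emeasure lebesgue (ball p r) \<le> emeasure lebesgue ((\<Union>i. E i) \<union> N)"
    using N sets by (intro emeasure_mono) auto
  also have "\<dots> = emeasure lebesgue (\<Union>i. E i)"
    using sets null by (intro emeasure_Un_null_set) auto
  also have "\<dots> \<le> (\<Sum>i. emeasure lebesgue (E i))"
    using sets by (intro emeasure_subadditive_countably) auto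
  also have "\<dots> \<le> (\<Sum>i. ennreal ((1 - g) * g ^ i * (?\<mu> / 2)))"
    using E by (intro suminf_le) (auto simp: emeasure_eq_measure2 intro!: ennreal_leI)
  also have "\<dots> = ennreal (?\<mu> / 2)"
  proof (rule suminf_ennreal_eq)
    have "(\<lambda>i. g ^ i) sums (1 / (1 - g))" using g by (intro geometric_sums) auto
    then have "(\<lambda>i. (1 - g) * g ^ i * (?\<mu> / 2)) sums ((1 - g) * (1 / (1 - g)) * (?\<mu> / 2))"
      by (intro sums_mult sums_mult2)
    then show "(\<lambda>i. (1 - g) * g ^ i * (?\<mu> / 2)) sums (?\<mu> / 2)" using g by simp
  qed (use g in auto)
  finally have "ennreal ?\<mu> \<le> ennreal (?\<mu> / 2)"
    by (simp add: emeasure_eq_measure2[OF lmeasurable_ball])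
  then have "?\<mu> \<le> ?\<mu> / 2" by (subst (asm) ennreal_le_iff) auto
  moreover have "?\<mu> > 0" using content_ball_pos[OF r, of p] by (simp add: measure_completion)
  ultimately show False by linarith
qed

text \<open>
  The point is taken in a ball around a Dirichlet approximation \<open>p / q\<close> of \<open>\<Theta>\<close>. Linear forms with
  \<open>\<bar>b\<bar> < Y\<close> inherit their lower bound from \<open>\<Theta>\<close>, and those with \<open>\<bar>b\<bar> \<ge> Y\<close> are avoided up to
  small measure: since \<open>\<Theta>\<close> is extremal, the lattice orthogonal to \<open>(q, p)\<close> has no short vectors.
\<close>

lemma perturb_to_approximable:
  fixes \<Theta> :: "real ^ 'n::finite"
  defines "n \<equiv> real CARD('n)"
  assumes ext: "extremal \<Theta>" and w: "1 / n \<le> w'" "w' < w" and \<tau>: "\<tau> = n * (1 + w) - 1"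
    and c: "0 < c0" "c0 < c1"
    and lb: "\<And>(a::int) b. b \<in> integral_vectors \<Longrightarrow> b \<noteq> 0 \<Longrightarrow> c1 * norm b powr (- \<tau>) \<le> \<bar>of_int a + b \<bullet> \<Theta>\<bar>"
    and \<eta>: "\<eta> > 0"
  shows "\<exists>\<Theta>' c2 (q::int) p. extremal \<Theta>' \<and> c0 < c2 \<and>
    (\<forall>a::int. \<forall>b\<in>integral_vectors. b \<noteq> 0 \<longrightarrow> c2 * norm b powr (- \<tau>) \<le> \<bar>of_int a + b \<bullet> \<Theta>'\<bar>) \<and>
    dist \<Theta>' \<Theta> < \<eta> \<and> of_int q > (M::real) \<and> q \<ge> 1 \<and> p \<in> integral_vectors \<and>
    norm (of_int q *\<^sub>R \<Theta>' - p) < of_int q powr (- w')"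
proof -
  have n1: "n \<ge> 1" unfolding n_def by (simp add: Suc_leI)
  have n_inv: "1 / n \<le> 1" "1 / n > 0" using n1 by (auto simp: field_simps)
  have \<tau>n: "\<tau> > n"
  proof -
    have "1 / n < w" using w by linarith
    then have "1 < n * w" using n1 by (simp add: field_simps)
    then show ?thesis by (simp add: \<tau> algebra_simps)
  qed
  define c2 where "c2 = (c0 + c1) / 2"
  have c2: "c0 < c2" "c2 < c1" "c2 > 0" using c by (auto simp: c2_def)
  \<comment> \<open>The share of its value that a linear form with short \<open>b\<close> may lose:
    \<open>(1 - \<nu>) * c1 = c2\<close>.\<close>
  define \<nu> where "\<nu> = 1 - c2 / c1"
  have \<nu>: "0 < \<nu>" "\<nu> < 1" using c2 c by (auto simp: \<nu>_def field_simps)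
  \<comment> \<open>Gives \<open>e * (\<tau> + 1) = (w - w') / 2\<close>: the loss from taking
    \<open>s\<close> below \<open>1 / n\<close> is covered by the gap between \<open>w'\<close> and
    \<open>w\<close>.\<close>
  define e where "e = (w - w') / (2 * (\<tau> + 1))"
  have e: "e > 0" using w \<tau>n n1 by (simp add: e_def)
  have e\<tau>: "e * (\<tau> + 1) < w - w'"
  proof -
    have "x / (2 * y) * y = x / 2" if "y > 0" for x y :: real using that by simp
    moreover have "\<tau> + 1 > 0" using \<tau>n n1 by simp
    ultimately have "e * (\<tau> + 1) = (w - w') / 2" unfolding e_def by blast
    then show ?thesis using w by simp
  qed
  \<comment> \<open>\<open>Y = q powr s\<close> will be a lower bound for the coefficient vectors of
    forms that vanish at \<open>p / q\<close>; the ideal exponent would be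
    \<open>1 / n\<close>.\<close>
  define s where "s = 1 / n - e"
  have s\<tau>: "s * (\<tau> + 1) = 1 + w - e * (\<tau> + 1)"
    using n1 by (simp add: s_def \<tau> algebra_simps)
  have s0: "s > 0"
  proof -
    have "e * (\<tau> + 1) < 1 + w" using e\<tau> w n_inv by linarith
    then have "s * (\<tau> + 1) > 0" using s\<tau> by simp
    then show ?thesis using \<tau>n n1 by (simp add: zero_less_mult_iff)
  qed
  obtain c' where c': "c' > 0" "\<And>(a::int) b. b \<in> integral_vectors \<Longrightarrow> b \<noteq> 0 \<Longrightarrow>
      c' * norm b powr (- (n + e)) \<le> \<bar>of_int a + b \<bullet> \<Theta>\<bar>"
    using ext[unfolded extremal_def, rule_format, OF e] unfolding n_def by auto
  \<comment> \<open>The rate at which the bounds for the bad sets decrease from one dyadic shell to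
    the next.\<close>
  define g where "g = 2 powr (n - \<tau>)"
  have g: "0 < g" "g < 1"
    using \<tau>n powr_less_mono[of "n - \<tau>" 0 2] by (simp_all add: g_def)
  define K where "K = 6 * 10 ^ CARD('n) * c2 / (1 - g)"
  have K: "K > 0" using g c2 by (simp add: K_def)

  \<comment> \<open>The four exponents govern, in this order: the distance of the new point from
    \<open>\<Theta>\<close>; the survival of the forms with \<open>norm b \<le> Y\<close>; the bad
    forms from a bounded number of values at \<open>p / q\<close>; and those from the remaining
    values, whose number grows with the shell.\<close>
  have ex1: "- 1 - 1 / n < 0" using n_inv by linarith
  have ex2: "s * (n + 1 + e) - 1 - 1 / n < 0"
  proof -
    have "s * (n + 1 + e) - 1 - 1 / n = e * (1 / n - (n + 1 + e))"
    proof -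
      have "(1 / n) * (n + 1 + e) = 1 + 1 / n + e / n" using n1 by (simp add: add_divide_distrib)
      then show ?thesis unfolding s_def left_diff_distrib by (simp add: right_diff_distrib)
    qed
    moreover have "1 / n - (n + 1 + e) < 0" using n_inv n1 e by linarith
    ultimately show ?thesis using e by (simp add: mult_less_0_iff)
  qed
  have ex3: "1 + w' - s * (\<tau> + 1) < 0" using s\<tau> e\<tau> by simp
  have ex4: "1 - s * \<tau> < 0"
  proof -
    have "s * \<tau> = s * (\<tau> + 1) - s" by (simp add: distrib_left)
    moreover have "s = 1 / n - e" by (rule s_def)
    ultimately show ?thesis using s\<tau> e\<tau> w e by linarith
  qed
  obtain q1 where q1: "q1 \<ge> 1" "\<And>q. q \<ge> q1 \<Longrightarrow> (n + 1) * q powr (- 1 - 1 / n) \<le> (\<eta> / 2) * q powr 0"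
    using eventually_powr_compare[OF _ ex1, of "\<eta> / 2" "n + 1"] \<eta> by auto
  obtain q2 where q2: "q2 \<ge> 1" "\<And>q. q \<ge> q2 \<Longrightarrow> ((n + 1) / \<nu>) * q powr (s * (n + 1 + e) - 1 - 1 / n) \<le> c' * q powr 0"
    using eventually_powr_compare[OF c'(1) ex2] by blast
  obtain q3 where q3: "q3 \<ge> 1" "\<And>q. q \<ge> q3 \<Longrightarrow> (3 * K) * q powr (1 + w' - s * (\<tau> + 1)) \<le> (1 / 4) * q powr 0"
    using eventually_powr_compare[OF _ ex3, of "1 / 4" "3 * K"] by auto
  obtain q4 where q4: "q4 \<ge> 1" "\<And>q. q \<ge> q4 \<Longrightarrow> (4 * K) * q powr (1 - s * \<tau>) \<le> (1 / 4) * q powr 0"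
    using eventually_powr_compare[OF _ ex4, of "1 / 4" "4 * K"] by auto
  obtain q5 where q5: "q5 \<ge> 1" "\<And>q. q \<ge> q5 \<Longrightarrow> c2 * q powr (1 - s * \<tau>) \<le> 1 * q powr 0"
    using eventually_powr_compare[OF _ ex4, of 1 c2] by auto
  obtain qi :: int and p where qi: "of_int qi > max M (max q1 (max q2 (max q3 (max q4 q5))))" "qi \<ge> 1"
    and p: "p \<in> integral_vectors" "norm (of_int qi *\<^sub>R \<Theta> - p) \<le> n * of_int qi powr (- 1 / n)"
    using simultaneous_approximation[OF extremal_lin_indep[OF ext]] unfolding n_def by blast
  define q where "q = real_of_int qi"
  have q: "q > M" "q \<ge> 1" "q \<ge> q1" "q \<ge> q2" "q \<ge> q3" "q \<ge> q4" "q \<ge> q5"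
    using qi by (auto simp: q_def)
  have base: "q * q powr x = q powr (1 + x)" for x
    using powr_mult_base[of q x] q(2) by simp
  define \<rho> where "\<rho> = q powr (- 1 - w')"
  define Y where "Y = q powr s"
  \<comment> \<open>Bounds the distance of the new point from \<open>\<Theta>\<close>: the
    \<open>n\<close> comes from the Dirichlet approximation and the 1 from the radius
    \<open>\<rho>\<close>, where \<open>1 / n \<le> w'\<close> enters.\<close>
  define \<kappa> where "\<kappa> = (n + 1) * q powr (- 1 - 1 / n)"
  have pos: "\<rho> > 0" "Y \<ge> 1" "\<kappa> > 0" using q s0 n1 by (auto simp: \<rho>_def Y_def \<kappa>_def ge_one_powr_ge_zero)
  define z where "z = (1 / q) *\<^sub>R p"
  have dist_z: "norm (\<Theta> - z) \<le> n * q powr (- 1 - 1 / n)"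
  proof -
    have "\<Theta> - z = (1 / q) *\<^sub>R (q *\<^sub>R \<Theta> - p)" using q(2) by (simp add: z_def algebra_simps)
    then have "norm (\<Theta> - z) = norm (q *\<^sub>R \<Theta> - p) / q" using q(2) by simp
    also have "\<dots> \<le> n * q powr (- 1 / n) / q"
      using p(2) q(2) unfolding q_def by (intro divide_right_mono) auto
    also have "\<dots> = n * q powr (- 1 - 1 / n)"
      using q(2) by (simp add: powr_diff powr_minus_divide)
    finally show ?thesis .
  qed
  \<comment> \<open>The displacement changes a form by at most \<open>norm b * \<kappa>\<close>. By
    extremality of \<open>\<Theta>\<close> this is at most the share \<open>\<nu>\<close> of its
    value as long as \<open>norm b \<le> Y\<close>.\<close>
  have small: "norm b * \<kappa> / \<nu> \<le> \<bar>of_int a + b \<bullet> \<Theta>\<bar>"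
    if b: "b \<in> integral_vectors" "b \<noteq> 0" "norm b \<le> Y" for a :: int and b
  proof -
    have "norm b powr (n + 1 + e) \<le> Y powr (n + 1 + e)"
      using b(3) n1 e by (intro powr_mono2) auto
    then have "norm b powr (n + 1 + e) * (\<kappa> / \<nu>) \<le> Y powr (n + 1 + e) * (\<kappa> / \<nu>)"
      using pos \<nu> by (intro mult_right_mono) auto
    also have "\<dots> = ((n + 1) / \<nu>) * (q powr (s * (n + 1 + e)) * q powr (- 1 - 1 / n))"
      by (simp add: Y_def \<kappa>_def powr_powr)
    also have "q powr (s * (n + 1 + e)) * q powr (- 1 - 1 / n) = q powr (s * (n + 1 + e) - 1 - 1 / n)"
      by (subst powr_add[symmetric], rule arg_cong[of _ _ "(powr) q"]) simp
    also have "((n + 1) / \<nu>) * \<dots> \<le> c'" using q2(2)[OF q(4)] q(2) by simp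
    finally have "norm b powr (n + 1 + e) * (\<kappa> / \<nu>) * norm b powr (- (n + e)) \<le> c' * norm b powr (- (n + e))"
      by (intro mult_right_mono) auto
    also have "\<dots> \<le> \<bar>of_int a + b \<bullet> \<Theta>\<bar>" using c'(2)[OF b(1,2)] .
    also have "norm b powr (n + 1 + e) * (\<kappa> / \<nu>) * norm b powr (- (n + e)) = norm b * \<kappa> / \<nu>"
    proof -
      have "norm b powr (n + 1 + e) * norm b powr (- (n + e)) = norm b powr 1"
        unfolding powr_add[symmetric] by simp
      also have "\<dots> = norm b" using b(2) by simp
      finally show ?thesis by (metis (no_types, lifting) mult.commute mult.left_commute times_divide_eq_right)
    qed
    finally show ?thesis .
  qed
  \<comment> \<open>A form vanishing at \<open>z\<close> has at most the value
    \<open>norm b * norm (\<Theta> - z)\<close> at \<open>\<Theta>\<close>, too little for the bound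
    just proved.\<close>
  have sep: "of_int (qi * a) + p \<bullet> b \<noteq> (0 :: real)" if b: "b \<in> integral_vectors" "b \<noteq> 0" "norm b < Y" for a :: int and b
  proof
    assume "of_int (qi * a) + p \<bullet> b = (0 :: real)"
    then have "of_int a + b \<bullet> z = 0" using q(2) by (simp add: z_def q_def field_simps inner_commute)
    then have "\<bar>of_int a + b \<bullet> \<Theta>\<bar> = \<bar>b \<bullet> (\<Theta> - z)\<bar>" by (simp add: inner_diff_right)
    also have "\<dots> \<le> norm b * norm (\<Theta> - z)" by (rule Cauchy_Schwarz_ineq2)
    also have "\<dots> \<le> norm b * (n * q powr (- 1 - 1 / n))"
      using dist_z by (intro mult_left_mono) auto
    also have "\<dots> < norm b * \<kappa>"
      using b(2) q(2) by (intro mult_strict_left_mono) (auto simp: \<kappa>_def algebra_simps)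
    also have "\<dots> \<le> norm b * \<kappa> / \<nu>"
      using \<nu> pos(3) mult_left_mono[of \<nu> 1 "norm b * \<kappa>"] by (simp add: field_simps)
    also have "\<dots> \<le> \<bar>of_int a + b \<bullet> \<Theta>\<bar>" using b by (intro small) auto
    finally show False by simp
  qed
  let ?\<mu> = "measure lebesgue (ball z \<rho>)"
  define T where "T i = 2 ^ i * Y" for i :: nat
  define \<delta> where "\<delta> i = c2 * T i powr (- \<tau>)" for i
  define E where "E i = {x \<in> ball z \<rho>. \<exists>a::int. \<exists>b\<in>integral_vectors.
    T i \<le> norm b \<and> norm b < 2 * T i \<and> \<bar>of_int a + b \<bullet> x\<bar> \<le> \<delta> i}" for i
  have T: "T i > 0" "Y \<le> T i" for i
  proof -
    show "T i > 0" using pos(2) by (simp add: T_def)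
    have "1 * Y \<le> 2 ^ i * Y" using pos(2) by (intro mult_right_mono) auto
    then show "Y \<le> T i" by (simp add: T_def)
  qed
  have \<delta>: "\<delta> i > 0" for i using T(1)[of i] c2(3) by (simp add: \<delta>_def)
  have Y0: "0 < Y" using pos(2) by simp
  have E_bound: "E i \<in> lmeasurable \<and> measure lebesgue (E i) \<le> (1 - g) * g ^ i * (?\<mu> / 2)" for i
  proof -
    note shell = bad_shell_measure_le[OF qi(2) p(1) pos(1) \<delta>[of i] Y0 T(2)[of i] sep, folded q_def, folded z_def, folded E_def]
    have Ei: "E i \<in> lmeasurable"
      using shell(1) by simp
    have "measure lebesgue (E i) \<le> (2 * (q * (\<delta> i + 2 * T i * \<rho>)) + 1) * (5 * T i / Y) ^ CARD('n) *
       (6 * 2 ^ CARD('n) * (\<delta> i / (\<rho> * T i)) * ?\<mu>)"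
      using shell(2) by simp
    \<comment> \<open>The threshold \<open>q5\<close> ensures \<open>q * \<delta> i \<le> 1\<close>,
      which turns the 1 into a 3.\<close>
    also have "\<dots> \<le> (3 + 4 * q * T i * \<rho>) * (5 * T i / Y) ^ CARD('n) *
       (6 * 2 ^ CARD('n) * (\<delta> i / (\<rho> * T i)) * ?\<mu>)"
    proof (intro mult_right_mono)
      have "T i powr (- \<tau>) \<le> Y powr (- \<tau>)" using T Y0 \<tau>n n1 by (intro powr_mono2') auto
      then have "q * \<delta> i \<le> q * (c2 * Y powr (- \<tau>))"
        using c2 q(2) unfolding \<delta>_def by (intro mult_left_mono) auto
      also have "\<dots> = c2 * (q * q powr (- (s * \<tau>)))" by (simp add: Y_def powr_powr)
      also have "\<dots> = c2 * q powr (1 - s * \<tau>)" using base[of "- (s * \<tau>)"] by simp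
      also have "\<dots> \<le> 1" using q5(2)[OF q(7)] q(2) by simp
      finally show "2 * (q * (\<delta> i + 2 * T i * \<rho>)) + 1 \<le> 3 + 4 * q * T i * \<rho>" by (simp add: algebra_simps)
    qed (use T[of i] Y0 \<delta>[of i] pos in auto)
    also have "\<dots> = 6 * 10 ^ CARD('n) * c2 * ?\<mu> *
       (3 * ((2 ^ i) ^ CARD('n) * T i powr (- \<tau>) / (\<rho> * T i)) + 4 * q * ((2 ^ i) ^ CARD('n) * T i powr (- \<tau>)))"
    proof -
      have "(5 * T i / Y) ^ CARD('n) = 5 ^ CARD('n) * (2 ^ i) ^ CARD('n)"
        using Y0 by (simp add: T_def power_mult_distrib)
      moreover have "(10::real) ^ CARD('n) = 5 ^ CARD('n) * 2 ^ CARD('n)" by (simp flip: power_mult_distrib)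
      moreover have "(3 + 4 * q * T i * \<rho>) * (X * X') * (6 * X'' * (c2 * t / (\<rho> * T i)) * ?\<mu>) =
        6 * (X * X'') * c2 * ?\<mu> * (3 * (X' * t / (\<rho> * T i)) + 4 * q * (X' * t))" for X X' X'' t
        using T(1)[of i] pos(1) by (simp add: field_simps)
      ultimately show ?thesis by (simp add: \<delta>_def)
    qed
    also have "\<dots> \<le> 6 * 10 ^ CARD('n) * c2 * ?\<mu> *
       (3 * (g ^ i * q powr (1 + w' - s * (\<tau> + 1))) + 4 * (g ^ i * q powr (1 - s * \<tau>)))"
    proof (intro mult_left_mono add_mono)
      have A: "(2 ^ i) ^ CARD('n) * T i powr (- \<tau>) = g ^ i * q powr (- (s * \<tau>))"
      proof -
        have "(2 ^ i) powr n * (2 ^ i) powr (- \<tau>) = g ^ i"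
          by (simp add: g_def powr_powr flip: powr_realpow powr_add) (simp add: algebra_simps)
        moreover have "(2 ^ i) ^ CARD('n) = ((2 ^ i) powr n :: real)" by (simp add: n_def powr_realpow)
        ultimately show ?thesis using Y0 by (simp add: T_def powr_mult Y_def powr_powr)
      qed
      have "1 / (\<rho> * T i) \<le> 1 / (\<rho> * Y)"
        using T pos(1) Y0 by (intro divide_left_mono mult_left_mono) auto
      then have "g ^ i * q powr (- (s * \<tau>)) * (1 / (\<rho> * T i)) \<le> g ^ i * q powr (- (s * \<tau>)) * (1 / (\<rho> * Y))"
        using g by (intro mult_left_mono) auto
      also have "1 / (\<rho> * Y) = q powr (1 + w' - s)"
      proof -
        have "\<rho> * Y = q powr (- (1 + w' - s))" unfolding \<rho>_def Y_def powr_add[symmetric] by (simp add: algebra_simps)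
        then show ?thesis unfolding powr_minus_divide by simp
      qed
      also have "g ^ i * q powr (- (s * \<tau>)) * q powr (1 + w' - s) = g ^ i * q powr (1 + w' - s * (\<tau> + 1))"
        by (simp add: mult.assoc algebra_simps flip: powr_add)
      finally show "(2 ^ i) ^ CARD('n) * T i powr (- \<tau>) / (\<rho> * T i) \<le> g ^ i * q powr (1 + w' - s * (\<tau> + 1))"
        unfolding A by simp
      have B: "q * (g ^ i * q powr (- (s * \<tau>))) = g ^ i * q powr (1 - s * \<tau>)"
        using base[of "- (s * \<tau>)"] by (simp add: mult.left_commute)
      show "4 * q * ((2 ^ i) ^ CARD('n) * T i powr (- \<tau>)) \<le> 4 * (g ^ i * q powr (1 - s * \<tau>))"
        unfolding A mult.assoc B by (rule order_refl)
    qed (use c2 in auto)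
    also have "\<dots> = (1 - g) * g ^ i * ?\<mu> * (3 * K * q powr (1 + w' - s * (\<tau> + 1)) + 4 * K * q powr (1 - s * \<tau>))"
    proof -
      have eq: "6 * 10 ^ CARD('n) * c2 = (1 - g) * K" using g by (simp add: K_def)
      show ?thesis unfolding eq by (simp add: algebra_simps)
    qed
    also have "\<dots> \<le> (1 - g) * g ^ i * ?\<mu> * (1 / 4 + 1 / 4)"
      using g q3(2)[OF q(5)] q4(2)[OF q(6)] q(2) by (intro mult_left_mono add_mono) auto
    finally show ?thesis using Ei by simp
  qed
  obtain \<Theta>' where \<Theta>': "\<Theta>' \<in> ball z \<rho>" "extremal \<Theta>'" "\<And>i. \<Theta>' \<notin> E i"
    using exists_outside_small_sets[OF pos(1) less_imp_le[OF g(1)] g(2), of E z extremal] E_bound AE_extremal by blast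
  have close: "norm (\<Theta>' - \<Theta>) \<le> \<kappa>"
  proof -
    have "norm (\<Theta>' - \<Theta>) \<le> norm (\<Theta>' - z) + norm (\<Theta> - z)"
      using norm_triangle_ineq4[of "\<Theta>' - z" "\<Theta> - z"] by simp
    also have "norm (\<Theta>' - z) \<le> q powr (- 1 - 1 / n)"
    proof -
      have "norm (\<Theta>' - z) \<le> \<rho>" using \<Theta>'(1) by (simp add: dist_norm norm_minus_commute)
      also have "\<rho> \<le> q powr (- 1 - 1 / n)" unfolding \<rho>_def using q(2) w by (intro powr_mono) auto
      finally show ?thesis .
    qed
    finally show ?thesis using dist_z by (simp add: \<kappa>_def algebra_simps)
  qed
  have "c2 * norm b powr (- \<tau>) \<le> \<bar>of_int a + b \<bullet> \<Theta>'\<bar>" if b: "b \<in> integral_vectors" "b \<noteq> 0" for a :: int and b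
  proof (cases "norm b \<le> Y")
    case True
    have "\<bar>b \<bullet> (\<Theta>' - \<Theta>)\<bar> \<le> norm b * \<kappa>"
      using Cauchy_Schwarz_ineq2[of b "\<Theta>' - \<Theta>"] mult_left_mono[OF close norm_ge_zero[of b]] by linarith
    also have "\<dots> \<le> \<nu> * \<bar>of_int a + b \<bullet> \<Theta>\<bar>"
      using small[OF b True, of a] \<nu>(1) by (simp add: field_simps)
    finally have "(1 - \<nu>) * \<bar>of_int a + b \<bullet> \<Theta>\<bar> \<le> \<bar>of_int a + b \<bullet> \<Theta>'\<bar>"
      by (simp add: inner_diff_right algebra_simps)
    moreover have "(1 - \<nu>) * (c1 * norm b powr (- \<tau>)) \<le> (1 - \<nu>) * \<bar>of_int a + b \<bullet> \<Theta>\<bar>"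
      using lb[OF b] \<nu> by (intro mult_left_mono) auto
    moreover have "(1 - \<nu>) * c1 = c2" using c by (simp add: \<nu>_def)
    ultimately show ?thesis by (simp flip: mult.assoc)
  next
    case False
    then have "norm b / Y \<ge> 1" using Y0 by simp
    then obtain i where i: "2 ^ i \<le> norm b / Y" "norm b / Y < 2 * 2 ^ i" by (rule dyadic_interval)
    then have Ti: "T i \<le> norm b" "norm b < 2 * T i" using Y0 by (auto simp: T_def field_simps)
    then have "\<not> \<bar>of_int a + b \<bullet> \<Theta>'\<bar> \<le> \<delta> i"
      using \<Theta>'(1) \<Theta>'(3)[of i] b(1) unfolding E_def by blast
    moreover have "norm b powr (- \<tau>) \<le> T i powr (- \<tau>)"
      using Ti T(1)[of i] \<tau>n n1 by (intro powr_mono2') auto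
    then have "c2 * norm b powr (- \<tau>) \<le> \<delta> i" using c2 by (simp add: \<delta>_def)
    ultimately show ?thesis by simp
  qed
  moreover have "dist \<Theta>' \<Theta> < \<eta>"
    using close q1(2)[OF q(3)] q(2) \<eta> by (simp add: dist_norm \<kappa>_def)
  moreover have "norm (of_int qi *\<^sub>R \<Theta>' - p) < of_int qi powr (- w')"
  proof -
    have "norm (q *\<^sub>R \<Theta>' - p) = norm (q *\<^sub>R (\<Theta>' - z))" using q(2) by (simp add: z_def algebra_simps)
    also have "\<dots> = q * norm (\<Theta>' - z)" using q(2) by simp
    also have "\<dots> < q * \<rho>"
      using \<Theta>'(1) q(2) by (intro mult_strict_left_mono) (auto simp: dist_norm norm_minus_commute)
    also have "\<dots> = q powr (- w')" using base[of "- 1 - w'"] by (simp add: \<rho>_def)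
    finally show ?thesis by (simp add: q_def)
  qed
  moreover have "of_int qi > M" using q(1) by (simp add: q_def)
  ultimately show ?thesis
    using \<Theta>'(2) c2(1) qi(2) p(1) by blast
qed

section \<open>Points with a prescribed exponent\<close>

lemma exists_extremal: "\<exists>\<Theta> :: real ^ 'n::finite. extremal \<Theta>"
  using exists_outside_small_sets[of 1 0 "\<lambda>_. {}" "0 :: real ^ 'n" extremal] AE_extremal by auto

lemma closed_linear_form_lower_bound:
  "closed {\<Theta> :: real ^ 'n::finite. c * norm b powr (- \<tau>) \<le> \<bar>of_int a + b \<bullet> \<Theta>\<bar>}"
  by (intro closed_Collect_le continuous_intros)

lemma open_approximable: "open {\<Theta> :: real ^ 'n::finite. norm (of_int q *\<^sub>R \<Theta> - p) < r}"
  by (intro open_Collect_less continuous_intros)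

text \<open>Baire's theorem is applied in \<open>closure D\<close>, as the lower bounds define
  closed sets and the approximations open ones. Members of \<open>D\<close> have some
  \<open>c1 > c0\<close>, a surplus of which each perturbation consumes a part; on the closure the
  bound with \<open>c0\<close> remains.\<close>

lemma exists_jarnik_point:
  fixes w :: real
  assumes w: "w > 1 / real CARD('n::finite)"
  shows "\<exists>\<Theta> :: real ^ 'n. \<exists>c>0.
    (\<forall>a::int. \<forall>b\<in>integral_vectors. b \<noteq> 0 \<longrightarrow>
      c * norm b powr (- (real CARD('n) * (1 + w) - 1)) \<le> \<bar>of_int a + b \<bullet> \<Theta>\<bar>) \<and>
    (\<forall>w'<w. \<forall>M::real. \<exists>q::int. \<exists>p\<in>integral_vectors. of_int q > M \<and>
      norm (of_int q *\<^sub>R \<Theta> - p) \<le> of_int q powr (- w'))"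
proof -
  define n where "n = real CARD('n)"
  have n1: "n \<ge> 1" unfolding n_def by (simp add: Suc_leI)
  define \<tau> where "\<tau> = n * (1 + w) - 1"
  have \<tau>n: "\<tau> - n > 0" using w n1 by (simp add: \<tau>_def n_def field_simps)
  obtain \<Theta>0 :: "real ^ 'n" where ext0: "extremal \<Theta>0" using exists_extremal by blast
  obtain c where c: "c > 0" "\<And>(a::int) b. b \<in> integral_vectors \<Longrightarrow> b \<noteq> 0 \<Longrightarrow>
      c * norm b powr (- \<tau>) \<le> \<bar>of_int a + b \<bullet> \<Theta>0\<bar>"
    using ext0[unfolded extremal_def, rule_format, OF \<tau>n] by (auto simp: n_def)
  define c0 where "c0 = c / 2"
  have c0: "0 < c0" "c0 < c" using c(1) by (auto simp: c0_def)
  define D where "D = {\<Theta> :: real ^ 'n. extremal \<Theta> \<and> (\<exists>c1>c0. \<forall>a::int. \<forall>b\<in>integral_vectors. b \<noteq> 0 \<longrightarrow>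
      c1 * norm b powr (- \<tau>) \<le> \<bar>of_int a + b \<bullet> \<Theta>\<bar>)}"
  have "\<Theta>0 \<in> D" using ext0 c(2) c0(2) by (auto simp: D_def)
  \<comment> \<open>Starts at \<open>1 / n\<close> for \<open>j = 0\<close> and increases to
    \<open>w\<close>, always strictly below it as \<open>perturb_to_approximable\<close>
    demands.\<close>
  define w_seq where "w_seq j = w - (w - 1 / n) / (real j + 1)" for j :: nat
  have w_seq: "1 / n \<le> w_seq j" "w_seq j < w" for j
  proof -
    define t where "t = (w - 1 / n) / (real j + 1)"
    have pos: "0 < w - 1 / n" using w by (simp add: n_def)
    then have "t \<le> (w - 1 / n) / 1" unfolding t_def by (intro divide_left_mono) auto
    then have "t \<le> w - 1 / n" by simp
    moreover have "0 < t" using pos by (simp add: t_def)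
    moreover have "w_seq j = w - t" by (simp add: w_seq_def t_def)
    ultimately show "1 / n \<le> w_seq j" "w_seq j < w" by linarith+
  qed
  define U where "U j = (\<Union>q\<in>{q::int. of_int q > real j}. \<Union>p\<in>integral_vectors.
      {\<Theta> :: real ^ 'n. norm (of_int q *\<^sub>R \<Theta> - p) < of_int q powr (- w_seq j)})" for j
  have openU: "open (U j)" for j
    unfolding U_def by (intro open_UN ballI open_approximable)
  have dense: "D \<subseteq> closure (closure D \<inter> U j)" for j
  proof
    fix \<Theta> assume "\<Theta> \<in> D"
    then obtain c1 where ext: "extremal \<Theta>" and c1: "c0 < c1"
      and lb: "\<And>(a::int) b. b \<in> integral_vectors \<Longrightarrow> b \<noteq> 0 \<Longrightarrow> c1 * norm b powr (- \<tau>) \<le> \<bar>of_int a + b \<bullet> \<Theta>\<bar>"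
      by (auto simp: D_def)
    show "\<Theta> \<in> closure (closure D \<inter> U j)"
      unfolding closure_approachable
    proof (intro allI impI)
      fix \<eta> :: real assume "\<eta> > 0"
      obtain \<Theta>' c2 and q :: int and p where *: "extremal \<Theta>'" "c0 < c2"
        "\<forall>a::int. \<forall>b\<in>integral_vectors. b \<noteq> 0 \<longrightarrow> c2 * norm b powr (- \<tau>) \<le> \<bar>of_int a + b \<bullet> \<Theta>'\<bar>"
        "dist \<Theta>' \<Theta> < \<eta>" "of_int q > real j" "p \<in> integral_vectors"
        "norm (of_int q *\<^sub>R \<Theta>' - p) < of_int q powr (- w_seq j)"
        using perturb_to_approximable[OF ext w_seq[of j, unfolded n_def] \<tau>_def[unfolded n_def] c0(1) c1 lb \<open>\<eta> > 0\<close>, where M = "real j"]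
        by blast
      have "\<Theta>' \<in> D" using * by (auto simp: D_def)
      then have "\<Theta>' \<in> closure D" using closure_subset by blast
      moreover have "\<Theta>' \<in> U j" using *(5,6,7) unfolding U_def by blast
      ultimately show "\<exists>y\<in>closure D \<inter> U j. dist y \<Theta> < \<eta>" using *(4) by blast
    qed
  qed
  have "closure D \<subseteq> closure (\<Inter>(range (\<lambda>j. closure D \<inter> U j)))"
  proof (rule Baire)
    fix T assume "T \<in> range (\<lambda>j. closure D \<inter> U j)"
    then obtain j where T: "T = closure D \<inter> U j" by blast
    show "openin (top_of_set (closure D)) T \<and> closure D \<subseteq> closure T"
      unfolding T using openin_open_Int[OF openU] closure_minimal[OF dense closed_closure] by blast
  qed auto
  then have "\<Inter>(range (\<lambda>j. closure D \<inter> U j)) \<noteq> {}"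
    using \<open>\<Theta>0 \<in> D\<close> closure_subset[of D] by (metis closure_empty empty_iff subsetD)
  then obtain \<Theta> where \<Theta>: "\<Theta> \<in> closure D" "\<And>j. \<Theta> \<in> U j" by blast
  have "c0 * norm b powr (- \<tau>) \<le> \<bar>of_int a + b \<bullet> \<Theta>\<bar>" if "b \<in> integral_vectors" "b \<noteq> 0" for a :: int and b
  proof -
    have "D \<subseteq> {\<Theta>. c0 * norm b powr (- \<tau>) \<le> \<bar>of_int a + b \<bullet> \<Theta>\<bar>}"
    proof
      fix x assume "x \<in> D"
      then obtain c1 where c1: "c0 < c1" "\<forall>a::int. \<forall>b\<in>integral_vectors. b \<noteq> 0 \<longrightarrow>
          c1 * norm b powr (- \<tau>) \<le> \<bar>of_int a + b \<bullet> x\<bar>"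
        unfolding D_def by blast
      have "c1 * norm b powr (- \<tau>) \<le> \<bar>of_int a + b \<bullet> x\<bar>" using c1(2) that by blast
      then show "x \<in> {\<Theta>. c0 * norm b powr (- \<tau>) \<le> \<bar>of_int a + b \<bullet> \<Theta>\<bar>}"
        using mult_right_mono[of c0 c1 "norm b powr (- \<tau>)"] c1(1) by simp
    qed
    then have "closure D \<subseteq> {\<Theta>. c0 * norm b powr (- \<tau>) \<le> \<bar>of_int a + b \<bullet> \<Theta>\<bar>}"
      by (rule closure_minimal[OF _ closed_linear_form_lower_bound])
    then show ?thesis using \<Theta>(1) by blast
  qed
  moreover have "\<exists>q::int. \<exists>p\<in>integral_vectors. of_int q > M \<and>
      norm (of_int q *\<^sub>R \<Theta> - p) \<le> of_int q powr (- w')" if "w' < w" for w' M :: real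
  proof -
    obtain j :: nat where j: "max M ((w - 1 / n) / (w - w')) < real j"
      using reals_Archimedean2 by blast
    obtain q :: int and p where q: "of_int q > real j" "p \<in> integral_vectors"
      "norm (of_int q *\<^sub>R \<Theta> - p) < of_int q powr (- w_seq j)"
      using \<Theta>(2)[of j] unfolding U_def by blast
    have "(w - 1 / n) / (real j + 1) \<le> w - w'"
      using j that by (simp add: field_simps)
    then have "- w_seq j \<le> - w'" by (simp add: w_seq_def)
    moreover have "real_of_int q > 0" using q(1) of_nat_0_le_iff order_le_less_trans by blast
    then have "1 \<le> q" by simp
    then have "1 \<le> real_of_int q" by simp
    ultimately have "of_int q powr (- w_seq j) \<le> of_int q powr (- w')" by (intro powr_mono) linarith+
    then show ?thesis using q j by (intro exI[of _ q] bexI[of _ p]) auto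
  qed
  ultimately show ?thesis using c0(1) unfolding \<tau>_def n_def by blast
qed

section \<open>Liouville points and the full spectrum\<close>

lemma countable_integral_vectors: "countable (integral_vectors :: (real ^ 'i::finite) set)"
proof -
  have "integral_vectors = (\<Union>k::nat. {x :: real ^ 'i. x \<in> integral_vectors \<and> norm x \<le> real k})"
    using real_arch_simple by auto
  then show ?thesis
  proof (rule countable_subset[OF equalityD1])
    have "countable {x :: real ^ 'i. x \<in> integral_vectors \<and> norm x \<le> real k}" for k
      by (rule countable_finite[OF finite_integral_vectors])
    then show "countable (\<Union>k::nat. {x :: real ^ 'i. x \<in> integral_vectors \<and> norm x \<le> real k})"
      by (intro countable_UN) auto
  qed
qed

text \<open>Two countable families of dense open sets: \<open>U j\<close> contains every rational
  point, whose denominator can be enlarged beyond \<open>j\<close>, and \<open>H y\<close> avoids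
  the zeros of an integral linear form. The second family excludes the rational points
  themselves.\<close>

lemma exists_liouville_point:
  "\<exists>\<Theta> :: real ^ 'n::finite. one_and_coords_lin_indep_rat \<Theta> \<and>
    (\<forall>w M :: real. \<exists>q::int. \<exists>p\<in>integral_vectors. of_int q > M \<and>
      norm (of_int q *\<^sub>R \<Theta> - p) \<le> of_int q powr (- w))"
proof -
  define U where "U j = (\<Union>q\<in>{q::int. of_int q > real j}. \<Union>p\<in>integral_vectors.
      {\<Theta> :: real ^ 'n. norm (of_int q *\<^sub>R \<Theta> - p) < of_int q powr (- real j)})" for j :: nat
  define H where "H y = {\<Theta> :: real ^ 'n. y \<bullet> homog \<Theta> \<noteq> 0}" for y
  let ?G = "range U \<union> H ` (integral_vectors - {0})"
  have openU: "open (U j)" for j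
    unfolding U_def by (intro open_UN ballI open_approximable)
  have denseU: "closure (U j) = UNIV" for j
  proof (intro set_eqI iffI UNIV_I, unfold closure_approachable, intro allI impI)
    fix \<Theta> :: "real ^ 'n" and \<eta> :: real assume \<eta>: "\<eta> > 0"
    obtain q0 :: nat where q0: "max (real j) (CARD('n) / \<eta>) < real q0" using reals_Archimedean2 by blast
    define p where "p = (\<chi> i. real_of_int \<lfloor>real q0 * \<Theta> $ i\<rfloor>)"
    let ?x = "(1 / real q0) *\<^sub>R p"
    have q0_pos: "real q0 > 0" using q0 by (metis max_less_iff_conj of_nat_0_le_iff order_le_less_trans)
    have "norm (real q0 *\<^sub>R \<Theta> - p) \<le> (\<Sum>i\<in>UNIV. \<bar>(real q0 *\<^sub>R \<Theta> - p) $ i\<bar>)"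
      by (rule norm_le_l1_cart)
    also have "\<dots> \<le> (\<Sum>i\<in>(UNIV :: 'n set). 1)"
    proof (rule sum_mono)
      fix i show "\<bar>(real q0 *\<^sub>R \<Theta> - p) $ i\<bar> \<le> 1"
        unfolding p_def by simp linarith
    qed
    finally have "norm (real q0 *\<^sub>R \<Theta> - p) \<le> CARD('n)" by simp
    moreover have "real q0 *\<^sub>R \<Theta> - p = real q0 *\<^sub>R (\<Theta> - ?x)"
      using q0_pos by (simp add: algebra_simps)
    ultimately have "real q0 * norm (\<Theta> - ?x) \<le> CARD('n)" by simp
    also have "\<dots> < real q0 * \<eta>" using q0 \<eta> by (simp add: field_simps)
    finally have "dist ?x \<Theta> < \<eta>" using q0_pos by (simp add: dist_norm norm_minus_commute)
    moreover have "?x \<in> U j"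
    proof -
      have "p \<in> integral_vectors" by (simp add: p_def)
      moreover have "norm (of_int (int q0) *\<^sub>R ?x - p) < of_int (int q0) powr (- real j)"
        using q0_pos by simp
      moreover have "real j < of_int (int q0)" using q0 by simp
      ultimately show ?thesis unfolding U_def by blast
    qed
    ultimately show "\<exists>x\<in>U j. dist x \<Theta> < \<eta>" by blast
  qed
  have openH: "open (H y)" for y
    unfolding H_def inner_homog_split by (intro open_Collect_neq continuous_intros)
  have denseH: "closure (H y) = UNIV" if y: "y \<noteq> 0" for y
  proof (intro set_eqI iffI UNIV_I, unfold closure_approachable, intro allI impI)
    fix \<Theta> :: "real ^ 'n" and \<eta> :: real assume \<eta>: "\<eta> > 0"
    define b where "b = (\<chi> i. y $ Some i)"
    show "\<exists>x\<in>H y. dist x \<Theta> < \<eta>"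
    proof (cases "\<Theta> \<in> H y")
      case False
      then have zero: "y $ None + b \<bullet> \<Theta> = 0" by (simp add: H_def inner_homog_split b_def)
      have "b \<noteq> 0"
      proof
        assume "b = 0"
        then have "y $ Some i = 0" for i by (simp add: b_def vec_eq_iff)
        moreover have "y $ None = 0" using zero \<open>b = 0\<close> by simp
        ultimately have "y $ j = 0" for j by (cases j) auto
        then show False using y by (simp add: vec_eq_iff)
      qed
      define x where "x = \<Theta> + (\<eta> / (2 * norm b)) *\<^sub>R b"
      have "y \<bullet> homog x = \<eta> / (2 * norm b) * (b \<bullet> b)"
        using zero by (simp add: inner_homog_split x_def inner_add_right flip: b_def)
      then have "x \<in> H y" using \<eta> \<open>b \<noteq> 0\<close> by (simp add: H_def)
      moreover have "dist x \<Theta> < \<eta>" using \<eta> \<open>b \<noteq> 0\<close> by (simp add: x_def dist_norm)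
      ultimately show ?thesis by blast
    next
      case True
      then show ?thesis using \<eta> by (intro bexI[of _ \<Theta>]) auto
    qed
  qed
  have "UNIV \<subseteq> closure (\<Inter>?G)"
  proof (rule Baire)
    show "countable ?G"
      using countable_integral_vectors by (intro countable_Un countable_image countable_Diff) auto
    fix T assume "T \<in> ?G"
    then show "openin (top_of_set UNIV) T \<and> UNIV \<subseteq> closure T"
      using openU denseU openH denseH by auto
  qed auto
  then have "\<Inter>?G \<noteq> {}" by (metis closure_empty empty_not_UNIV top.extremum_unique)
  then obtain \<Theta> where \<Theta>: "\<And>j. \<Theta> \<in> U j" "\<And>y. y \<in> integral_vectors \<Longrightarrow> y \<noteq> 0 \<Longrightarrow> \<Theta> \<in> H y" by blast
  have "one_and_coords_lin_indep_rat \<Theta>"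
    using \<Theta>(2) unfolding lin_indep_rat_iff H_def by blast
  moreover have "\<exists>q::int. \<exists>p\<in>integral_vectors. of_int q > M \<and>
      norm (of_int q *\<^sub>R \<Theta> - p) \<le> of_int q powr (- w)" for w M :: real
  proof -
    obtain j :: nat where j: "max M w < real j" using reals_Archimedean2 by blast
    obtain q :: int and p where q: "of_int q > real j" "p \<in> integral_vectors"
      "norm (of_int q *\<^sub>R \<Theta> - p) < of_int q powr (- real j)"
      using \<Theta>(1)[of j] unfolding U_def by blast
    have "real_of_int q > 0" using q(1) of_nat_0_le_iff order_le_less_trans by blast
    then have "1 \<le> q" by simp
    then have "1 \<le> real_of_int q" by simp
    then have "of_int q powr (- real j) \<le> of_int q powr (- w)" using j by (intro powr_mono) linarith+
    then show ?thesis using q j by (intro exI[of _ q] bexI[of _ p]) auto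
  qed
  ultimately show ?thesis by blast
qed

text \<open>The lower bound applies with every exponent \<open>t \<ge> 0\<close> and is at least
  \<open>t\<close>, because \<open>CARD('n) - d \<le> CARD('n)\<close>.\<close>

lemma omega_eq_infinity_attained:
  assumes d: "d < CARD('n::{finite,linorder})"
  shows "\<exists>\<Theta> :: real ^ 'n::{finite,linorder}. one_and_coords_lin_indep_rat \<Theta> \<and> omega d \<Theta> = \<infinity>"
proof -
  obtain \<Theta> :: "real ^ 'n::{finite,linorder}" where ind: "one_and_coords_lin_indep_rat \<Theta>"
    and approx: "\<And>w M :: real. \<exists>q::int. \<exists>p\<in>integral_vectors. of_int q > M \<and>
      norm (of_int q *\<^sub>R \<Theta> - p) \<le> of_int q powr (- w)"
    using exists_liouville_point by blast
  have "ereal t \<le> omega d \<Theta>" if t: "t \<ge> 0" for t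
  proof -
    let ?m = "real CARD('n) - real d"
    have m: "?m > 0" "?m \<le> real CARD('n)" using d by auto
    have "ereal (real CARD('n) * (1 + t) / ?m - 1) \<le> omega d \<Theta>"
      by (rule omega_ge_approximable[OF d ind t zero_less_one]) (use approx in simp)
    moreover have "t \<le> real CARD('n) * (1 + t) / ?m - 1"
    proof -
      have "?m * (1 + t) \<le> real CARD('n) * (1 + t)" using m t by (intro mult_right_mono) auto
      then show ?thesis using m by (simp add: field_simps)
    qed
    ultimately show ?thesis by (meson ereal_less_eq(3) order_trans)
  qed
  then have "omega d \<Theta> = \<infinity>"
    by (intro ereal_top) (meson linear max.cobounded1 max.cobounded2 ereal_less_eq(3) order_trans)
  then show ?thesis using ind by blast
qed

text \<open>\<open>w\<close> is chosen so that the lower bound for approximation exponent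
  \<open>w\<close> is \<open>s\<close>; the condition on \<open>s\<close> then says
  \<open>w > 1 / CARD('n)\<close>. The linear forms of a point from
  \<open>exists_jarnik_point\<close> give the upper bound \<open>s\<close> as well.\<close>

lemma omega_value_attained:
  assumes d: "d < CARD('n::{finite,linorder})"
    and s: "(real d + 1) / (real CARD('n) - real d) < s"
  shows "\<exists>\<Theta> :: real ^ 'n::{finite,linorder}. one_and_coords_lin_indep_rat \<Theta> \<and> omega d \<Theta> = ereal s"
proof -
  let ?n = "real CARD('n)" and ?m = "real CARD('n) - real d"
  have m: "?m > 0" and n: "?n > 0" using d by auto
  define w where "w = ?m * (1 + s) / ?n - 1"
  have s_w: "?n * (1 + w) / ?m - 1 = s" using m n by (simp add: w_def)
  have "real d + 1 < s * ?m" using s m by (simp add: pos_divide_less_eq)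
  then have w: "w > 1 / ?n" using n by (simp add: w_def field_simps)
  then have w0: "w > 0" using n by (meson divide_pos_pos less_trans zero_less_one)
  obtain \<Theta> :: "real ^ 'n::{finite,linorder}" and c where c: "c > 0"
    and lb: "\<And>(a::int) b. b \<in> integral_vectors \<Longrightarrow> b \<noteq> 0 \<Longrightarrow> c * norm b powr (- (?n * (1 + w) - 1)) \<le> \<bar>of_int a + b \<bullet> \<Theta>\<bar>"
    and approx: "\<And>w' M :: real. w' < w \<Longrightarrow> \<exists>q::int. \<exists>p\<in>integral_vectors. of_int q > M \<and>
      norm (of_int q *\<^sub>R \<Theta> - p) \<le> of_int q powr (- w')"
    using exists_jarnik_point[OF w] by blast
  have \<tau>: "?n * (1 + w) - 1 \<ge> 0"
  proof -
    have "?n \<ge> 1" by (simp add: Suc_leI)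
    then have "1 * 1 \<le> ?n * (1 + w)" using w0 by (intro mult_mono) auto
    then show ?thesis by simp
  qed
  have ind: "one_and_coords_lin_indep_rat \<Theta>"
    using linear_form_lower_bound_lin_indep[OF c \<tau> lb] .
  have "omega d \<Theta> \<le> ereal ((1 + (?n * (1 + w) - 1)) / ?m - 1)"
    using omega_le_linear_form[OF d c \<tau> lb] .
  then have upper: "omega d \<Theta> \<le> ereal s" using s_w by simp
  have lower: "ereal s \<le> omega d \<Theta>"
  proof (rule ereal_le_epsilon2)
    fix \<epsilon> :: real assume \<epsilon>: "\<epsilon> > 0"
    \<comment> \<open>The approximations are available for exponents below \<open>w\<close> only, so
      \<open>s\<close> is reached up to \<open>\<epsilon>\<close>. The maximum with 0 meets the sign
      condition of the lower bound.\<close>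
    define w' where "w' = max 0 (w - \<epsilon> * ?m / ?n)"
    have w': "w' \<ge> 0" "w' < w" "w - \<epsilon> * ?m / ?n \<le> w'" using w0 \<epsilon> m n by (auto simp: w'_def)
    have "ereal (?n * (1 + w') / ?m - 1) \<le> omega d \<Theta>"
      by (rule omega_ge_approximable[OF d ind w'(1) zero_less_one]) (use approx[OF w'(2)] in simp)
    moreover have "s \<le> ?n * (1 + w') / ?m - 1 + \<epsilon>"
    proof -
      have "?n * (1 + (w - \<epsilon> * ?m / ?n)) / ?m = ?n * (1 + w) / ?m - \<epsilon>" using m n by (simp add: field_simps)
      moreover have "?n * (1 + (w - \<epsilon> * ?m / ?n)) / ?m \<le> ?n * (1 + w') / ?m"
        using w'(3) m n by (intro divide_right_mono mult_left_mono) auto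
      ultimately show ?thesis using s_w by linarith
    qed
    then have "ereal s \<le> ereal (?n * (1 + w') / ?m - 1) + ereal \<epsilon>" by simp
    ultimately show "ereal s \<le> omega d \<Theta> + ereal \<epsilon>"
      by (meson add_right_mono order_trans)
  qed
  show ?thesis using upper lower ind by (intro exI[of _ \<Theta>]) auto
qed

theorem mainTheorem2:
  fixes d :: nat
  assumes "d \<le> CARD('n::{finite,linorder}) - 1"
  shows "(\<forall>\<Theta> :: real ^ ('n::{finite,linorder}). one_and_coords_lin_indep_rat \<Theta> \<longrightarrow>
            omega d \<Theta> \<ge> ereal ((real d + 1) / (real CARD('n) - real d)))
       \<and> (AE \<Theta> :: real ^ ('n::{finite,linorder}) in lebesgue.
            omega d \<Theta> = ereal ((real d + 1) / (real CARD('n) - real d)))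
       \<and> {omega d \<Theta> | \<Theta> :: real ^ ('n::{finite,linorder}). one_and_coords_lin_indep_rat \<Theta>}
            = {ereal ((real d + 1) / (real CARD('n) - real d)) .. \<infinity>}"
proof -
  have "CARD('n) > 0" by simp
  then have d: "d < CARD('n)" using assms by linarith
  let ?s = "(real d + 1) / (real CARD('n) - real d)"
  have lower: "omega d \<Theta> \<ge> ereal ?s" if "one_and_coords_lin_indep_rat \<Theta>" for \<Theta> :: "real ^ 'n::{finite,linorder}"
    using that by (rule omega_ge_lin_indep[OF d])
  have eq: "omega d \<Theta> = ereal ?s" if "extremal \<Theta>" for \<Theta> :: "real ^ 'n::{finite,linorder}"
    using omega_le_extremal[OF d that] lower[OF extremal_lin_indep[OF that]] by (rule antisym)
  have "AE \<Theta> :: real ^ 'n::{finite,linorder} in lebesgue. omega d \<Theta> = ereal ?s"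
    using AE_extremal by (rule eventually_mono) (rule eq)
  moreover have attained: "\<exists>\<Theta> :: real ^ 'n::{finite,linorder}. one_and_coords_lin_indep_rat \<Theta> \<and> omega d \<Theta> = x"
    if x: "ereal ?s \<le> x" for x
  proof (cases x)
    case (real s)
    then consider "?s < s" | "s = ?s" using x by force
    then show ?thesis
    proof cases
      case 1
      then show ?thesis using omega_value_attained[OF d] real by blast
    next
      \<comment> \<open>The endpoint would correspond to \<open>w = 1 / CARD('n)\<close>, which the
        construction of the other values excludes; extremal points attain it.\<close>
      case 2
      obtain \<Theta> :: "real ^ 'n::{finite,linorder}" where "extremal \<Theta>" using exists_extremal by blast
      then show ?thesis using eq extremal_lin_indep 2 real by blast
    qed
  next
    case PInf
    then show ?thesis using omega_eq_infinity_attained[OF d] by simp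
  qed (use x in simp)
  moreover have "{omega d \<Theta> | \<Theta> :: real ^ 'n::{finite,linorder}. one_and_coords_lin_indep_rat \<Theta>} = {ereal ?s .. \<infinity>}"
  proof (intro equalityI subsetI)
    fix x assume "x \<in> {omega d \<Theta> | \<Theta> :: real ^ 'n::{finite,linorder}. one_and_coords_lin_indep_rat \<Theta>}"
    then show "x \<in> {ereal ?s .. \<infinity>}" using lower by auto
  next
    fix x assume "x \<in> {ereal ?s .. \<infinity>}"
    then obtain \<Theta> :: "real ^ 'n::{finite,linorder}" where "one_and_coords_lin_indep_rat \<Theta>" "omega d \<Theta> = x"
      using attained[of x] by auto
    then show "x \<in> {omega d \<Theta> | \<Theta> :: real ^ 'n::{finite,linorder}. one_and_coords_lin_indep_rat \<Theta>}" by blast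
  qed
  ultimately show ?thesis using lower by blast
qed

end
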